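(* Let $a,b,c\in\mathbb{R}$ satisfy $0<a<c<b$, $b+c-a=1$ and $c<2a$. Put $$\kappa=\frac{\eta}{2\pi},\qquad \eta=2\Big(\frac{a^{a}}{b^{b}c^{c}}\Big)^{1/(b+c-a)}\quad\Big(\text{so that }\kappa=\frac{a^{a}}{\pi\, b^{b}c^{c}}\Big),$$ let $\omega(h,n,m)=h^{-1/2+b/2}n^{-1/2+c/2}m^{-1/2-a/2}$, and for $T>0$ let $$\mathcal{D}_{T}=\Big\{(h,n,m)\in\mathbb{N}^{3}:\ (hnm)^{2/3}(abc)^{-1/3}\leq h^{b}n^{c}m^{-a}\leq T\Big\}.$$ Then for all sufficiently large $T$, $$\sum_{(h,n,m)\in\mathcal{D}_{T}}\omega(h,n,m)\,e\big(\kappa h^{b}n^{c}m^{-a}\big)\ll T^{5/4-c/(4a)}+T^{1/4+(2a-c)/(2(b-c))},$$ where the implied constant depends only on $a,b,c$.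
   Context: $e(x)=e^{2\pi i x}$; $\mathbb{N}=\{1,2,3,\dots\}$; $f\ll g$ means $|f|\leq Cg$ for a constant $C$. *)

theory Defs
  imports Complex_Main
begin

definition e :: "real \<Rightarrow> complex" where
  "e x = exp (2 * of_real pi * \<i> * of_real x)"

definition eta :: "real \<Rightarrow> real \<Rightarrow> real \<Rightarrow> real" where
  "eta a b c = 2 * (a powr a / (b powr b * c powr c)) powr (1 / (b + c - a))"

definition kappa :: "real \<Rightarrow> real \<Rightarrow> real \<Rightarrow> real" where
  "kappa a b c = eta a b c / (2 * pi)"

lemma kappa_eq:
  assumes "0 < a" "0 < b" "0 < c" "b + c - a = 1"
  shows "kappa a b c = a powr a / (pi * b powr b * c powr c)"
  using assms by (simp add: kappa_def eta_def field_simps)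

definition monom_phase :: "real \<Rightarrow> real \<Rightarrow> real \<Rightarrow> nat \<times> nat \<times> nat \<Rightarrow> real" where
  "monom_phase a b c = (\<lambda>(h, n, m). real h powr b * real n powr c * real m powr (- a))"

definition omega :: "real \<Rightarrow> real \<Rightarrow> real \<Rightarrow> nat \<times> nat \<times> nat \<Rightarrow> real" where
  "omega a b c = (\<lambda>(h, n, m).
     real h powr (- 1/2 + b/2) * real n powr (- 1/2 + c/2) * real m powr (- 1/2 - a/2))"

definition D :: "real \<Rightarrow> real \<Rightarrow> real \<Rightarrow> real \<Rightarrow> (nat \<times> nat \<times> nat) set" where
  "D a b c T = {(h, n, m). 1 \<le> h \<and> 1 \<le> n \<and> 1 \<le> m \<and>
     (real h * real n * real m) powr (2/3) * (a * b * c) powr (- 1/3) \<le> monom_phase a b c (h, n, m) \<and>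
     monom_phase a b c (h, n, m) \<le> T}"

text \<open>The index set is finite, so the sum over it is a genuine sum and not the
  default value that \<^const>\<open>sum\<close> takes on infinite sets.\<close>

lemma finite_D:
  assumes "0 < a" "0 < b" "0 < c"
  shows "finite (D a b c T)"
proof -
  define q where "q = (a * b * c) powr (- 1/3)"
  have q: "q > 0" using assms by (simp add: q_def)
  define N where "N = nat \<lceil>(T / q) powr (3/2)\<rceil>"
  have "D a b c T \<subseteq> {..N} \<times> {..N} \<times> {..N}"
  proof
    fix p assume p: "p \<in> D a b c T"
    obtain h n m where hnm: "p = (h, n, m)" by (cases p)
    have pos: "1 \<le> h" "1 \<le> n" "1 \<le> m"
      and le: "(real h * real n * real m) powr (2/3) * q \<le> T"
      using p by (auto simp: D_def q_def hnm)
    let ?P = "h * n * m"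
    have "real ?P powr (2/3) \<le> T / q"
      using le q by (simp add: field_simps)
    then have "(real ?P powr (2/3)) powr (3/2) \<le> (T / q) powr (3/2)"
      by (intro powr_mono2) auto
    moreover have "(real ?P powr (2/3)) powr (3/2) = real ?P"
      by (subst powr_powr) simp
    ultimately have "real ?P \<le> (T / q) powr (3/2)" by metis
    then have PN: "?P \<le> N" unfolding N_def by linarith
    have "h \<le> ?P" "n \<le> ?P" "m \<le> ?P"
      using pos by auto
    then show "p \<in> {..N} \<times> {..N} \<times> {..N}"
      using PN unfolding hnm by (metis (no_types) SigmaI atMost_iff le_trans)
  qed
  then show ?thesis by (rule finite_subset) auto
qed

end

theory Submission
  imports Defs "HOL-Analysis.Analysis" "HOL-Library.Discrete_Functions"
begin

text \<open>
  Fix \<open>m\<close> and restrict \<open>h \<sim> H\<close>, \<open>n \<sim> N\<close> to dyadic ranges, on which the phase has size \<open>Z\<close>.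
  Abel summation removes the weights. If \<open>Z > H\<^sup>2\<close>, the second derivative test in \<open>n\<close> suffices.
  If \<open>Z \<le> H\<^sup>2\<close>, Poisson summation in \<open>h\<close> gives for each \<open>n\<close> the integrals of
  \<open>e (Q n\<^sup>c t\<^sup>b - k t)\<close> over the frequencies \<open>k\<close>. Those without a stationary point are harmless. For
  the \<open>O (Z / H)\<close> others no stationary phase expansion is needed: in the variable
  \<open>w = t / h\<^sub>k(n)\<close>, where \<open>h\<^sub>k(n)\<close> is the stationary point, the phase is a function of \<open>w\<close> times a
  monomial in \<open>n\<close>, so integration by parts concentrates the mass on \<open>|w - 1| \<lesssim> Z\<^sup>-\<^sup>1\<^sup>/\<^sup>2\<close>, and for each
  fixed \<open>w\<close> the sum over \<open>n\<close> is bounded by the second derivative test. A box then contributes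
  \<open>(H N / m)\<^sup>1\<^sup>/\<^sup>2\<close> and, if \<open>H \<lesssim> Z\<close>, also \<open>Z\<^sup>3\<^sup>/\<^sup>2 (H N m)\<^sup>-\<^sup>1\<^sup>/\<^sup>2\<close>, up to logarithms. Since
  \<open>H N m \<lesssim> Z\<^sup>3\<^sup>/\<^sup>2\<close>, both are \<open>\<lesssim> T\<^sup>E / m\<close> with \<open>E = 3/4 + (2a - c) / (2(a + c))\<close>, which is smaller than
  \<open>5/4 - c / (4a) = 3/4 + (2a - c) / (4a)\<close>; the gap absorbs the logarithms.
\<close>

section \<open>Oscillatory integrals\<close>

text \<open>A stationary point may lie anywhere relative to the ends of the \<open>h\<close>-range,
  so a stationary phase expansion would need errors uniform up to the boundary. Rescaling by
  \<open>h_k(n)\<close> puts every stationary point at \<open>w = 1\<close>; the ends of the range,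
  which depend on \<open>n\<close>, become for fixed \<open>w\<close> a condition on
  \<open>n\<close>. Hence regions must meet the curves of constant \<open>w\<close> in intervals. On
  such a curve the phase is a multiple of \<open>n powr (c / (1 - b))\<close>, and
  \<open>b + c = 1 + a > 1\<close> makes this exponent exceed 1, so its second derivative does not
  vanish. The cut at \<open>Z = H^2\<close> is where the second derivative in \<open>h\<close>, of
  size \<open>Z / H^2\<close>, stops being bounded; its boundedness makes Poisson summation up to
  arbitrary real endpoints cheap. The origin of \<open>E\<close>: the second contribution is
  \<open>Z powr (3/2) * sqrt (m / (H * N)) / m\<close>. As a monomial in \<open>Z\<close>,
  \<open>H\<close> and \<open>H * N * m\<close>, the quotient \<open>m / (H * N)\<close> has
  positive exponents in the last two because \<open>c < b\<close> and \<open>a < c\<close>.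
  Inserting \<open>H \<lesssim> Z\<close> and \<open>H * N * m \<lesssim> Z powr (3/2)\<close>
  yields exactly \<open>E\<close>.\<close>

lemma norm_e [simp]: "norm (e x) = 1"
  by (simp add: e_def)

lemma e_add: "e (x + y) = e x * e y"
  by (simp add: e_def exp_add algebra_simps)

lemma e_minus: "e (- x) = cnj (e x)"
  by (simp add: e_def exp_cnj)

lemma e_of_int [simp]: "e (of_int k) = 1"
  using exp_two_pi_i' by (simp add: e_def exp_eq_1)

lemma e_has_vector_derivative:
  assumes "(F has_real_derivative f) (at t within S)"
  shows "((\<lambda>t. e (F t)) has_vector_derivative (2 * pi * f) *\<^sub>R (\<i> * e (F t))) (at t within S)"
proof -
  have "((\<lambda>x. 2 * of_real pi * \<i> * complex_of_real (F x)) has_vector_derivative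
      2 * of_real pi * \<i> * of_real f) (at t within S)"
    by (intro has_vector_derivative_mult_right has_vector_derivative_of_real assms)
  from field_vector_diff_chain_within[OF this, of exp, OF DERIV_subset[OF DERIV_exp]]
  have "((\<lambda>t. exp (2 * of_real pi * \<i> * complex_of_real (F t))) has_vector_derivative
      2 * of_real pi * \<i> * of_real f * exp (2 * of_real pi * \<i> * complex_of_real (F t))) (at t within S)"
    by (simp add: o_def)
  then show ?thesis
    by (simp add: e_def scaleR_conv_of_real algebra_simps)
qed

lemma continuous_on_e [continuous_intros]:
  "continuous_on S F \<Longrightarrow> continuous_on S (\<lambda>t. e (F t))"
  unfolding e_def by (intro continuous_intros)

lemma has_real_derivative_imp_continuous_on:
  assumes "\<And>t. t \<in> S \<Longrightarrow> (F has_real_derivative f t) (at t within S)"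
  shows "continuous_on S F"
  using assms DERIV_continuous continuous_on_eq_continuous_within by blast

lemma real_FTC:
  fixes F f :: "real \<Rightarrow> real"
  assumes "u \<le> v"
    and "\<And>t. t \<in> {u..v} \<Longrightarrow> (F has_real_derivative f t) (at t within {u..v})"
  shows "(f has_integral (F v - F u)) {u..v}"
  by (rule fundamental_theorem_of_calculus[OF assms(1)])
    (use assms(2) in \<open>simp flip: has_real_derivative_iff_has_vector_derivative\<close>)

text \<open>Since \<open>f * e F\<close> is the derivative of \<open>e F\<close> up to the factor
  \<open>2 * pi * \<i>\<close>, an amplitude can be integrated by parts once it is written as a
  multiple of \<open>f\<close>. The applications differ only in the quotient \<open>R\<close>:
  \<open>1 / f\<close>, \<open>f / (\<delta> + f^2)\<close>, \<open>1 / (f \<plusminus> k)\<close>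
  and later \<open>tau\<close>.\<close>

lemma integral_e_by_parts:
  fixes F f R R' :: "real \<Rightarrow> real"
  assumes uv: "u \<le> v"
    and F: "\<And>t. t \<in> {u..v} \<Longrightarrow> (F has_real_derivative f t) (at t within {u..v})"
    and R: "\<And>t. t \<in> {u..v} \<Longrightarrow> (R has_real_derivative R' t) (at t within {u..v})"
    and cf: "continuous_on {u..v} f" and cR': "continuous_on {u..v} R'"
  shows "integral {u..v} (\<lambda>t. of_real (R t * f t) * e (F t)) =
     (of_real (R v) * e (F v) - of_real (R u) * e (F u)
        - integral {u..v} (\<lambda>t. of_real (R' t) * e (F t))) / (2 * pi * \<i>)"
proof -
  have cF: "continuous_on {u..v} F" and cR: "continuous_on {u..v} R"
    using F R has_real_derivative_imp_continuous_on by blast+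
  let ?g = "\<lambda>t. of_real (R' t) * e (F t) + (2 * pi * \<i>) * (of_real (R t * f t) * e (F t))"
  have "((\<lambda>t. R t *\<^sub>R e (F t)) has_vector_derivative ?g t) (at t within {u..v})"
    if "t \<in> {u..v}" for t
    using has_vector_derivative_scaleR[OF R[OF that] e_has_vector_derivative[OF F[OF that]]]
    by (simp add: scaleR_conv_of_real algebra_simps)
  then have 1: "(?g has_integral (R v *\<^sub>R e (F v) - R u *\<^sub>R e (F u))) {u..v}"
    using fundamental_theorem_of_calculus[OF uv, of "\<lambda>t. R t *\<^sub>R e (F t)" ?g] by blast
  have i1: "(\<lambda>t. of_real (R' t) * e (F t)) integrable_on {u..v}"
    by (intro integrable_continuous_interval continuous_intros cF cR')
  have i2: "(\<lambda>t. of_real (R t * f t) * e (F t)) integrable_on {u..v}"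
    by (intro integrable_continuous_interval continuous_intros cF cR cf)
  have "integral {u..v} ?g = integral {u..v} (\<lambda>t. of_real (R' t) * e (F t))
      + (2 * pi * \<i>) * integral {u..v} (\<lambda>t. of_real (R t * f t) * e (F t))"
    by (subst integral_add) (use i1 i2 in \<open>auto intro!: integrable_on_mult_right\<close>)
  then show ?thesis
    using integral_unique[OF 1] by (simp add: field_simps scaleR_conv_of_real)
qed

text \<open>The majorant \<open>G\<close> is passed together with its integral \<open>B\<close>, so
  that the variation of \<open>R\<close> can be read off an antiderivative, by telescoping or by an
  arctangent.\<close>

lemma norm_integral_e_by_parts_le:
  fixes F f R R' G :: "real \<Rightarrow> real"
  assumes uv: "u \<le> v"
    and F: "\<And>t. t \<in> {u..v} \<Longrightarrow> (F has_real_derivative f t) (at t within {u..v})"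
    and R: "\<And>t. t \<in> {u..v} \<Longrightarrow> (R has_real_derivative R' t) (at t within {u..v})"
    and cf: "continuous_on {u..v} f" and cR': "continuous_on {u..v} R'"
    and G: "(G has_integral B) {u..v}" and GR: "\<And>t. t \<in> {u..v} \<Longrightarrow> \<bar>R' t\<bar> \<le> G t"
  shows "norm (integral {u..v} (\<lambda>t. of_real (R t * f t) * e (F t))) \<le> (\<bar>R u\<bar> + \<bar>R v\<bar> + B) / (2 * pi)"
proof -
  have cF: "continuous_on {u..v} F"
    using F has_real_derivative_imp_continuous_on by blast
  have eq: "integral {u..v} (\<lambda>t. of_real (R t * f t) * e (F t)) =
     (of_real (R v) * e (F v) - of_real (R u) * e (F u)
        - integral {u..v} (\<lambda>t. of_real (R' t) * e (F t))) / (2 * pi * \<i>)"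
    by (rule integral_e_by_parts[OF uv F R cf cR'])
  have "norm (integral {u..v} (\<lambda>t. of_real (R' t) * e (F t))) \<le> integral {u..v} G"
  proof (rule integral_norm_bound_integral)
    show "(\<lambda>t. of_real (R' t) * e (F t)) integrable_on {u..v}"
      by (intro integrable_continuous_interval continuous_intros cF cR')
    show "G integrable_on {u..v}" using G by blast
  qed (use GR in \<open>simp add: norm_mult\<close>)
  then have "norm (integral {u..v} (\<lambda>t. of_real (R' t) * e (F t))) \<le> B"
    using integral_unique[OF G] by simp
  moreover have "norm (of_real (R v) * e (F v) - of_real (R u) * e (F u)
        - integral {u..v} (\<lambda>t. of_real (R' t) * e (F t))) \<le>
      norm (of_real (R v) * e (F v)) + norm (of_real (R u) * e (F u))
        + norm (integral {u..v} (\<lambda>t. of_real (R' t) * e (F t)))"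
    by (meson add_right_mono norm_triangle_ineq4 order_trans)
  ultimately have "norm (of_real (R v) * e (F v) - of_real (R u) * e (F u)
        - integral {u..v} (\<lambda>t. of_real (R' t) * e (F t))) \<le> \<bar>R u\<bar> + \<bar>R v\<bar> + B"
    by (simp add: norm_mult)
  then show ?thesis
    unfolding eq by (simp add: norm_divide norm_mult divide_right_mono)
qed

text \<open>With \<open>R = 1 / f\<close> the derivative \<open>R'\<close> has constant sign, so the
  variation of \<open>R\<close> telescopes to its endpoint values and the length of the interval
  does not enter. The sign \<open>\<sigma>\<close> covers increasing and decreasing \<open>f\<close>
  at once.\<close>

lemma first_derivative_test:
  fixes F f f' :: "real \<Rightarrow> real"
  assumes uv: "u \<le> v"
    and F: "\<And>t. t \<in> {u..v} \<Longrightarrow> (F has_real_derivative f t) (at t within {u..v})"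
    and f: "\<And>t. t \<in> {u..v} \<Longrightarrow> (f has_real_derivative f' t) (at t within {u..v})"
    and cf': "continuous_on {u..v} f'"
    and sg: "\<bar>\<sigma>\<bar> = (1::real)" "\<And>t. t \<in> {u..v} \<Longrightarrow> 0 \<le> \<sigma> * f' t"
    and mu: "0 < \<mu>" "\<And>t. t \<in> {u..v} \<Longrightarrow> \<mu> \<le> \<bar>f t\<bar>"
  shows "norm (integral {u..v} (\<lambda>t. e (F t))) \<le> 1 / \<mu>"
proof -
  have cf: "continuous_on {u..v} f"
    using f has_real_derivative_imp_continuous_on by blast
  have nz: "f t \<noteq> 0" if "t \<in> {u..v}" for t
    using mu(1) mu(2)[OF that] by auto
  define R where "R = (\<lambda>t. 1 / f t)"
  define R' where "R' = (\<lambda>t. - f' t / (f t)\<^sup>2)"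
  define G where "G = (\<lambda>t. - \<sigma> * R' t)"
  have R: "(R has_real_derivative R' t) (at t within {u..v})" if "t \<in> {u..v}" for t
    unfolding R_def R'_def
    by (rule derivative_eq_intros f[OF that] nz[OF that] | use that in \<open>simp add: power2_eq_square\<close>)+
  have cR': "continuous_on {u..v} R'"
    unfolding R'_def by (intro continuous_intros cf cf') (use nz in auto)
  have "(R' has_integral (R v - R u)) {u..v}"
    by (rule real_FTC[OF uv R])
  then have G: "(G has_integral (- \<sigma> * (R v - R u))) {u..v}"
    unfolding G_def by (rule has_integral_mult_right)
  have GR: "\<bar>R' t\<bar> \<le> G t" if "t \<in> {u..v}" for t
  proof -
    have "G t = (\<sigma> * f' t) / (f t)\<^sup>2" by (simp add: G_def R'_def)
    moreover have "\<bar>\<sigma> * f' t\<bar> = \<bar>f' t\<bar>" using sg by (simp add: abs_mult)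
    ultimately show ?thesis using sg(2)[OF that] by (simp add: R'_def)
  qed
  have Rb: "\<bar>R t\<bar> \<le> 1 / \<mu>" if "t \<in> {u..v}" for t
    using mu(1) mu(2)[OF that] by (simp add: R_def frac_le)
  have "- \<sigma> * (R v - R u) \<le> \<bar>- \<sigma> * (R v - R u)\<bar>" by simp
  also have "\<dots> = \<bar>R v - R u\<bar>" using sg by (simp add: abs_mult)
  also have "\<dots> \<le> 2 * (1 / \<mu>)" using Rb[of u] Rb[of v] uv by auto
  finally have "(\<bar>R u\<bar> + \<bar>R v\<bar> + (- \<sigma> * (R v - R u))) / (2 * pi) \<le> (4 * (1 / \<mu>)) / (2 * pi)"
    using Rb[of u] Rb[of v] uv by (intro divide_right_mono) auto
  \<comment> \<open>The four endpoint contributions \<open>1 / \<mu>\<close> are paid for by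
    \<open>2 * pi \<ge> 4\<close>.\<close>
  also have "\<dots> \<le> 1 / \<mu>"
    using pi_ge_two mu(1) by (simp add: field_simps)
  finally have "norm (integral {u..v} (\<lambda>t. of_real (R t * f t) * e (F t))) \<le> 1 / \<mu>"
    using norm_integral_e_by_parts_le[OF uv F R cf cR' G GR] by linarith
  moreover have "integral {u..v} (\<lambda>t. of_real (R t * f t) * e (F t)) = integral {u..v} (\<lambda>t. e (F t))"
    by (rule integral_cong) (simp add: R_def nz)
  ultimately show ?thesis by simp
qed

text \<open>The weight \<open>\<delta> / (\<delta> + f\<^sup>2)\<close> is integrable with mass \<open>O(1 / sqrt \<delta>)\<close>, and its complement
  carries a factor \<open>f\<close> that can be integrated by parts; this replaces the usual cut around the
  stationary point.\<close>

lemma second_derivative_test: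
  fixes F f f' :: "real \<Rightarrow> real"
  assumes uv: "u \<le> v"
    and F: "\<And>t. t \<in> {u..v} \<Longrightarrow> (F has_real_derivative f t) (at t within {u..v})"
    and f: "\<And>t. t \<in> {u..v} \<Longrightarrow> (f has_real_derivative f' t) (at t within {u..v})"
    and cf': "continuous_on {u..v} f'"
    and la: "0 < \<delta>" and sg: "\<bar>\<sigma>\<bar> = (1::real)" "\<And>t. t \<in> {u..v} \<Longrightarrow> \<delta> \<le> \<sigma> * f' t"
  shows "norm (integral {u..v} (\<lambda>t. e (F t))) \<le> 4 / sqrt \<delta>"
proof -
  have cF: "continuous_on {u..v} F" and cf: "continuous_on {u..v} f"
    using F f has_real_derivative_imp_continuous_on by blast+
  have pos: "0 < \<delta> + (f t)\<^sup>2" for t using la by (simp add: add_pos_nonneg)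
  then have nz: "\<delta> + (f t)\<^sup>2 \<noteq> 0" for t by (metis less_irrefl)
  define R where "R = (\<lambda>t. f t / (\<delta> + (f t)\<^sup>2))"
  define R' where "R' = (\<lambda>t. f' t * (\<delta> - (f t)\<^sup>2) / (\<delta> + (f t)\<^sup>2)\<^sup>2)"
  define G where "G = (\<lambda>t. \<sigma> * (f' t / (\<delta> + (f t)\<^sup>2)))"
  \<comment> \<open>An antiderivative of \<open>f' / (\<delta> + f^2)\<close>; its bound
    \<open>pi / (2 * sqrt \<delta>)\<close> is independent of the range of \<open>f\<close>.\<close>
  define A where "A = (\<lambda>t. arctan (f t / sqrt \<delta>) / sqrt \<delta>)"
  have R: "(R has_real_derivative R' t) (at t within {u..v})" if "t \<in> {u..v}" for t
    unfolding R_def R'_def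
    by (rule derivative_eq_intros f[OF that] | use that pos[of t] in \<open>simp add: power2_eq_square algebra_simps\<close>)+
  have cR': "continuous_on {u..v} R'"
    unfolding R'_def by (intro continuous_intros cf cf' ballI power_not_zero nz)
  have A: "(A has_real_derivative f' t / (\<delta> + (f t)\<^sup>2)) (at t within {u..v})" if "t \<in> {u..v}" for t
  proof -
    have "(A has_real_derivative (inverse (1 + (f t / sqrt \<delta>)\<^sup>2) * (f' t / sqrt \<delta>)) / sqrt \<delta>)
       (at t within {u..v})"
      unfolding A_def by (intro DERIV_cdivide DERIV_chain2[OF DERIV_arctan] f[OF that])
    moreover have "(inverse (1 + (f t / sqrt \<delta>)\<^sup>2) * (f' t / sqrt \<delta>)) / sqrt \<delta> = f' t / (\<delta> + (f t)\<^sup>2)"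
    proof -
      have 1: "inverse x * (y / z) / z = y / (x * (z * z))" for x y z :: real
        by (simp add: divide_simps)
      have 2: "(1 + (f t / sqrt \<delta>)\<^sup>2) * (sqrt \<delta> * sqrt \<delta>) = \<delta> + (f t)\<^sup>2"
        using la by (simp add: power_divide field_simps)
      show ?thesis by (simp only: 1 2)
    qed
    ultimately show ?thesis by simp
  qed
  have "((\<lambda>t. f' t / (\<delta> + (f t)\<^sup>2)) has_integral (A v - A u)) {u..v}"
    by (rule real_FTC[OF uv A])
  then have G: "(G has_integral (\<sigma> * (A v - A u))) {u..v}"
    unfolding G_def by (rule has_integral_mult_right)
  have Ab: "\<bar>A t\<bar> \<le> (pi / 2) / sqrt \<delta>" for t
  proof -
    have "\<bar>arctan (f t / sqrt \<delta>)\<bar> \<le> pi / 2"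
      using arctan_bounded[of "f t / sqrt \<delta>"] by linarith
    then show ?thesis using la by (simp add: A_def abs_divide divide_right_mono del: divide_divide_eq_left)
  qed
  have "\<sigma> * (A v - A u) \<le> \<bar>\<sigma> * (A v - A u)\<bar>" by simp
  also have "\<dots> = \<bar>A v - A u\<bar>" using sg by (simp add: abs_mult)
  also have "\<dots> \<le> \<bar>A v\<bar> + \<bar>A u\<bar>" by simp
  also have "\<dots> \<le> (pi / 2) / sqrt \<delta> + (pi / 2) / sqrt \<delta>" using Ab add_mono by blast
  finally have B: "\<sigma> * (A v - A u) \<le> pi / sqrt \<delta>" by simp
  have GR: "\<bar>R' t\<bar> \<le> G t" if "t \<in> {u..v}" for t
  proof -
    have f'a: "\<bar>f' t\<bar> = \<sigma> * f' t"
      using sg(1) sg(2)[OF that] la by (metis abs_mult abs_of_nonneg less_eq_real_def mult_1 order_trans)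
    have "\<bar>\<delta> - (f t)\<^sup>2\<bar> \<le> \<delta> + (f t)\<^sup>2" using la by (simp add: abs_if)
    then have "\<bar>R' t\<bar> \<le> \<bar>f' t\<bar> * (\<delta> + (f t)\<^sup>2) / (\<delta> + (f t)\<^sup>2)\<^sup>2"
      unfolding R'_def abs_divide abs_mult abs_power2 by (intro divide_right_mono mult_left_mono) auto
    also have "\<dots> = G t" using pos[of t] f'a by (simp add: G_def power2_eq_square)
    finally show ?thesis .
  qed
  have Rb: "\<bar>R t\<bar> \<le> 1 / (2 * sqrt \<delta>)" for t
  proof -
    have "0 \<le> (sqrt \<delta> - \<bar>f t\<bar>)\<^sup>2" by simp
    then have "2 * sqrt \<delta> * \<bar>f t\<bar> \<le> \<delta> + (f t)\<^sup>2" using la by (simp add: power2_diff)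
    then show ?thesis using la pos[of t] by (simp add: R_def field_simps)
  qed
  have 1: "norm (integral {u..v} (\<lambda>t. of_real (R t * f t) * e (F t))) \<le>
      (1 / (2 * sqrt \<delta>) + 1 / (2 * sqrt \<delta>) + pi / sqrt \<delta>) / (2 * pi)"
  proof -
    have "(\<bar>R u\<bar> + \<bar>R v\<bar> + \<sigma> * (A v - A u)) / (2 * pi) \<le>
        (1 / (2 * sqrt \<delta>) + 1 / (2 * sqrt \<delta>) + pi / sqrt \<delta>) / (2 * pi)"
      by (intro divide_right_mono add_mono Rb B) simp
    with norm_integral_e_by_parts_le[OF uv F R cf cR' G GR] show ?thesis
      by (rule order_trans)
  qed
  let ?w = "\<lambda>t. \<delta> / (\<delta> + (f t)\<^sup>2)"
  have iw: "(\<lambda>t. of_real (?w t) * e (F t)) integrable_on {u..v}"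
    by (intro integrable_continuous_interval continuous_intros cF cf ballI nz)
  have iR: "(\<lambda>t. of_real (R t * f t) * e (F t)) integrable_on {u..v}"
    unfolding R_def
    by (intro integrable_continuous_interval continuous_intros cF cf ballI nz)
  have "norm (integral {u..v} (\<lambda>t. of_real (?w t) * e (F t))) \<le> integral {u..v} G"
  proof (rule integral_norm_bound_integral[OF iw])
    show "G integrable_on {u..v}" using G by blast
    fix t assume t: "t \<in> {u..v}"
    \<comment> \<open>The lower bound on \<open>\<sigma> * f'\<close> replaces the constant
      \<open>\<delta>\<close> in the numerator, which dominates the weight by an exact
      derivative.\<close>
    have "?w t \<le> (\<sigma> * f' t) / (\<delta> + (f t)\<^sup>2)"
      using sg(2)[OF t] pos[of t] by (intro divide_right_mono) auto
    then show "norm (of_real (?w t) * e (F t)) \<le> G t"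
      using la pos[of t] unfolding norm_mult norm_of_real by (simp add: G_def)
  qed
  also have "\<dots> \<le> pi / sqrt \<delta>" using integral_unique[OF G] B by simp
  finally have 2: "norm (integral {u..v} (\<lambda>t. of_real (?w t) * e (F t))) \<le> pi / sqrt \<delta>" .
  have "integral {u..v} (\<lambda>t. e (F t)) =
      integral {u..v} (\<lambda>t. of_real (?w t) * e (F t) + of_real (R t * f t) * e (F t))"
  proof (rule integral_cong)
    fix t
    have "?w t + R t * f t = (\<delta> + (f t)\<^sup>2) / (\<delta> + (f t)\<^sup>2)"
      unfolding R_def by (simp only: times_divide_eq_left add_divide_distrib[symmetric] power2_eq_square)
    then have "?w t + R t * f t = 1" using pos[of t] by simp
    then show "e (F t) = of_real (?w t) * e (F t) + of_real (R t * f t) * e (F t)"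
      by (metis distrib_right mult_1 of_real_1 of_real_add)
  qed
  also have "\<dots> = integral {u..v} (\<lambda>t. of_real (?w t) * e (F t))
      + integral {u..v} (\<lambda>t. of_real (R t * f t) * e (F t))"
    by (rule integral_add[OF iw iR])
  finally have "norm (integral {u..v} (\<lambda>t. e (F t))) \<le>
      pi / sqrt \<delta> + (1 / (2 * sqrt \<delta>) + 1 / (2 * sqrt \<delta>) + pi / sqrt \<delta>) / (2 * pi)"
    using norm_triangle_mono[OF 2 1] by simp
  also have "\<dots> = (pi + 1 / 2 + 1 / (2 * pi)) / sqrt \<delta>"
    by (simp add: add_divide_distrib mult.commute)
  also have "\<dots> \<le> 4 / sqrt \<delta>"
  proof (intro divide_right_mono)
    have "pi < 63 / 20" using pi_approx by simp
    moreover have "1 / (2 * pi) \<le> 1 / (2 * 3)" using pi_gt3 by (intro divide_left_mono) auto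
    ultimately show "pi + 1 / 2 + 1 / (2 * pi) \<le> 4" by linarith
  qed (use la in simp)
  finally show ?thesis .
qed

section \<open>Poisson summation\<close>

text \<open>The remainder of the Fourier series of the sawtooth on the unit interval. It serves as a
  primitive of the Dirichlet kernel: its derivative is the sum of \<open>e (- k * t)\<close> over
  \<open>|k| \<le> K\<close>, and its values \<open>- 1/2\<close> and \<open>1/2\<close> at 0 and 1
  produce the halved endpoint terms of Poisson summation.\<close>

definition saw :: "nat \<Rightarrow> real \<Rightarrow> real" where
  "saw K t = t - 1 / 2 + (\<Sum>k=1..K. sin (2 * pi * real k * t) / (pi * real k))"

lemma saw_Suc: "saw (Suc K) t = saw K t + sin (2 * pi * real (Suc K) * t) / (pi * real (Suc K))"
  by (simp add: saw_def)

lemma saw_0 [simp]: "saw K 0 = - 1 / 2"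
  by (simp add: saw_def)

lemma sin_2pi_nat: "sin (2 * pi * real k) = 0"
  using sin_2npi[of k] by (simp only: mult.assoc mult.commute[of pi])

lemma cos_2pi_nat: "cos (2 * pi * real k) = 1"
  using cos_2npi[of k] by (simp only: mult.assoc mult.commute[of pi])

lemma saw_1 [simp]: "saw K 1 = 1 / 2"
  by (simp add: saw_def sin_2pi_nat)

lemma saw_has_real_derivative:
  "(saw K has_real_derivative 1 + 2 * (\<Sum>k=1..K. cos (2 * pi * real k * t))) (at t within S)"
proof (induction K)
  case 0
  show ?case unfolding saw_def by (auto intro!: derivative_eq_intros)
next
  case (Suc K)
  have "((\<lambda>t. sin (2 * pi * j * t) / (pi * j)) has_real_derivative 2 * cos (2 * pi * j * t))
      (at t within S)" if "j > 0" for j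
    using that by (auto intro!: derivative_eq_intros)
  from DERIV_add[OF Suc this[of "real (Suc K)"]]
  have "((\<lambda>t. saw K t + sin (2 * pi * real (Suc K) * t) / (pi * real (Suc K))) has_real_derivative
      (1 + 2 * (\<Sum>k=1..K. cos (2 * pi * real k * t))) + 2 * cos (2 * pi * real (Suc K) * t)) (at t within S)"
    by simp
  then show ?case
    unfolding saw_Suc[abs_def] by (simp add: algebra_simps)
qed

lemma continuous_on_saw [continuous_intros]: "continuous_on S (saw K)"
  unfolding saw_def[abs_def] by (intro continuous_intros) auto

lemma cos_has_integral_0:
  assumes "j \<ge> 1"
  shows "((\<lambda>t. cos (2 * pi * real j * t)) has_integral 0) {0..1}"
proof -
  have "((\<lambda>t. sin (2 * pi * real j * t) / (2 * pi * real j)) has_real_derivative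
       cos (2 * pi * real j * t)) (at t within {0..1})" for t
    using assms by (auto intro!: derivative_eq_intros)
  from real_FTC[OF _ this] show ?thesis by (simp add: sin_2pi_nat)
qed

lemma cos_cos_has_integral_0:
  assumes "k < j"
  shows "((\<lambda>t. cos (2 * pi * real j * t) * cos (2 * pi * real k * t)) has_integral 0) {0..1}"
proof -
  have "((\<lambda>t. (1/2) * (cos (2 * pi * real (j - k) * t) + cos (2 * pi * real (j + k) * t)))
      has_integral (1/2) * (0 + 0)) {0..1}"
    using assms by (intro has_integral_mult_right has_integral_add cos_has_integral_0) auto
  moreover have "(1/2) * (cos (2 * pi * real (j - k) * t) + cos (2 * pi * real (j + k) * t)) =
      cos (2 * pi * real j * t) * cos (2 * pi * real k * t)" for t
    using assms by (simp add: cos_times_cos of_nat_diff algebra_simps)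
  ultimately show ?thesis by simp
qed

text \<open>Integration by parts turns the sine into the cosine of frequency \<open>j\<close>
  against the Dirichlet kernel of order \<open>K < j\<close>, which is orthogonal to it. Only the
  boundary values of \<open>saw K\<close> remain.\<close>

lemma saw_sin_has_integral:
  assumes "K < j"
  shows "((\<lambda>t. saw K t * sin (2 * pi * real j * t)) has_integral - 1 / (2 * pi * real j)) {0..1}"
proof -
  define D where "D = (\<lambda>t. 1 + 2 * (\<Sum>k=1..K. cos (2 * pi * real k * t)))"
  have "((\<lambda>t. - saw K t * cos (2 * pi * real j * t) / (2 * pi * real j)) has_real_derivative
      saw K t * sin (2 * pi * real j * t) - cos (2 * pi * real j * t) * D t / (2 * pi * real j))
      (at t within {0..1})" for t
    unfolding D_def using assms
    by (auto intro!: derivative_eq_intros saw_has_real_derivative simp: field_simps)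
  from real_FTC[OF _ this]
  have 1: "((\<lambda>t. saw K t * sin (2 * pi * real j * t) - cos (2 * pi * real j * t) * D t / (2 * pi * real j))
      has_integral - 1 / (2 * pi * real j)) {0..1}"
    using cos_2pi_nat[of j] by (simp add: mult.assoc)
  have "((\<lambda>t. cos (2 * pi * real j * t) + 2 * (\<Sum>k=1..K. cos (2 * pi * real j * t) * cos (2 * pi * real k * t)))
      has_integral 0 + 2 * (\<Sum>k=1..K. 0)) {0..1}"
    using assms by (intro has_integral_add has_integral_mult_right has_integral_sum cos_has_integral_0
        cos_cos_has_integral_0) auto
  then have "((\<lambda>t. cos (2 * pi * real j * t) * D t) has_integral 0) {0..1}"
    by (simp add: D_def algebra_simps sum_distrib_left)
  from has_integral_divide[OF this, of "2 * pi * real j"]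
  have 2: "((\<lambda>t. cos (2 * pi * real j * t) * D t / (2 * pi * real j)) has_integral 0) {0..1}" by simp
  from has_integral_add[OF 1 2] show ?thesis by simp
qed

text \<open>Parseval by induction. In each step the cross term is minus twice the square term of the
  new sine, so the mean square drops by \<open>1 / (2 * pi^2 * k^2)\<close>.\<close>

lemma saw_square_has_integral:
  "((\<lambda>t. (saw K t)\<^sup>2) has_integral 1 / 12 - (\<Sum>k=1..K. 1 / (2 * pi\<^sup>2 * (real k)\<^sup>2))) {0..1}"
proof (induction K)
  case 0
  have "((\<lambda>t. (t - 1 / 2) ^ 3 / 3) has_real_derivative (t - 1 / 2)\<^sup>2) (at t within {0..1})" for t :: real
    by (auto intro!: derivative_eq_intros)
  from real_FTC[OF _ this] show ?case by (simp add: saw_def power3_eq_cube)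
next
  case (Suc K)
  let ?j = "Suc K"
  have s: "((\<lambda>t. (1/2) * (1 - cos (2 * pi * real (2 * ?j) * t))) has_integral (1/2) * ((1 - 0) - 0)) {0..1}"
    by (intro has_integral_mult_right has_integral_diff cos_has_integral_0)
      (use has_integral_const_real[of "1::real" 0 1] in auto)
  have sq: "(1/2) * (1 - cos (2 * pi * real (2 * ?j) * t)) = (sin (2 * pi * real ?j * t))\<^sup>2" for t
    using cos_double_sin[of "2 * pi * real ?j * t"] by (simp add: algebra_simps)
  have s': "((\<lambda>t. (sin (2 * pi * real ?j * t))\<^sup>2) has_integral 1 / 2) {0..1}"
    using s unfolding sq by simp
  have "((\<lambda>t. (saw K t)\<^sup>2 + (2 / (pi * real ?j)) * (saw K t * sin (2 * pi * real ?j * t))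
       + (1 / (pi * real ?j)\<^sup>2) * (sin (2 * pi * real ?j * t))\<^sup>2) has_integral
     (1 / 12 - (\<Sum>k=1..K. 1 / (2 * pi\<^sup>2 * (real k)\<^sup>2))) + (2 / (pi * real ?j)) * (- 1 / (2 * pi * real ?j))
       + (1 / (pi * real ?j)\<^sup>2) * (1 / 2)) {0..1}"
    by (intro has_integral_add has_integral_mult_right Suc saw_sin_has_integral)
      (use s' in auto)
  moreover have "(saw K t)\<^sup>2 + (2 / (pi * real ?j)) * (saw K t * sin (2 * pi * real ?j * t))
       + (1 / (pi * real ?j)\<^sup>2) * (sin (2 * pi * real ?j * t))\<^sup>2 = (saw ?j t)\<^sup>2" for t
    unfolding saw_Suc power2_sum by (simp add: power_divide)
  moreover have "(1 / 12 - (\<Sum>k=1..K. 1 / (2 * pi\<^sup>2 * (real k)\<^sup>2))) + (2 / (pi * real ?j)) * (- 1 / (2 * pi * real ?j))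
       + (1 / (pi * real ?j)\<^sup>2) * (1 / 2) = 1 / 12 - (\<Sum>k=1..?j. 1 / (2 * pi\<^sup>2 * (real k)\<^sup>2))"
    by (simp add: power2_eq_square)
  ultimately show ?case by (simp only:)
qed

text \<open>Euler's value \<open>pi^2 / 6\<close> makes the subtracted sum converge to exactly
  \<open>1 / 12\<close>, the mean square of \<open>t - 1/2\<close>.\<close>

lemma saw_square_integral_tendsto_0:
  "(\<lambda>K. integral {0..1} (\<lambda>t. (saw K t)\<^sup>2)) \<longlonglongrightarrow> 0"
proof -
  have "(\<lambda>n. \<Sum>k<n. 1 / (real (k + 1))\<^sup>2) \<longlonglongrightarrow> pi\<^sup>2 / 6"
    using inverse_squares_sums by (simp add: sums_def add.commute)
  then have "(\<lambda>n. 1 / 12 - (1 / (2 * pi\<^sup>2)) * (\<Sum>k<n. 1 / (real (k + 1))\<^sup>2)) \<longlonglongrightarrow>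
      1 / 12 - (1 / (2 * pi\<^sup>2)) * (pi\<^sup>2 / 6)"
    by (intro tendsto_intros)
  moreover have "1 / 12 - (1 / (2 * pi\<^sup>2)) * (pi\<^sup>2 / 6) = 0" by simp
  moreover have "integral {0..1} (\<lambda>t. (saw K t)\<^sup>2) = 1 / 12 - (1 / (2 * pi\<^sup>2)) * (\<Sum>k<K. 1 / (real (k + 1))\<^sup>2)" for K
  proof -
    have "(\<Sum>k=1..K. 1 / (2 * pi\<^sup>2 * (real k)\<^sup>2)) = (\<Sum>k<K. 1 / (2 * pi\<^sup>2 * (real (k + 1))\<^sup>2))"
      by (rule sum.reindex_bij_witness[of _ "\<lambda>k. k + 1" "\<lambda>k. k - 1"]) auto
    also have "\<dots> = (1 / (2 * pi\<^sup>2)) * (\<Sum>k<K. 1 / (real (k + 1))\<^sup>2)"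
      by (simp add: sum_distrib_left)
    finally show ?thesis using integral_unique[OF saw_square_has_integral[of K]] by simp
  qed
  ultimately show ?thesis by simp
qed

text \<open>Convergence in mean avoids the endpoints, where the remainder keeps the values
  \<open>\<plusminus> 1/2\<close> and uniform convergence fails. The elementary inequality
  \<open>s \<le> r / 2 + s^2 / (2 * r)\<close> plays the part of Cauchy-Schwarz.\<close>

lemma saw_abs_integral_tendsto_0:
  "(\<lambda>K. integral {0..1} (\<lambda>t. \<bar>saw K t\<bar>)) \<longlonglongrightarrow> 0"
proof (rule LIMSEQ_I)
  fix r :: real assume r: "0 < r"
  have "\<exists>no. \<forall>K\<ge>no. norm (integral {0..1} (\<lambda>t. (saw K t)\<^sup>2) - 0) < r\<^sup>2"
    using LIMSEQ_D[OF saw_square_integral_tendsto_0, of "r\<^sup>2"] r by simp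
  then obtain no where no: "\<And>K. K \<ge> no \<Longrightarrow> integral {0..1} (\<lambda>t. (saw K t)\<^sup>2) < r\<^sup>2"
    by fastforce
  show "\<exists>no. \<forall>K\<ge>no. norm (integral {0..1} (\<lambda>t. \<bar>saw K t\<bar>) - 0) < r"
  proof (intro exI allI impI)
    fix K assume K: "K \<ge> no"
    have i2: "(\<lambda>t. (saw K t)\<^sup>2) integrable_on {0..1}"
      by (intro integrable_continuous_interval continuous_intros)
    have "integral {0..1} (\<lambda>t. \<bar>saw K t\<bar>) \<le> integral {0..1} (\<lambda>t. r / 2 + (1 / (2 * r)) * (saw K t)\<^sup>2)"
    proof (rule integral_le)
      fix t
      have "0 \<le> (r - \<bar>saw K t\<bar>)\<^sup>2" by simp
      then have "2 * r * \<bar>saw K t\<bar> \<le> r\<^sup>2 + (saw K t)\<^sup>2" by (simp add: power2_diff)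
      then show "\<bar>saw K t\<bar> \<le> r / 2 + (1 / (2 * r)) * (saw K t)\<^sup>2"
        using r by (simp add: field_simps power2_eq_square)
    qed (intro integrable_continuous_interval continuous_intros)+
    also have "\<dots> = r / 2 + (1 / (2 * r)) * integral {0..1} (\<lambda>t. (saw K t)\<^sup>2)"
      by (subst integral_add) (use i2 r in \<open>auto intro!: integrable_on_mult_right integrable_continuous_interval continuous_intros\<close>)
    also have "\<dots> < r / 2 + (1 / (2 * r)) * r\<^sup>2"
      using no[OF K] r by (intro add_strict_left_mono mult_strict_left_mono) auto
    also have "\<dots> = r" using r by (simp add: power2_eq_square)
    finally have "integral {0..1} (\<lambda>t. \<bar>saw K t\<bar>) < r" .
    moreover have "0 \<le> integral {0..1} (\<lambda>t. \<bar>saw K t\<bar>)"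
      by (intro integral_nonneg integrable_continuous_interval continuous_intros) auto
    ultimately show "norm (integral {0..1} (\<lambda>t. \<bar>saw K t\<bar>) - 0) < r" by simp
  qed
qed

section \<open>Poisson summation between integer endpoints\<close>

lemma sum_e_symmetric:
  "(\<Sum>k\<in>{- int K..int K}. e (- (of_int k * t))) = of_real (1 + 2 * (\<Sum>k=1..K. cos (2 * pi * real k * t)))"
proof (induction K)
  case 0
  show ?case using e_of_int[of 0] by simp
next
  case (Suc K)
  have "{- int (Suc K)..int (Suc K)} = insert (- int (Suc K)) (insert (int (Suc K)) {- int K..int K})"
    by auto
  moreover have "e (- (of_int (- int (Suc K)) * t)) + e (- (of_int (int (Suc K)) * t)) =
      of_real (2 * cos (2 * pi * real (Suc K) * t))"
  proof -
    let ?x = "of_int (int (Suc K)) * t"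
    have "- (of_int (- int (Suc K)) * t) = ?x" by (simp add: algebra_simps)
    then have "e (- (of_int (- int (Suc K)) * t)) + e (- ?x) = e ?x + cnj (e ?x)"
      by (simp only: e_minus)
    also have "\<dots> = of_real (2 * Re (e ?x))" by (simp add: complex_add_cnj)
    also have "Re (e ?x) = cos (2 * pi * real (Suc K) * t)"
      by (simp add: e_def Re_exp mult.assoc)
    finally show ?thesis .
  qed
  ultimately show ?case using Suc by (simp add: algebra_simps)
qed

text \<open>Integrate \<open>\<phi>'\<close> against \<open>saw K\<close> by parts: the derivative
  of \<open>saw K\<close> collects the frequencies up to \<open>K\<close>, its endpoint values give
  the half sum, and what is left is at most \<open>sup |\<phi>'|\<close> times the mean of
  \<open>|saw K|\<close>. The partial sums are symmetric because single terms in general decay only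
  like \<open>1 / k\<close>.\<close>

lemma poisson_unit_interval:
  fixes \<phi> \<phi>' :: "real \<Rightarrow> complex"
  assumes d: "\<And>t. t \<in> {0..1} \<Longrightarrow> (\<phi> has_vector_derivative \<phi>' t) (at t within {0..1})"
    and c': "continuous_on {0..1} \<phi>'"
  shows "(\<lambda>K. \<Sum>k\<in>{- int K..int K}. integral {0..1} (\<lambda>t. \<phi> t * e (- (of_int k * t)))) \<longlonglongrightarrow> (\<phi> 0 + \<phi> 1) / 2"
proof -
  have c: "continuous_on {0..1} \<phi>"
    using d continuous_on_vector_derivative by blast
  have "compact (\<phi>' ` {0..1})" using c' compact_continuous_image by blast
  then obtain B where B: "\<And>t. t \<in> {0..1} \<Longrightarrow> norm (\<phi>' t) \<le> B"
    using compact_imp_bounded bounded_iff by (metis image_eqI)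
  have main: "(\<Sum>k\<in>{- int K..int K}. integral {0..1} (\<lambda>t. \<phi> t * e (- (of_int k * t))))
      = (\<phi> 0 + \<phi> 1) / 2 - integral {0..1} (\<lambda>t. saw K t *\<^sub>R \<phi>' t)" for K
  proof -
    define D where "D = (\<lambda>t. 1 + 2 * (\<Sum>k=1..K. cos (2 * pi * real k * t)))"
    have cD: "continuous_on {0..1} D" unfolding D_def by (intro continuous_intros)
    have "((\<lambda>t. saw K t *\<^sub>R \<phi> t) has_vector_derivative (saw K t *\<^sub>R \<phi>' t + D t *\<^sub>R \<phi> t)) (at t within {0..1})"
      if "t \<in> {0..1}" for t
      unfolding D_def by (rule has_vector_derivative_scaleR[OF saw_has_real_derivative d[OF that]])
    from fundamental_theorem_of_calculus[OF _ this]
    have "((\<lambda>t. saw K t *\<^sub>R \<phi>' t + D t *\<^sub>R \<phi> t) has_integral (\<phi> 0 + \<phi> 1) / 2) {0..1}"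
      by (simp add: scaleR_conv_of_real add_divide_distrib add.commute)
    moreover have "integral {0..1} (\<lambda>t. saw K t *\<^sub>R \<phi>' t + D t *\<^sub>R \<phi> t) =
        integral {0..1} (\<lambda>t. saw K t *\<^sub>R \<phi>' t) + integral {0..1} (\<lambda>t. D t *\<^sub>R \<phi> t)"
      by (intro integral_add integrable_continuous_interval continuous_intros c c' cD)
    moreover have "(\<Sum>k\<in>{- int K..int K}. integral {0..1} (\<lambda>t. \<phi> t * e (- (of_int k * t))))
        = integral {0..1} (\<lambda>t. \<Sum>k\<in>{- int K..int K}. \<phi> t * e (- (of_int k * t)))"
      by (intro integral_sum[symmetric] integrable_continuous_interval continuous_intros c) auto
    moreover have "(\<Sum>k\<in>{- int K..int K}. \<phi> t * e (- (of_int k * t))) = D t *\<^sub>R \<phi> t" for t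
      unfolding sum_distrib_left[symmetric] sum_e_symmetric D_def by (simp add: scaleR_conv_of_real)
    ultimately show ?thesis by (simp add: integral_unique eq_diff_eq)
  qed
  have "(\<lambda>K. integral {0..1} (\<lambda>t. saw K t *\<^sub>R \<phi>' t)) \<longlonglongrightarrow> 0"
  proof (rule Lim_null_comparison)
    show "(\<lambda>K. B * integral {0..1} (\<lambda>t. \<bar>saw K t\<bar>)) \<longlonglongrightarrow> 0"
      using tendsto_mult_left[OF saw_abs_integral_tendsto_0, of B] by simp
    have "norm (integral {0..1} (\<lambda>t. saw K t *\<^sub>R \<phi>' t)) \<le> integral {0..1} (\<lambda>t. B * \<bar>saw K t\<bar>)" for K
      by (rule integral_norm_bound_integral)
        (use B in \<open>auto intro!: integrable_continuous_interval continuous_intros c' mult_left_mono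
            simp: mult.commute[of B]\<close>)
    then show "\<forall>\<^sub>F K in sequentially. norm (integral {0..1} (\<lambda>t. saw K t *\<^sub>R \<phi>' t))
        \<le> B * integral {0..1} (\<lambda>t. \<bar>saw K t\<bar>)" by simp
  qed
  from tendsto_diff[OF tendsto_const this] show ?thesis unfolding main by simp
qed

text \<open>Unit intervals are glued together. An interior integer receives one half from each
  neighbour, so only the two ends keep weight one half; translation by the integer \<open>q\<close>
  leaves \<open>e (- k * t)\<close> unchanged.\<close>

lemma poisson_interval:
  fixes \<phi> \<phi>' :: "real \<Rightarrow> complex" and p q :: int
  assumes pq: "p \<le> q"
    and d: "\<And>t. t \<in> {real_of_int p..real_of_int q} \<Longrightarrow> (\<phi> has_vector_derivative \<phi>' t) (at t within {real_of_int p..real_of_int q})"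
    and c': "continuous_on {real_of_int p..real_of_int q} \<phi>'"
  shows "(\<lambda>K. \<Sum>k\<in>{- int K..int K}. integral {real_of_int p..real_of_int q} (\<lambda>t. \<phi> t * e (- (of_int k * t))))
     \<longlonglongrightarrow> (\<Sum>h\<in>{p..q}. \<phi> h) - (\<phi> p + \<phi> q) / 2"
  using pq d c'
proof (induction q rule: int_ge_induct)
  case base
  then show ?case by simp
next
  case (step q)
  have sub: "{real_of_int p..real_of_int q} \<subseteq> {real_of_int p..real_of_int (q + 1)}"
    "{real_of_int q..real_of_int q + 1} \<subseteq> {real_of_int p..real_of_int (q + 1)}"
    using step.hyps by auto
  have c: "continuous_on {real_of_int p..real_of_int (q + 1)} \<phi>"
    by (rule continuous_on_vector_derivative[OF step.prems(1)])
  have IH: "(\<lambda>K. \<Sum>k\<in>{- int K..int K}. integral {real_of_int p..real_of_int q} (\<lambda>t. \<phi> t * e (- (of_int k * t))))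
     \<longlonglongrightarrow> (\<Sum>h\<in>{p..q}. \<phi> h) - (\<phi> p + \<phi> q) / 2"
  proof (rule step.IH)
    fix t assume "t \<in> {real_of_int p..real_of_int q}"
    then show "(\<phi> has_vector_derivative \<phi>' t) (at t within {real_of_int p..real_of_int q})"
      by (intro has_vector_derivative_within_subset[OF step.prems(1) sub(1)]) (use sub(1) in auto)
  qed (rule continuous_on_subset[OF step.prems(2) sub(1)])
  define \<psi> where "\<psi> = (\<lambda>x. \<phi> (of_int q + x))"
  define \<psi>' where "\<psi>' = (\<lambda>x. \<phi>' (of_int q + x))"
  have im: "(\<lambda>x. real_of_int q + x) ` {0..1} = {real_of_int q..real_of_int q + 1}"
    by (simp add: image_add_atLeastAtMost)
  have U: "(\<lambda>K. \<Sum>k\<in>{- int K..int K}. integral {0..1} (\<lambda>t. \<psi> t * e (- (of_int k * t)))) \<longlonglongrightarrow> (\<psi> 0 + \<psi> 1) / 2"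
  proof (rule poisson_unit_interval)
    fix t :: real assume t: "t \<in> {0..1}"
    then have "real_of_int q + t \<in> {real_of_int p..real_of_int (q + 1)}"
      using step.hyps by auto
    from has_vector_derivative_within_subset[OF step.prems(1)[OF this] sub(2)]
    have 1: "(\<phi> has_vector_derivative \<phi>' (of_int q + t)) (at (of_int q + t) within (\<lambda>x. real_of_int q + x) ` {0..1})"
      unfolding im .
    have 2: "((\<lambda>x. real_of_int q + x) has_real_derivative 1) (at t within {0..1})"
      by (auto intro!: derivative_eq_intros)
    show "(\<psi> has_vector_derivative \<psi>' t) (at t within {0..1})"
      using vector_diff_chain_within[OF 2[unfolded has_real_derivative_iff_has_vector_derivative] 1]
      by (simp add: \<psi>_def \<psi>'_def o_def)
  next
    show "continuous_on {0..1} \<psi>'"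
      unfolding \<psi>'_def
      by (intro continuous_on_compose2[OF continuous_on_subset[OF step.prems(2) sub(2)]] continuous_intros) auto
  qed
  have shift: "integral {0..1} (\<lambda>t. \<psi> t * e (- (of_int k * t))) =
      integral {of_int q..of_int q + 1} (\<lambda>t. \<phi> t * e (- (of_int k * t)))" for k
  proof -
    have "integral {0..1} ((\<lambda>t. \<phi> t * e (- (of_int k * t))) \<circ> (\<lambda>x. x + of_int q)) =
        integral {0 + of_int q..1 + of_int q} (\<lambda>t. \<phi> t * e (- (of_int k * t)))"
      by (rule integral_shift) (intro continuous_intros continuous_on_subset[OF c], use sub(2) in auto)
    moreover have "e (- (of_int k * (x + of_int q))) = e (- (of_int k * x))" for x
    proof -
      have "- (of_int k * (x + of_int q)) = - (of_int k * x) + of_int (- (k * q))"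
        by (simp add: algebra_simps)
      then show ?thesis by (simp only: e_add e_of_int mult_1_right)
    qed
    ultimately show ?thesis by (simp add: o_def \<psi>_def add.commute)
  qed
  have comb: "integral {real_of_int p..real_of_int (q + 1)} (\<lambda>t. \<phi> t * e (- (of_int k * t))) =
      integral {real_of_int p..real_of_int q} (\<lambda>t. \<phi> t * e (- (of_int k * t))) + integral {0..1} (\<lambda>t. \<psi> t * e (- (of_int k * t)))" for k
    unfolding shift of_int_add of_int_1
    by (rule Henstock_Kurzweil_Integration.integral_combine[symmetric])
      (use step.hyps in \<open>auto intro!: integrable_continuous_interval continuous_intros continuous_on_subset[OF c]\<close>)
  have "{p..q + 1} = insert (q + 1) {p..q}" using step.hyps by auto
  then have S: "(\<Sum>h\<in>{p..q + 1}. \<phi> (of_int h)) = (\<Sum>h\<in>{p..q}. \<phi> (of_int h)) + \<phi> (of_int q + 1)" by simp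
  have "((\<Sum>h\<in>{p..q}. \<phi> h) - (\<phi> p + \<phi> q) / 2) + (\<psi> 0 + \<psi> 1) / 2 =
      (\<Sum>h\<in>{p..q + 1}. \<phi> (of_int h)) - (\<phi> p + \<phi> (of_int (q + 1))) / 2"
    unfolding S by (simp add: \<psi>_def field_simps)
  with tendsto_add[OF IH U] show ?case
    by (simp only: comb sum.distrib)
qed

section \<open>Truncation of the frequency sum\<close>

lemma sum_inverse_squares_tail:
  assumes "1 \<le> K"
  shows "(\<Sum>k=Suc K..K'. 1 / (real k)\<^sup>2) \<le> 1 / real K"
proof (cases "K \<le> K'")
  case True
  then have "(\<Sum>k=Suc K..K'. 1 / (real k)\<^sup>2) \<le> 1 / real K - 1 / real K'"
  proof (induction K' rule: dec_induct)
    case (step n)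
    have "1 / (real (Suc n))\<^sup>2 \<le> 1 / (real n * real (Suc n))"
      using step.hyps assms by (intro divide_left_mono) (auto simp: power2_eq_square)
    also have "\<dots> = 1 / real n - 1 / real (Suc n)"
      using step.hyps assms by (simp add: field_simps)
    finally show ?case using step by simp
  qed simp
  also have "\<dots> \<le> 1 / real K" by simp
  finally show ?thesis .
qed simp

lemma norm_integral_le:
  fixes g :: "real \<Rightarrow> complex"
  assumes "continuous_on {u..v} g" "(G has_integral B) {u..v}"
    and "\<And>t. t \<in> {u..v} \<Longrightarrow> norm (g t) \<le> G t"
  shows "norm (integral {u..v} g) \<le> B"
  using integral_norm_bound_integral[OF integrable_continuous_interval[OF assms(1)]
      has_integral_integrable[OF assms(2)] assms(3)] integral_unique[OF assms(2)] by simp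

text \<open>A single frequency contributes about \<open>1 / k\<close>, which is not summable. At
  integer endpoints \<open>e (k * t) = 1\<close>, so the boundary terms of \<open>k\<close> and
  \<open>- k\<close> combine to \<open>1 / (f - k) + 1 / (f + k)\<close>, of size
  \<open>M / k^2\<close>; the variation terms have that size individually.\<close>

lemma poisson_pair_bound:
  fixes F f f' :: "real \<Rightarrow> real" and p q :: int
  assumes pq: "p \<le> q"
    and F: "\<And>t. t \<in> {real_of_int p..real_of_int q} \<Longrightarrow> (F has_real_derivative f t) (at t within {real_of_int p..real_of_int q})"
    and f: "\<And>t. t \<in> {real_of_int p..real_of_int q} \<Longrightarrow> (f has_real_derivative f' t) (at t within {real_of_int p..real_of_int q})"
    and cf': "continuous_on {real_of_int p..real_of_int q} f'"
    and sg: "\<bar>\<sigma>\<bar> = (1::real)" "\<And>t. t \<in> {real_of_int p..real_of_int q} \<Longrightarrow> 0 \<le> \<sigma> * f' t"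
    and M: "\<And>t. t \<in> {real_of_int p..real_of_int q} \<Longrightarrow> \<bar>f t\<bar> \<le> M"
    and k: "1 \<le> k" "2 * M \<le> real k"
  shows "norm (integral {real_of_int p..real_of_int q} (\<lambda>t. e (F t - real k * t)) + integral {real_of_int p..real_of_int q} (\<lambda>t. e (F t + real k * t)))
     \<le> 4 * M / (real k)\<^sup>2"
proof -
  define u v where "u = real_of_int p" and "v = real_of_int q"
  note uv_defs = u_def[symmetric] v_def[symmetric]
  note F = F[unfolded uv_defs] and f = f[unfolded uv_defs] and cf' = cf'[unfolded uv_defs]
    and sg = sg[unfolded uv_defs] and M = M[unfolded uv_defs]
  have uv: "u \<le> v" using pq by (simp add: u_def v_def)
  have cF: "continuous_on {u..v} F" by (rule has_real_derivative_imp_continuous_on[OF F])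
  have cf: "continuous_on {u..v} f" by (rule has_real_derivative_imp_continuous_on[OF f])
  have M0: "0 \<le> M" using M[of u] uv by (meson abs_ge_zero atLeastAtMost_iff order_refl order_trans)
  have k0: "0 < real k" using k by simp
  \<comment> \<open>From \<open>2 * M\<close> on, the derivative of
    \<open>F \<plusminus> k * t\<close> stays as large as \<open>k / 2\<close>, so there is no
    stationary point.\<close>
  have half: "real k / 2 \<le> \<bar>f t + s * real k\<bar>" if "t \<in> {u..v}" "\<bar>s\<bar> = 1" for t s
    using M[OF that(1)] k that(2) by (auto simp: abs_if split: if_splits)
  define V where "V = (\<lambda>s. integral {u..v} (\<lambda>t. of_real (- f' t / (f t + s * real k)\<^sup>2) * e (F t + s * real k * t)))"
  have I: "integral {u..v} (\<lambda>t. e (F t + s * real k * t)) =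
      (of_real (1 / (f v + s * real k)) * e (F v) - of_real (1 / (f u + s * real k)) * e (F u) - V s) / (2 * pi * \<i>)"
    and Vb: "norm (V s) \<le> 8 * M / (real k)\<^sup>2"
    if s: "s = 1 \<or> s = - 1" for s
  proof -
    from s have s1: "\<bar>s\<bar> = 1" by auto
    have nz: "f t + s * real k \<noteq> 0" if "t \<in> {u..v}" for t
      using half[OF that s1] k0 by auto
    define R where "R = (\<lambda>t. 1 / (f t + s * real k))"
    define R' where "R' = (\<lambda>t. - f' t / (f t + s * real k)\<^sup>2)"
    have R: "(R has_real_derivative R' t) (at t within {u..v})" if "t \<in> {u..v}" for t
      unfolding R_def R'_def
      by (rule derivative_eq_intros f[OF that] nz[OF that] | use that in \<open>simp add: power2_eq_square\<close>)+
    have F': "((\<lambda>t. F t + s * real k * t) has_real_derivative f t + s * real k) (at t within {u..v})"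
      if "t \<in> {u..v}" for t
      by (rule derivative_eq_intros F[OF that] refl | simp)+
    have cR': "continuous_on {u..v} R'"
      unfolding R'_def by (intro continuous_intros cf cf') (use nz in auto)
    have eint: "e (F x + s * real k * x) = e (F x)" if "x = of_int j" for x j
    proof -
      have "s * real k * x = of_int ((if s = 1 then 1 else - 1) * int k * j)"
        using s that by auto
      then show ?thesis by (simp only: e_add e_of_int mult_1_right)
    qed
    have "integral {u..v} (\<lambda>t. of_real (R t * (f t + s * real k)) * e (F t + s * real k * t)) =
      (of_real (R v) * e (F v + s * real k * v) - of_real (R u) * e (F u + s * real k * u)
        - integral {u..v} (\<lambda>t. of_real (R' t) * e (F t + s * real k * t))) / (2 * pi * \<i>)"
      by (rule integral_e_by_parts[OF uv F' R _ cR']) (assumption | intro continuous_intros cf)+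
    moreover have "integral {u..v} (\<lambda>t. of_real (R t * (f t + s * real k)) * e (F t + s * real k * t)) =
      integral {u..v} (\<lambda>t. e (F t + s * real k * t))"
      by (rule integral_cong) (simp add: R_def nz del: of_real_mult)
    ultimately show "integral {u..v} (\<lambda>t. e (F t + s * real k * t)) =
      (of_real (1 / (f v + s * real k)) * e (F v) - of_real (1 / (f u + s * real k)) * e (F u) - V s) / (2 * pi * \<i>)"
      by (simp only: V_def R'_def R_def eint[OF u_def] eint[OF v_def])
    \<comment> \<open>The factor 4 comes from squaring \<open>k / 2\<close>; monotonicity of
      \<open>f\<close> lets the variation telescope to at most \<open>2 * M\<close>.\<close>
    have "((\<lambda>t. 4 / (real k)\<^sup>2 * (\<sigma> * f' t)) has_integral 4 / (real k)\<^sup>2 * (\<sigma> * (f v - f u))) {u..v}"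
      by (intro has_integral_mult_right real_FTC[OF uv f])
    moreover have "norm (of_real (- f' t / (f t + s * real k)\<^sup>2) * e (F t + s * real k * t)) \<le> 4 / (real k)\<^sup>2 * (\<sigma> * f' t)"
      if t: "t \<in> {u..v}" for t
    proof -
      have "(real k / 2)\<^sup>2 \<le> \<bar>f t + s * real k\<bar>\<^sup>2"
        using half[OF t s1] k0 by (intro power_mono) auto
      then have "(real k)\<^sup>2 / 4 \<le> (f t + s * real k)\<^sup>2" by (simp add: power_divide)
      moreover have "\<bar>f' t\<bar> = \<sigma> * f' t"
        using sg(1) sg(2)[OF t] by (metis abs_mult abs_of_nonneg mult_1)
      ultimately have "\<bar>f' t\<bar> / (f t + s * real k)\<^sup>2 \<le> (\<sigma> * f' t) / ((real k)\<^sup>2 / 4)"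
        using k0 by (intro frac_le) auto
      then show ?thesis by (simp add: norm_mult norm_divide mult.commute flip: of_real_minus of_real_divide)
    qed
    ultimately have "norm (V s) \<le> 4 / (real k)\<^sup>2 * (\<sigma> * (f v - f u))"
      unfolding V_def
    proof (intro norm_integral_le)
      show "continuous_on {u..v} (\<lambda>t. of_real (- f' t / (f t + s * real k)\<^sup>2) * e (F t + s * real k * t))"
        by (intro continuous_on_mult continuous_on_of_real cR'[unfolded R'_def] continuous_intros cF)
    qed
    also have "\<sigma> * (f v - f u) \<le> \<bar>\<sigma> * (f v - f u)\<bar>" by simp
    also have "\<dots> = \<bar>f v - f u\<bar>" using sg(1) by (simp add: abs_mult)
    also have "\<dots> \<le> 2 * M" using M[of u] M[of v] uv by auto
    finally show "norm (V s) \<le> 8 * M / (real k)\<^sup>2" using k0 by (simp add: divide_right_mono mult_left_mono)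
  qed
  have B: "\<bar>1 / (f x - real k) + 1 / (f x + real k)\<bar> \<le> 4 * M / (real k)\<^sup>2" if x: "x \<in> {u..v}" for x
  proof -
    have nz: "f x - real k \<noteq> 0" "f x + real k \<noteq> 0"
      using half[OF x, of 1] half[OF x, of "-1"] k0 by auto
    have "\<bar>f x\<bar> \<le> real k / 2" using M[OF x] k by simp
    then have "\<bar>f x\<bar>\<^sup>2 \<le> (real k / 2)\<^sup>2" by (intro power_mono) auto
    then have "(f x)\<^sup>2 \<le> (real k)\<^sup>2 / 4" by (simp add: power_divide)
    then have sq: "(real k)\<^sup>2 / 2 \<le> (real k)\<^sup>2 - (f x)\<^sup>2"
      using zero_le_power2[of "f x"] by linarith
    have "1 / (f x - real k) + 1 / (f x + real k) = - (2 * f x / ((real k)\<^sup>2 - (f x)\<^sup>2))"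
    proof -
      have "1 / (f x - real k) + 1 / (f x + real k) = (2 * f x) / ((f x - real k) * (f x + real k))"
        using nz by (simp add: add_frac_eq)
      also have "(f x - real k) * (f x + real k) = - ((real k)\<^sup>2 - (f x)\<^sup>2)"
        by (simp add: algebra_simps power2_eq_square)
      finally show ?thesis by (simp only: divide_minus_right)
    qed
    then have "\<bar>1 / (f x - real k) + 1 / (f x + real k)\<bar> = 2 * \<bar>f x\<bar> / \<bar>(real k)\<^sup>2 - (f x)\<^sup>2\<bar>"
      by (simp add: abs_divide abs_mult)
    also have "\<dots> \<le> 2 * M / ((real k)\<^sup>2 / 2)"
    proof (rule frac_le)
      show "(real k)\<^sup>2 / 2 \<le> \<bar>(real k)\<^sup>2 - (f x)\<^sup>2\<bar>" using sq by linarith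
    qed (use M[OF x] k0 M0 in auto)
    finally show ?thesis by simp
  qed
  have "integral {u..v} (\<lambda>t. e (F t - real k * t)) + integral {u..v} (\<lambda>t. e (F t + real k * t)) =
    (of_real (1 / (f v - real k) + 1 / (f v + real k)) * e (F v) -
     of_real (1 / (f u - real k) + 1 / (f u + real k)) * e (F u) - (V (-1) + V 1)) / (2 * pi * \<i>)"
  proof -
    have gen: "(a1 * x - b1 * y - v1) / C + (a2 * x - b2 * y - v2) / C =
        ((a1 + a2) * x - (b1 + b2) * y - (v1 + v2)) / C" for a1 a2 b1 b2 x y v1 v2 C :: complex
    proof -
      have "(a1 * x - b1 * y - v1) + (a2 * x - b2 * y - v2) = (a1 + a2) * x - (b1 + b2) * y - (v1 + v2)"
        by (simp add: algebra_simps)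
      then show ?thesis by (simp only: add_divide_distrib[symmetric])
    qed
    have J1: "integral {u..v} (\<lambda>t. e (F t - real k * t)) =
      (of_real (1 / (f v - real k)) * e (F v) - of_real (1 / (f u - real k)) * e (F u) - V (-1)) / (2 * pi * \<i>)"
      using I[of "-1"] by simp
    have J2: "integral {u..v} (\<lambda>t. e (F t + real k * t)) =
      (of_real (1 / (f v + real k)) * e (F v) - of_real (1 / (f u + real k)) * e (F u) - V 1) / (2 * pi * \<i>)"
      using I[of 1] by simp
    show ?thesis unfolding J1 J2 gen of_real_add ..
  qed
  moreover have "norm \<dots> \<le> (4 * M / (real k)\<^sup>2 + 4 * M / (real k)\<^sup>2 + (8 * M / (real k)\<^sup>2 + 8 * M / (real k)\<^sup>2)) / (2 * pi)"
    unfolding norm_divide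
  proof (rule frac_le)
    show "norm (of_real (1 / (f v - real k) + 1 / (f v + real k)) * e (F v) -
     of_real (1 / (f u - real k) + 1 / (f u + real k)) * e (F u) - (V (-1) + V 1))
     \<le> 4 * M / (real k)\<^sup>2 + 4 * M / (real k)\<^sup>2 + (8 * M / (real k)\<^sup>2 + 8 * M / (real k)\<^sup>2)"
      by (intro order_trans[OF norm_triangle_ineq4] add_mono order_trans[OF norm_triangle_ineq] Vb)
        (use B[of u] B[of v] uv in \<open>auto simp only: norm_mult norm_e norm_of_real mult_1_right atLeastAtMost_iff\<close>)
  qed (use M0 in \<open>auto simp: norm_mult\<close>)
  \<comment> \<open>The total \<open>24 * M / k^2\<close> is divided by
    \<open>2 * pi > 6\<close>.\<close>
  moreover have "\<dots> \<le> 4 * M / (real k)\<^sup>2"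
  proof -
    define x where "x = M / (real k)\<^sup>2"
    have "24 * x \<le> 4 * x * (2 * pi)"
      using M0 pi_gt3 mult_right_mono[of 3 pi "8 * x"] by (simp add: x_def mult.commute mult.left_commute)
    then have "24 * x / (2 * pi) \<le> 4 * x" by (subst pos_divide_le_eq) auto
    then show ?thesis by (simp add: x_def)
  qed
  ultimately show ?thesis unfolding uv_defs by simp
qed

text \<open>The 3 consists of 1 for the two half endpoint terms and 2 for the discarded pairs, whose
  sum is at most \<open>4 * M / K \<le> 2\<close>.\<close>

lemma poisson_sum:
  fixes F f f' :: "real \<Rightarrow> real" and p q :: int
  assumes pq: "p \<le> q"
    and F: "\<And>t. t \<in> {real_of_int p..real_of_int q} \<Longrightarrow> (F has_real_derivative f t) (at t within {real_of_int p..real_of_int q})"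
    and f: "\<And>t. t \<in> {real_of_int p..real_of_int q} \<Longrightarrow> (f has_real_derivative f' t) (at t within {real_of_int p..real_of_int q})"
    and cf': "continuous_on {real_of_int p..real_of_int q} f'"
    and sg: "\<bar>\<sigma>\<bar> = (1::real)" "\<And>t. t \<in> {real_of_int p..real_of_int q} \<Longrightarrow> 0 \<le> \<sigma> * f' t"
    and M: "\<And>t. t \<in> {real_of_int p..real_of_int q} \<Longrightarrow> \<bar>f t\<bar> \<le> M"
    and K: "1 \<le> K" "2 * M \<le> real K"
  shows "norm ((\<Sum>h\<in>{p..q}. e (F h)) - (\<Sum>k\<in>{- int K..int K}. integral {real_of_int p..real_of_int q} (\<lambda>t. e (F t - of_int k * t)))) \<le> 3"
proof -
  define I where "I = (\<lambda>k::int. integral {real_of_int p..real_of_int q} (\<lambda>t. e (F t - of_int k * t)))"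
  define N where "N = (\<lambda>K. \<Sum>k\<in>{- int K..int K}. I k)"
  have cF: "continuous_on {real_of_int p..real_of_int q} F"
    by (rule has_real_derivative_imp_continuous_on[OF F])
  have cf: "continuous_on {real_of_int p..real_of_int q} f"
    by (rule has_real_derivative_imp_continuous_on[OF f])
  define S where "S = (\<Sum>h\<in>{p..q}. e (F h))"
  have I_eq: "integral {of_int p..of_int q} (\<lambda>t. e (F t) * e (- (of_int k * t))) = I k" for k
    by (simp add: I_def flip: e_add)
  have lim: "N \<longlonglongrightarrow> S - (e (F p) + e (F q)) / 2"
  proof -
    have "continuous_on {real_of_int p..real_of_int q} (\<lambda>t. (2 * pi * f t) *\<^sub>R (\<i> * e (F t)))"
      by (intro continuous_intros cF cf)
    from poisson_interval[OF pq e_has_vector_derivative[OF F] this] show ?thesis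
      unfolding N_def S_def I_eq .
  qed
  have M0: "0 \<le> M" using M[of p] pq by (meson abs_ge_zero atLeastAtMost_iff of_int_le_iff order_refl order_trans)
  have step: "norm (N (Suc n) - N n) \<le> 4 * M / (real (Suc n))\<^sup>2" if "K \<le> n" for n
  proof -
    have "{- int (Suc n)..int (Suc n)} = insert (- int (Suc n)) (insert (int (Suc n)) {- int n..int n})"
      by auto
    then have "N (Suc n) - N n = I (int (Suc n)) + I (- int (Suc n))"
      by (simp add: N_def algebra_simps)
    also have "norm \<dots> \<le> 4 * M / (real (Suc n))\<^sup>2"
      using poisson_pair_bound[OF pq F f cf' sg M, of "Suc n"] that K
      by (simp add: I_def algebra_simps)
    finally show ?thesis .
  qed
  have "norm (N n - N K) \<le> (\<Sum>k=Suc K..n. 4 * M / (real k)\<^sup>2)" if "K \<le> n" for n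
    using that
  proof (induction n rule: dec_induct)
    case (step n)
    have "norm (N (Suc n) - N K) \<le> norm (N (Suc n) - N n) + norm (N n - N K)"
      using norm_triangle_ineq[of "N (Suc n) - N n" "N n - N K"] by simp
    then show ?case using step \<open>\<And>n. K \<le> n \<Longrightarrow> norm (N (Suc n) - N n) \<le> 4 * M / (real (Suc n))\<^sup>2\<close>[of n]
      by simp
  qed simp
  also have "(\<Sum>k=Suc K..n. 4 * M / (real k)\<^sup>2) \<le> 2" for n
  proof -
    have "(\<Sum>k=Suc K..n. 4 * M / (real k)\<^sup>2) = 4 * M * (\<Sum>k=Suc K..n. 1 / (real k)\<^sup>2)"
      by (simp add: sum_distrib_left)
    also have "\<dots> \<le> 4 * M * (1 / real K)"
      using M0 K by (intro mult_left_mono sum_inverse_squares_tail) auto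
    also have "\<dots> \<le> 2" using K by (simp add: field_simps)
    finally show ?thesis .
  qed
  finally have "\<forall>\<^sub>F n in sequentially. norm (N n - N K) \<le> 2"
    by (auto intro: eventually_sequentiallyI)
  then have "norm ((S - (e (F p) + e (F q)) / 2) - N K) \<le> 2"
    by (intro tendsto_upperbound[OF tendsto_norm[OF tendsto_diff[OF lim tendsto_const]]]) auto
  moreover have "norm ((e (F p) + e (F q)) / 2) \<le> 1"
    using norm_triangle_ineq[of "e (F p)" "e (F q)"] by (simp add: norm_divide)
  moreover have "S - N K = ((S - (e (F p) + e (F q)) / 2) - N K) + (e (F p) + e (F q)) / 2" by simp
  ultimately have "norm (S - N K) \<le> 3"
    using norm_triangle_ineq[of "(S - (e (F p) + e (F q)) / 2) - N K" "(e (F p) + e (F q)) / 2"] by simp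
  then show ?thesis unfolding S_def N_def I_def .
qed

section \<open>Sums of monomial phases\<close>

lemma powr_comparable:
  fixes x y \<kappa> \<alpha> :: real
  assumes "0 < x" "1 \<le> \<kappa>" "x / \<kappa> \<le> y" "y \<le> \<kappa> * x"
  shows "y powr \<alpha> \<le> \<kappa> powr \<bar>\<alpha>\<bar> * x powr \<alpha>"
proof -
  have y: "0 < y" using assms by (meson divide_pos_pos less_le_trans zero_less_one)
  define r where "r = y / x"
  have r: "0 < r" "r \<le> \<kappa>" "1 / r \<le> \<kappa>"
    using assms y by (auto simp: r_def field_simps)
  have "r powr \<alpha> \<le> \<kappa> powr \<bar>\<alpha>\<bar>"
  proof (cases "\<alpha> \<ge> 0")
    case True
    then show ?thesis using r by (simp add: powr_mono2)
  next
    case False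
    have "r powr \<alpha> = (1 / r) powr (- \<alpha>)" using r by (simp add: powr_divide powr_minus_divide)
    also have "\<dots> \<le> \<kappa> powr (- \<alpha>)" using r False by (intro powr_mono2) auto
    finally show ?thesis using False by simp
  qed
  moreover have "y powr \<alpha> = r powr \<alpha> * x powr \<alpha>"
    using assms y by (simp add: r_def flip: powr_mult)
  ultimately show ?thesis by (simp add: mult_right_mono)
qed

lemma powr_dyadic:
  fixes N t \<alpha> :: real
  assumes "0 < N" "N \<le> t" "t \<le> 2 * N"
  shows "t powr \<alpha> \<le> 2 powr \<bar>\<alpha>\<bar> * N powr \<alpha>" and "N powr \<alpha> \<le> 2 powr \<bar>\<alpha>\<bar> * t powr \<alpha>"
  using powr_comparable[of N 2 t \<alpha>] powr_comparable[of t 2 N \<alpha>] assms by auto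

lemma powr_has_real_derivative:
  assumes "0 < t"
  shows "((\<lambda>t. A * t powr \<alpha>) has_real_derivative A * \<alpha> * t powr (\<alpha> - 1)) (at t within S)"
  using DERIV_subset[OF DERIV_cmult[OF has_real_derivative_powr[OF assms, of \<alpha>], of A]] 
  by (simp add: mult.assoc)

text \<open>Van der Corput's test for sums: Poisson summation leaves at most
  \<open>4 * M + 5\<close> integrals, and the linear term \<open>k * t\<close> does not affect the
  second derivative, so one bound serves all of them.\<close>

lemma second_derivative_sum_test:
  fixes F f f' :: "real \<Rightarrow> real" and p q :: nat
  assumes pq: "p \<le> q"
    and F: "\<And>t. t \<in> {real p..real q} \<Longrightarrow> (F has_real_derivative f t) (at t within {real p..real q})"
    and f: "\<And>t. t \<in> {real p..real q} \<Longrightarrow> (f has_real_derivative f' t) (at t within {real p..real q})"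
    and cf': "continuous_on {real p..real q} f'"
    and la: "0 < \<delta>" and sg: "\<bar>\<sigma>\<bar> = (1::real)" "\<And>t. t \<in> {real p..real q} \<Longrightarrow> \<delta> \<le> \<sigma> * f' t"
    and M: "\<And>t. t \<in> {real p..real q} \<Longrightarrow> \<bar>f t\<bar> \<le> M"
  shows "norm (\<Sum>n\<in>{p..q}. e (F n)) \<le> 3 + (4 * M + 5) * (4 / sqrt \<delta>)"
proof -
  \<comment> \<open>One above the ceiling, so that \<open>K \<ge> 1\<close> also when
    \<open>M = 0\<close>.\<close>
  define K where "K = nat \<lceil>2 * M\<rceil> + 1"
  have M0: "0 \<le> M" using M[of "real p"] pq by (meson abs_ge_zero atLeastAtMost_iff of_nat_le_iff order_refl order_trans)
  have "real (nat \<lceil>2 * M\<rceil>) = of_int \<lceil>2 * M\<rceil>" using M0 by simp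
  then have K: "1 \<le> K" "2 * M \<le> real K" "real (2 * K + 1) \<le> 4 * M + 5"
    unfolding K_def by (simp_all, linarith+)
  let ?I = "\<lambda>k::int. integral {real p..real q} (\<lambda>t. e (F t - of_int k * t))"
  have I: "norm (?I k) \<le> 4 / sqrt \<delta>" for k
  proof (rule second_derivative_test[where f = "\<lambda>t. f t - of_int k" and \<sigma> = \<sigma>])
    fix t assume t: "t \<in> {real p..real q}"
    show "((\<lambda>t. F t - of_int k * t) has_real_derivative f t - of_int k) (at t within {real p..real q})"
      by (rule derivative_eq_intros F[OF t] refl | simp)+
    show "((\<lambda>t. f t - of_int k) has_real_derivative f' t) (at t within {real p..real q})"
      by (rule derivative_eq_intros f[OF t] refl | simp)+
  qed (use assms in auto)
  have "norm (\<Sum>k\<in>{- int K..int K}. ?I k) \<le> (\<Sum>k\<in>{- int K..int K}. 4 / sqrt \<delta>)"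
    by (intro sum_norm_le I)
  also have "\<dots> = real (2 * K + 1) * (4 / sqrt \<delta>)" by (simp add: nat_add_distrib)
  also have "\<dots> \<le> (4 * M + 5) * (4 / sqrt \<delta>)"
    using K la by (intro mult_right_mono) auto
  finally have 1: "norm (\<Sum>k\<in>{- int K..int K}. ?I k) \<le> (4 * M + 5) * (4 / sqrt \<delta>)" .
  have sg': "0 \<le> \<sigma> * f' t" if "t \<in> {real p..real q}" for t using sg(2)[OF that] la by simp
  have 2: "norm ((\<Sum>h\<in>{int p..int q}. e (F (of_int h))) - (\<Sum>k\<in>{- int K..int K}. ?I k)) \<le> 3"
    using poisson_sum[of "int p" "int q" F f f' \<sigma> M K] pq F f cf' sg(1) sg' M K by simp
  have "(\<Sum>n\<in>{p..q}. e (F n)) = (\<Sum>h\<in>{int p..int q}. e (F (of_int h)))"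
    by (simp add: sum.reindex flip: image_int_atLeastAtMost)
  then have "norm (\<Sum>n\<in>{p..q}. e (F n)) \<le> norm ((\<Sum>h\<in>{int p..int q}. e (F (of_int h))) - (\<Sum>k\<in>{- int K..int K}. ?I k))
      + norm (\<Sum>k\<in>{- int K..int K}. ?I k)"
    using norm_triangle_ineq[of "(\<Sum>h\<in>{int p..int q}. e (F (of_int h))) - (\<Sum>k\<in>{- int K..int K}. ?I k)"
        "\<Sum>k\<in>{- int K..int K}. ?I k"] by simp
  then show ?thesis using 1 2 by linarith
qed

text \<open>With \<open>Z = |A| * N powr \<gamma>\<close> the first two derivatives on the dyadic
  range are comparable with \<open>Z / N\<close> and \<open>Z / N^2\<close>; the excluded exponents
  are those for which the second derivative vanishes. The shape of the bound is
  \<open>(Z / N + 1) / sqrt (Z / N^2) = sqrt Z + N / sqrt Z\<close>.\<close>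

lemma monomial_sum_bound:
  fixes \<gamma> :: real
  assumes g: "\<gamma> \<noteq> 0" "\<gamma> \<noteq> 1"
  shows "\<exists>C>0. \<forall>A N p q. A \<noteq> 0 \<longrightarrow> 0 < N \<longrightarrow> N \<le> real p \<longrightarrow> real q \<le> 2 * N \<longrightarrow>
    norm (\<Sum>n\<in>{p..q}. e (A * real n powr \<gamma>)) \<le> C * (1 + sqrt (\<bar>A\<bar> * N powr \<gamma>) + N / sqrt (\<bar>A\<bar> * N powr \<gamma>))"
proof -
  define m where "m = \<bar>\<gamma>\<bar> * 2 powr \<bar>\<gamma> - 1\<bar>"
  define d where "d = \<bar>\<gamma> * (\<gamma> - 1)\<bar> / 2 powr \<bar>\<gamma> - 2\<bar>"
  have md: "0 < m" "0 < d" using g by (auto simp: m_def d_def)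
  define C where "C = 3 + 16 * m / sqrt d + 20 / sqrt d"
  show ?thesis
  proof (intro exI[of _ C] conjI allI impI)
    show "0 < C" using md by (simp add: C_def add_pos_pos)
    fix A N :: real and p q :: nat
    assume A: "A \<noteq> 0" and N: "0 < N" and p: "N \<le> real p" and q: "real q \<le> 2 * N"
    define Z where "Z = \<bar>A\<bar> * N powr \<gamma>"
    have Z: "0 < Z" using A N by (simp add: Z_def)
    show "norm (\<Sum>n\<in>{p..q}. e (A * real n powr \<gamma>)) \<le> C * (1 + sqrt (\<bar>A\<bar> * N powr \<gamma>) + N / sqrt (\<bar>A\<bar> * N powr \<gamma>))"
    proof (cases "p \<le> q")
      case False
      then show ?thesis using \<open>0 < C\<close> N by simp
    next
      case True
      define \<sigma> where "\<sigma> = sgn (A * \<gamma> * (\<gamma> - 1))"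
      have sg: "\<bar>\<sigma>\<bar> = 1" using A g by (simp add: \<sigma>_def abs_sgn_eq)
      have t: "0 < t" "N \<le> t" "t \<le> 2 * N" if "t \<in> {real p..real q}" for t
        using that p q N by auto
      have nz: "0 \<notin> {real p..real q}" using t by force
      have "norm (\<Sum>n\<in>{p..q}. e (A * real n powr \<gamma>)) \<le> 3 + (4 * (m * Z / N) + 5) * (4 / sqrt (d * Z / N\<^sup>2))"
      proof (rule second_derivative_sum_test[OF True])
        fix x assume x: "x \<in> {real p..real q}"
        note tx = t[OF x]
        show "((\<lambda>t. A * t powr \<gamma>) has_real_derivative A * \<gamma> * x powr (\<gamma> - 1)) (at x within {real p..real q})"
          by (rule powr_has_real_derivative[OF tx(1)])
        show "((\<lambda>t. A * \<gamma> * t powr (\<gamma> - 1)) has_real_derivative A * \<gamma> * (\<gamma> - 1) * x powr (\<gamma> - 1 - 1)) (at x within {real p..real q})"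
          by (rule powr_has_real_derivative[OF tx(1)])
        have "\<bar>A * \<gamma> * x powr (\<gamma> - 1)\<bar> \<le> \<bar>A\<bar> * \<bar>\<gamma>\<bar> * (2 powr \<bar>\<gamma> - 1\<bar> * N powr (\<gamma> - 1))"
          using powr_dyadic(1)[OF N tx(2,3), of "\<gamma> - 1"] by (simp add: abs_mult mult_left_mono)
        also have "\<dots> = m * Z / N" using N by (simp add: m_def Z_def powr_diff)
        finally show "\<bar>A * \<gamma> * x powr (\<gamma> - 1)\<bar> \<le> m * Z / N" .
        have "d * Z / N\<^sup>2 = \<bar>A\<bar> * \<bar>\<gamma> * (\<gamma> - 1)\<bar> * (N powr (\<gamma> - 2) / 2 powr \<bar>\<gamma> - 2\<bar>)"
          using N by (simp add: d_def Z_def powr_diff mult.commute mult.left_commute)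
        also have "\<dots> \<le> \<bar>A\<bar> * \<bar>\<gamma> * (\<gamma> - 1)\<bar> * x powr (\<gamma> - 2)"
          using powr_dyadic(2)[OF N tx(2,3), of "\<gamma> - 2"] by (intro mult_left_mono) (auto simp: field_simps)
        also have "\<dots> = \<sigma> * (A * \<gamma> * (\<gamma> - 1)) * x powr (\<gamma> - 2)"
        proof -
          have "\<sigma> * (A * \<gamma> * (\<gamma> - 1)) = \<bar>A * \<gamma> * (\<gamma> - 1)\<bar>"
            unfolding \<sigma>_def by (simp only: abs_sgn mult.commute)
          then show ?thesis by (simp add: abs_mult mult.assoc)
        qed
        finally show "d * Z / N\<^sup>2 \<le> \<sigma> * (A * \<gamma> * (\<gamma> - 1) * x powr (\<gamma> - 1 - 1))"
          by (simp add: mult.assoc)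
      next
        show "continuous_on {real p..real q} (\<lambda>x. A * \<gamma> * (\<gamma> - 1) * x powr (\<gamma> - 1 - 1))"
          using nz by (intro continuous_intros) auto
      qed (use md Z N sg in auto)
      also have "4 / sqrt (d * Z / N\<^sup>2) = (4 / sqrt d) * (N / sqrt Z)"
        using N by (simp add: real_sqrt_divide real_sqrt_mult)
      also have "(4 * (m * Z / N) + 5) * ((4 / sqrt d) * (N / sqrt Z)) = 
          (16 * m / sqrt d) * sqrt Z + (20 / sqrt d) * (N / sqrt Z)"
      proof -
        have "Z / sqrt Z = sqrt Z" using Z by (simp add: real_div_sqrt)
        moreover have "(4 * (m * Z / N) + 5) * ((4 / sqrt d) * (N / sqrt Z)) = 
          (16 * m / sqrt d) * (Z / sqrt Z) + (20 / sqrt d) * (N / sqrt Z)"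
          using N by (simp add: distrib_right add_divide_distrib mult.assoc)
        ultimately show ?thesis by simp
      qed
      also have "3 + ((16 * m / sqrt d) * sqrt Z + (20 / sqrt d) * (N / sqrt Z)) \<le> C * 1 + (C * sqrt Z + C * (N / sqrt Z))"
        using md Z N by (intro add_mono mult_right_mono) (auto simp: C_def)
      finally show ?thesis by (simp add: Z_def distrib_left add.assoc)
    qed
  qed
qed

text \<open>Apart from the two integers adjacent to \<open>x\<close>, the distances
  \<open>|k - x|\<close> on either side are at least 1, 2, 3 and so on, which gives one harmonic sum
  per side; the two exceptions get the bound \<open>A\<close>. For oscillatory integrals of
  frequency \<open>k\<close>, \<open>A\<close> is a bound that ignores \<open>k\<close> and
  \<open>B\<close> measures the decay away from resonance.\<close>

lemma sum_reciprocal_distance_le: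
  fixes g :: "int \<Rightarrow> real" and x A B :: real
  assumes S: "S \<subseteq> {- int K..int K}" and x: "\<bar>x\<bar> \<le> real K" and B: "0 \<le> B" and A: "0 \<le> A"
    and gA: "\<And>k. k \<in> S \<Longrightarrow> g k \<le> A" and gB: "\<And>k. k \<in> S \<Longrightarrow> \<bar>of_int k - x\<bar> * g k \<le> B"
  shows "sum g S \<le> 2 * A + 2 * B * harm (2 * K + 1)"
proof -
  have fS: "finite S" using S finite_subset by blast
  define j where "j = \<lfloor>x\<rfloor>"
  have j: "of_int j \<le> x" "x < of_int j + 1" by (auto simp: j_def)
  have jK: "- int K \<le> j" "j \<le> int K" using x j by linarith+
  define L where "L = {k\<in>S. k < j}"
  define R where "R = {k\<in>S. j + 1 < k}"
  define E where "E = {k\<in>S. k = j \<or> k = j + 1}"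
  have "S = E \<union> (L \<union> R)" by (auto simp: L_def R_def E_def)
  then have "sum g S = sum g (E \<union> (L \<union> R))" by simp
  also have "\<dots> = sum g E + sum g (L \<union> R)"
    by (rule sum.union_disjoint) (use fS in \<open>auto simp: L_def R_def E_def\<close>)
  also have "sum g (L \<union> R) = sum g L + sum g R"
    by (rule sum.union_disjoint) (use fS in \<open>auto simp: L_def R_def\<close>)
  finally have split: "sum g S = sum g E + (sum g L + sum g R)" .
  have "sum g E \<le> (\<Sum>k\<in>E. A)" by (intro sum_mono gA) (auto simp: E_def)
  also have "\<dots> \<le> (\<Sum>k\<in>{j, j + 1}. A)" using A by (intro sum_mono2) (auto simp: E_def)
  finally have 1: "sum g E \<le> 2 * A" by simp
  \<comment> \<open>\<open>d\<close> labels the points of one side injectively by positive integers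
    not exceeding their distance to \<open>x\<close>.\<close>
  have H: "sum g T \<le> B * harm (2 * K + 1)"
    if T: "T \<subseteq> S" and d: "inj_on d T" "d ` T \<subseteq> {1..2 * K + 1}" "\<And>k. k \<in> T \<Longrightarrow> real (d k) \<le> \<bar>of_int k - x\<bar>"
    for T and d :: "int \<Rightarrow> nat"
  proof -
    have "sum g T \<le> (\<Sum>k\<in>T. B * inverse (of_nat (d k)))"
    proof (rule sum_mono)
      fix k assume k: "k \<in> T"
      have pos: "0 < real (d k)" using d(2) k by force
      show "g k \<le> B * inverse (of_nat (d k))"
      proof (cases "g k \<le> 0")
        case True
        then show ?thesis using B by (meson inverse_nonnegative_iff_nonnegative mult_nonneg_nonneg of_nat_0_le_iff order_trans)
      next
        case False
        then have "real (d k) * g k \<le> \<bar>of_int k - x\<bar> * g k" using d(3)[OF k] by (intro mult_right_mono) auto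
        also have "\<dots> \<le> B" using gB T k by blast
        finally show ?thesis using pos by (simp add: field_simps)
      qed
    qed
    also have "\<dots> = (\<Sum>i\<in>d ` T. B * inverse (of_nat i))"
      using d(1) by (simp add: sum.reindex)
    also have "\<dots> \<le> (\<Sum>i\<in>{1..2 * K + 1}. B * inverse (of_nat i))"
      using d(2) B by (intro sum_mono2) auto
    finally show ?thesis by (simp only: harm_def sum_distrib_left)
  qed
  have 2: "sum g L \<le> B * harm (2 * K + 1)"
  proof (rule H[of _ "\<lambda>k. nat (j - k)"])
    show "inj_on (\<lambda>k. nat (j - k)) L" by (auto simp: inj_on_def L_def)
    show "(\<lambda>k. nat (j - k)) ` L \<subseteq> {1..2 * K + 1}" using S jK by (force simp: L_def)
    fix k assume "k \<in> L"
    then show "real (nat (j - k)) \<le> \<bar>of_int k - x\<bar>" using j by (simp add: L_def)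
  qed (auto simp: L_def)
  have 3: "sum g R \<le> B * harm (2 * K + 1)"
  proof (rule H[of _ "\<lambda>k. nat (k - (j + 1))"])
    show "inj_on (\<lambda>k. nat (k - (j + 1))) R" by (auto simp: inj_on_def R_def)
    show "(\<lambda>k. nat (k - (j + 1))) ` R \<subseteq> {1..2 * K + 1}" using S jK by (force simp: R_def)
    fix k assume "k \<in> R"
    then show "real (nat (k - (j + 1))) \<le> \<bar>of_int k - x\<bar>" using j by (simp add: R_def)
  qed (auto simp: R_def)
  show ?thesis using split 1 2 3 by (simp add: algebra_simps)
qed

text \<open>Over a length of at most 1 the derivative \<open>f\<close> moves by at most
  \<open>L\<close>, so \<open>f u\<close> represents it. Frequencies within \<open>2 * L\<close> of
  \<open>f u\<close> are estimated by the length of the interval, the others by the first derivative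
  test with \<open>\<mu>\<close> half their distance to \<open>f u\<close>; the sum over
  \<open>k\<close> is then logarithmic.\<close>

lemma short_interval_integral_sum_le:
  fixes F f f' :: "real \<Rightarrow> real"
  assumes uv: "u \<le> v" "v \<le> u + 1"
    and F: "\<And>t. t \<in> {u..v} \<Longrightarrow> (F has_real_derivative f t) (at t within {u..v})"
    and f: "\<And>t. t \<in> {u..v} \<Longrightarrow> (f has_real_derivative f' t) (at t within {u..v})"
    and cf': "continuous_on {u..v} f'"
    and sg: "\<bar>\<sigma>\<bar> = (1::real)" "\<And>t. t \<in> {u..v} \<Longrightarrow> 0 \<le> \<sigma> * f' t"
    and L: "\<And>t. t \<in> {u..v} \<Longrightarrow> \<bar>f' t\<bar> \<le> L"
    and K: "\<And>t. t \<in> {u..v} \<Longrightarrow> \<bar>f t\<bar> \<le> real K"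
  shows "(\<Sum>k\<in>{- int K..int K}. norm (integral {u..v} (\<lambda>t. e (F t - of_int k * t)))) \<le> 2 + 4 * (L + 1) * harm (2 * K + 1)"
proof -
  have cF: "continuous_on {u..v} F" by (rule has_real_derivative_imp_continuous_on[OF F])
  have L0: "0 \<le> L" using L[of u] uv by (meson abs_ge_zero atLeastAtMost_iff order_refl order_trans)
  let ?g = "\<lambda>k::int. norm (integral {u..v} (\<lambda>t. e (F t - of_int k * t)))"
  have g1: "?g k \<le> 1" for k
  proof -
    have "?g k \<le> (1 * (v - u))"
      by (rule norm_integral_le[where G = "\<lambda>_. 1"])
        (use uv has_integral_const_real[of "1::real" u v] in \<open>auto intro!: continuous_intros cF\<close>)
    then show ?thesis using uv by simp
  qed
  have "(\<Sum>k\<in>{- int K..int K}. ?g k) \<le> 2 * 1 + 2 * (2 * L + 2) * harm (2 * K + 1)"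
  proof (rule sum_reciprocal_distance_le[where x = "f u"])
    show "\<bar>f u\<bar> \<le> real K" using K uv by simp
    fix k :: int
    show "\<bar>of_int k - f u\<bar> * ?g k \<le> 2 * L + 2"
    proof (cases "\<bar>of_int k - f u\<bar> \<le> 2 * L")
      case True
      then have "\<bar>of_int k - f u\<bar> * ?g k \<le> 2 * L * 1" using g1[of k] L0 by (intro mult_mono) auto
      then show ?thesis by simp
    next
      case False
      define \<mu> where "\<mu> = \<bar>of_int k - f u\<bar> / 2"
      have mu: "0 < \<mu>" using False L0 by (simp add: \<mu>_def)
      have "?g k \<le> 1 / \<mu>"
      proof (rule first_derivative_test[where f = "\<lambda>t. f t - of_int k" and \<sigma> = \<sigma>])
        fix t assume t: "t \<in> {u..v}"
        show "((\<lambda>t. F t - of_int k * t) has_real_derivative f t - of_int k) (at t within {u..v})"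
          by (rule derivative_eq_intros F[OF t] refl | simp)+
        show "((\<lambda>t. f t - of_int k) has_real_derivative f' t) (at t within {u..v})"
          by (rule derivative_eq_intros f[OF t] refl | simp)+
        have "norm (f t - f u) \<le> L * norm (t - u)"
          by (rule field_differentiable_bound[of "{u..v}", OF _ f]) (use L t uv in auto)
        also have "\<dots> \<le> L * 1" using t uv L0 by (intro mult_left_mono) auto
        finally have "\<bar>f t - f u\<bar> \<le> L" by simp
        then show "\<mu> \<le> \<bar>f t - of_int k\<bar>" using False by (simp add: \<mu>_def abs_if split: if_splits)
      qed (use uv sg cf' mu in auto)
      then have "\<bar>of_int k - f u\<bar> * ?g k \<le> \<bar>of_int k - f u\<bar> * (1 / \<mu>)" by (intro mult_left_mono) auto
      also have "\<dots> = 2" using mu by (simp add: \<mu>_def)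
      finally show ?thesis using L0 by simp
    qed
  qed (use L0 g1 in auto)
  then show ?thesis by (simp add: algebra_simps)
qed

text \<open>Cutting at the extreme integers leaves two end pieces of length at most 1, whose
  frequency sums are only logarithmic as long as \<open>L\<close> is bounded. The constants are
  \<open>7 = 3 + 2 + 2\<close> and \<open>8 = 4 + 4\<close>.\<close>

lemma poisson_sum_real_endpoints:
  fixes F f f' :: "real \<Rightarrow> real"
  assumes uv: "u \<le> v"
    and F: "\<And>t. t \<in> {u..v} \<Longrightarrow> (F has_real_derivative f t) (at t within {u..v})"
    and f: "\<And>t. t \<in> {u..v} \<Longrightarrow> (f has_real_derivative f' t) (at t within {u..v})"
    and cf': "continuous_on {u..v} f'"
    and sg: "\<bar>\<sigma>\<bar> = (1::real)" "\<And>t. t \<in> {u..v} \<Longrightarrow> 0 \<le> \<sigma> * f' t"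
    and L: "\<And>t. t \<in> {u..v} \<Longrightarrow> \<bar>f' t\<bar> \<le> L"
    and M: "\<And>t. t \<in> {u..v} \<Longrightarrow> \<bar>f t\<bar> \<le> M"
    and K: "1 \<le> K" "2 * M \<le> real K"
  shows "norm ((\<Sum>h\<in>{\<lceil>u\<rceil>..\<lfloor>v\<rfloor>}. e (F h)) - (\<Sum>k\<in>{- int K..int K}. integral {u..v} (\<lambda>t. e (F t - of_int k * t))))
    \<le> 7 + 8 * (L + 1) * harm (2 * K + 1)"
proof -
  have cF: "continuous_on {u..v} F" by (rule has_real_derivative_imp_continuous_on[OF F])
  have L0: "0 \<le> L" using L[of u] uv by (meson abs_ge_zero atLeastAtMost_iff order_refl order_trans)
  have M0: "0 \<le> M" using M[of u] uv by (meson abs_ge_zero atLeastAtMost_iff order_refl order_trans)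
  have h0: "0 \<le> (harm (2 * K + 1) :: real)" by (rule harm_nonneg)
  have MK: "M \<le> real K" using K M0 by simp
  let ?I = "\<lambda>x y (k::int). integral {x..y} (\<lambda>t. e (F t - of_int k * t))"
  have short: "norm (\<Sum>k\<in>{- int K..int K}. ?I x y k) \<le> 2 + 4 * (L + 1) * harm (2 * K + 1)"
    if "u \<le> x" "x \<le> y" "y \<le> v" "y \<le> x + 1" for x y
  proof -
    have sub: "{x..y} \<subseteq> {u..v}" using that by auto
    have "(\<Sum>k\<in>{- int K..int K}. norm (?I x y k)) \<le> 2 + 4 * (L + 1) * harm (2 * K + 1)"
    proof (rule short_interval_integral_sum_le[where f' = f' and \<sigma> = \<sigma>])
      fix t assume t: "t \<in> {x..y}"
      show "(F has_real_derivative f t) (at t within {x..y})" "(f has_real_derivative f' t) (at t within {x..y})"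
        using DERIV_subset[OF F sub] DERIV_subset[OF f sub] sub t by blast+
      show "\<bar>f t\<bar> \<le> real K" using M[of t] sub t MK by force
    qed (use that sub L sg continuous_on_subset[OF cf' sub] in auto)
    then show ?thesis using sum_norm_le[of "{- int K..int K}" "?I x y" "\<lambda>k. norm (?I x y k)"] by simp
  qed
  show ?thesis
  proof (cases "\<lceil>u\<rceil> \<le> \<lfloor>v\<rfloor>")
    \<comment> \<open>Without an integer inside, the whole interval is one short piece and the sum
      over \<open>h\<close> is empty.\<close>
    case False
    then have "v \<le> u + 1" by linarith
    then have "norm (\<Sum>k\<in>{- int K..int K}. ?I u v k) \<le> 2 + 4 * ((L + 1) * harm (2 * K + 1))"
      using short[of u v] uv by (simp only: mult.assoc order_refl)
    moreover have "0 \<le> (L + 1) * harm (2 * K + 1)" using L0 h0 by simp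
    ultimately have "norm (\<Sum>k\<in>{- int K..int K}. ?I u v k) \<le> 7 + 8 * ((L + 1) * harm (2 * K + 1))"
      by linarith
    moreover have "{\<lceil>u\<rceil>..\<lfloor>v\<rfloor>} = {}" using False by simp
    ultimately show ?thesis by (simp only: sum.empty diff_0 norm_minus_cancel mult.assoc)
  next
    case True
    define p q where "p = \<lceil>u\<rceil>" and "q = \<lfloor>v\<rfloor>"
    have pq: "p \<le> q" "u \<le> of_int p" "of_int p \<le> u + 1" "of_int q \<le> v" "v \<le> of_int q + 1"
      "of_int p \<le> (of_int q :: real)"
      using True by (auto simp: p_def q_def)
    have sub: "{real_of_int p..real_of_int q} \<subseteq> {u..v}" using pq by auto
    have P: "norm ((\<Sum>h\<in>{p..q}. e (F h)) - (\<Sum>k\<in>{- int K..int K}. ?I p q k)) \<le> 3"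
    proof (rule poisson_sum[where f' = f' and \<sigma> = \<sigma>])
      fix t assume t: "t \<in> {real_of_int p..real_of_int q}"
      show "(F has_real_derivative f t) (at t within {real_of_int p..real_of_int q})"
         "(f has_real_derivative f' t) (at t within {real_of_int p..real_of_int q})"
        using DERIV_subset[OF F sub] DERIV_subset[OF f sub] sub t by blast+
      show "\<bar>f t\<bar> \<le> M" using M[of t] sub t by blast
      show "0 \<le> \<sigma> * f' t" using sg(2)[of t] sub t by blast
    qed (use pq K sg continuous_on_subset[OF cf' sub] in auto)
    have comb: "?I u v k = ?I u p k + ?I p q k + ?I q v k" for k
    proof -
      have i: "(\<lambda>t. e (F t - of_int k * t)) integrable_on {u..v}"
        by (intro integrable_continuous_interval continuous_intros cF)
      have i2: "(\<lambda>t. e (F t - of_int k * t)) integrable_on {u..of_int q}"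
        by (rule integrable_on_subinterval[OF i]) (use pq in auto)
      show ?thesis
        using Henstock_Kurzweil_Integration.integral_combine[OF _ pq(4) i]
          Henstock_Kurzweil_Integration.integral_combine[OF pq(2,6) i2] pq by simp
    qed
    have "(\<Sum>h\<in>{p..q}. e (F h)) - (\<Sum>k\<in>{- int K..int K}. ?I u v k) =
       ((\<Sum>h\<in>{p..q}. e (F h)) - (\<Sum>k\<in>{- int K..int K}. ?I p q k))
        - (\<Sum>k\<in>{- int K..int K}. ?I u p k) - (\<Sum>k\<in>{- int K..int K}. ?I q v k)"
      unfolding comb by (simp add: sum.distrib)
    also have "norm \<dots> \<le> 3 + (2 + 4 * (L + 1) * harm (2 * K + 1)) + (2 + 4 * (L + 1) * harm (2 * K + 1))"
      by (intro order_trans[OF norm_triangle_ineq4] add_mono P short) (use pq in auto)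
    finally show ?thesis unfolding p_def q_def by (simp add: algebra_simps)
  qed
qed

section \<open>The stationary frequencies\<close>

lemma harm_le_one_plus_ln:
  assumes "1 \<le> n"
  shows "harm n \<le> 1 + ln (real n)"
  using assms
proof (induction n rule: dec_induct)
  case base
  show ?case by (simp add: harm_def)
next
  case (step n)
  have "ln (real n / real (Suc n)) \<le> real n / real (Suc n) - 1"
    using step.hyps by (intro ln_le_minus_one) auto
  also have "\<dots> = - inverse (real (Suc n))" by (simp add: field_simps)
  finally have "inverse (real (Suc n)) \<le> ln (real (Suc n)) - ln (real n)"
    using step.hyps by (simp add: ln_div)
  then show ?case using step.IH by (simp add: harm_Suc)
qed

section \<open>Abel summation and the interchange of sum and integral\<close>

lemma finite_convex_nat_set:
  fixes S :: "nat set"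
  assumes "finite S" "\<And>x y z. x \<in> S \<Longrightarrow> z \<in> S \<Longrightarrow> x \<le> y \<Longrightarrow> y \<le> z \<Longrightarrow> y \<in> S"
  obtains p q where "S = {p..q}"
proof (cases "S = {}")
  case True
  then show ?thesis using that[of 1 0] by simp
next
  case False
  have "S = {Min S..Max S}"
  proof
    show "S \<subseteq> {Min S..Max S}" using assms(1) by auto
    show "{Min S..Max S} \<subseteq> S"
    proof
      fix y assume "y \<in> {Min S..Max S}"
      then show "y \<in> S"
        by (intro assms(2)[OF Min_in[OF assms(1) False] Max_in[OF assms(1) False]]) simp_all
    qed
  qed
  then show ?thesis by (rule that)
qed

text \<open>The difference to \<open>g q\<close> times the full sum is what an induction on
  \<open>q\<close> can carry: each step adds \<open>g m - g (Suc m)\<close> times the partial sum up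
  to \<open>m\<close>. The sign \<open>\<sigma>\<close> admits monotone weights of either
  direction.\<close>

lemma abel_summation_remainder:
  fixes a :: "nat \<Rightarrow> complex" and g :: "nat \<Rightarrow> real"
  assumes pq: "p \<le> q" and sg: "\<bar>\<sigma>\<bar> = (1::real)"
    and mono: "\<And>n. p \<le> n \<Longrightarrow> n < q \<Longrightarrow> 0 \<le> \<sigma> * (g n - g (Suc n))"
    and B: "\<And>r. p \<le> r \<Longrightarrow> r \<le> q \<Longrightarrow> norm (\<Sum>n\<in>{p..r}. a n) \<le> B"
  shows "norm ((\<Sum>n\<in>{p..q}. of_real (g n) * a n) - of_real (g q) * (\<Sum>n\<in>{p..q}. a n)) \<le> \<sigma> * (g p - g q) * B"
  using pq mono B
proof (induction q rule: dec_induct)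
  case (step m)
  let ?S = "\<lambda>r. \<Sum>n\<in>{p..r}. a n" and ?T = "\<lambda>r. \<Sum>n\<in>{p..r}. of_real (g n) * a n"
  have eq: "?T (Suc m) - of_real (g (Suc m)) * ?S (Suc m) =
      (?T m - of_real (g m) * ?S m) + of_real (g m - g (Suc m)) * ?S m"
    using step.hyps by (simp add: algebra_simps)
  have nn: "0 \<le> \<sigma> * (g m - g (Suc m))" using step.prems(1)[of m] step.hyps by simp
  have "\<bar>g m - g (Suc m)\<bar> = \<bar>\<sigma> * (g m - g (Suc m))\<bar>" using sg by (simp add: abs_mult)
  also have "\<dots> = \<sigma> * (g m - g (Suc m))" using nn by simp
  finally have "norm (of_real (g m - g (Suc m)) * ?S m) = \<sigma> * (g m - g (Suc m)) * norm (?S m)"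
    by (simp only: norm_mult norm_of_real)
  also have "\<dots> \<le> \<sigma> * (g m - g (Suc m)) * B"
    using step.prems(2)[of m] step.hyps nn by (intro mult_left_mono) auto
  finally have "norm (?T (Suc m) - of_real (g (Suc m)) * ?S (Suc m)) \<le>
      \<sigma> * (g p - g m) * B + \<sigma> * (g m - g (Suc m)) * B"
    unfolding eq using step by (intro order_trans[OF norm_triangle_ineq] add_mono) auto
  then show ?case by (simp add: algebra_simps)
qed simp

lemma abel_summation_antimono:
  fixes a :: "nat \<Rightarrow> complex" and g :: "nat \<Rightarrow> real"
  assumes "p \<le> q" and g: "\<And>n. p \<le> n \<Longrightarrow> n < q \<Longrightarrow> g (Suc n) \<le> g n" "0 \<le> g q"
    and B: "\<And>r. p \<le> r \<Longrightarrow> r \<le> q \<Longrightarrow> norm (\<Sum>n\<in>{p..r}. a n) \<le> B"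
  shows "norm (\<Sum>n\<in>{p..q}. of_real (g n) * a n) \<le> g p * B"
proof -
  let ?S = "\<Sum>n\<in>{p..q}. a n" and ?T = "\<Sum>n\<in>{p..q}. of_real (g n) * a n"
  have "norm (?T - of_real (g q) * ?S) \<le> 1 * (g p - g q) * B"
    by (rule abel_summation_remainder) (use assms in auto)
  moreover have "norm (of_real (g q) * ?S) \<le> g q * B"
    using B[of q] assms(1) g(2) by (simp add: norm_mult mult_left_mono)
  ultimately have "norm ((?T - of_real (g q) * ?S) + of_real (g q) * ?S) \<le> 1 * (g p - g q) * B + g q * B"
    by (intro order_trans[OF norm_triangle_ineq] add_mono)
  then show ?thesis by (simp add: algebra_simps)
qed

lemma abel_summation_mono:
  fixes a :: "nat \<Rightarrow> complex" and g :: "nat \<Rightarrow> real"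
  assumes "p \<le> q" and g: "\<And>n. p \<le> n \<Longrightarrow> n < q \<Longrightarrow> g n \<le> g (Suc n)" "0 \<le> g p" "0 \<le> g q"
    and B: "\<And>r. p \<le> r \<Longrightarrow> r \<le> q \<Longrightarrow> norm (\<Sum>n\<in>{p..r}. a n) \<le> B"
  shows "norm (\<Sum>n\<in>{p..q}. of_real (g n) * a n) \<le> 2 * g q * B"
proof -
  let ?S = "\<Sum>n\<in>{p..q}. a n" and ?T = "\<Sum>n\<in>{p..q}. of_real (g n) * a n"
  have B0: "0 \<le> B" using B[of p] assms(1) by (meson norm_ge_zero order_refl order_trans)
  have "norm (?T - of_real (g q) * ?S) \<le> (-1) * (g p - g q) * B"
    by (rule abel_summation_remainder) (use assms in auto)
  moreover have "norm (of_real (g q) * ?S) \<le> g q * B"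
    using B[of q] assms(1) g(3) by (simp add: norm_mult mult_left_mono)
  ultimately have "norm ((?T - of_real (g q) * ?S) + of_real (g q) * ?S) \<le> (-1) * (g p - g q) * B + g q * B"
    by (intro order_trans[OF norm_triangle_ineq] add_mono)
  moreover have "0 \<le> g p * B" using g B0 by simp
  ultimately show ?thesis by (simp add: algebra_simps)
qed

text \<open>Each integrand is extended by zero to the common interval, after which the finite sum
  can be moved inside. At a given \<open>w\<close> there remains the sum over those \<open>n\<close>
  whose interval contains \<open>w\<close>, so cancellation in \<open>n\<close> becomes available
  under the integral.\<close>

lemma norm_sum_integrals_le:
  fixes \<phi> :: "'i \<Rightarrow> real \<Rightarrow> complex"
  assumes fin: "finite I" and lr: "l \<le> r"
    and c: "\<And>n. n \<in> I \<Longrightarrow> continuous_on {l..r} (\<phi> n)"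
    and sub: "\<And>n. n \<in> I \<Longrightarrow> {x n..y n} \<subseteq> {l..r}"
    and G: "(G has_integral B) {l..r}"
    and le: "\<And>w. w \<in> {l..r} \<Longrightarrow> norm (\<Sum>n\<in>{n\<in>I. w \<in> {x n..y n}}. \<phi> n w) \<le> G w"
  shows "norm (\<Sum>n\<in>I. integral {x n..y n} (\<phi> n)) \<le> B"
proof -
  let ?\<psi> = "\<lambda>n w. if w \<in> {x n..y n} then \<phi> n w else 0"
  have i: "(?\<psi> n has_integral integral {x n..y n} (\<phi> n)) {l..r}" if "n \<in> I" for n
    unfolding has_integral_restrict[OF sub[OF that]]
    by (intro integrable_integral integrable_continuous_interval continuous_on_subset[OF c sub] that)
  have "((\<lambda>w. \<Sum>n\<in>I. ?\<psi> n w) has_integral (\<Sum>n\<in>I. integral {x n..y n} (\<phi> n))) {l..r}"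
    by (rule has_integral_sum[OF fin i])
  moreover have "(\<Sum>n\<in>I. ?\<psi> n w) = (\<Sum>n\<in>{n\<in>I. w \<in> {x n..y n}}. \<phi> n w)" for w
    using sum.inter_filter[OF fin, of "\<lambda>n. \<phi> n w" "\<lambda>n. w \<in> {x n..y n}"] by simp
  ultimately have S: "((\<lambda>w. \<Sum>n\<in>{n\<in>I. w \<in> {x n..y n}}. \<phi> n w) has_integral (\<Sum>n\<in>I. integral {x n..y n} (\<phi> n))) {l..r}"
    by simp
  have "norm (integral {l..r} (\<lambda>w. \<Sum>n\<in>{n\<in>I. w \<in> {x n..y n}}. \<phi> n w)) \<le> integral {l..r} G"
    by (rule integral_norm_bound_integral[OF has_integral_integrable[OF S] has_integral_integrable[OF G] le])
  then show ?thesis unfolding integral_unique[OF S] integral_unique[OF G] .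
qed

text \<open>After the substitution \<open>t = h w\<close>, where \<open>h\<close> is the stationary point of \<open>Q t\<^sup>b - k t\<close>,
  that phase becomes \<open>k h\<close> times \<open>rho b w\<close>. The weight \<open>wt\<close> and the function \<open>tau\<close>, through which
  its complement is integrated by parts, are those of the second derivative test.\<close>

definition rho :: "real \<Rightarrow> real \<Rightarrow> real" where "rho b w = w powr b / b - w"
definition rho1 :: "real \<Rightarrow> real \<Rightarrow> real" where "rho1 b w = w powr (b - 1) - 1"
definition rho2 :: "real \<Rightarrow> real \<Rightarrow> real" where "rho2 b w = (b - 1) * w powr (b - 2)"
definition wt :: "real \<Rightarrow> real \<Rightarrow> real \<Rightarrow> real" where "wt b Z w = 1 / (1 + Z * (rho1 b w)\<^sup>2)"
definition tau :: "real \<Rightarrow> real \<Rightarrow> real \<Rightarrow> real" where "tau b Z w = rho1 b w / (1 + Z * (rho1 b w)\<^sup>2)"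
definition tau1 :: "real \<Rightarrow> real \<Rightarrow> real \<Rightarrow> real" where
  "tau1 b Z w = rho2 b w * (1 - Z * (rho1 b w)\<^sup>2) / (1 + Z * (rho1 b w)\<^sup>2)\<^sup>2"

section \<open>Calculus of the rescaled phase and its weights\<close>

lemma rho_has_real_derivative:
  assumes "b \<noteq> 0" "0 < w" shows "(rho b has_real_derivative rho1 b w) (at w within S)"
proof -
  have "((\<lambda>w. w powr b / b - w) has_real_derivative b * w powr (b - 1) / b - 1) (at w within S)"
    using DERIV_subset[OF has_real_derivative_powr[OF assms(2), of b]]
    by (intro DERIV_diff DERIV_cdivide DERIV_ident) auto
  then show ?thesis using assms by (simp add: rho_def[abs_def] rho1_def)
qed

lemma rho1_has_real_derivative:
  assumes "0 < w" shows "(rho1 b has_real_derivative rho2 b w) (at w within S)"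
proof -
  have "((\<lambda>w. w powr (b - 1) - 1) has_real_derivative (b - 1) * w powr (b - 1 - 1) - 0) (at w within S)"
    using DERIV_subset[OF has_real_derivative_powr[OF assms, of "b - 1"]]
    by (intro DERIV_diff DERIV_const) auto
  then show ?thesis by (simp add: rho1_def[abs_def] rho2_def)
qed

lemma wt_denominator_pos: "0 < Z \<Longrightarrow> 0 < 1 + Z * (rho1 b w)\<^sup>2"
  by (simp add: add_pos_nonneg)

lemma tau_has_real_derivative:
  assumes "0 < w" "0 < Z" shows "(tau b Z has_real_derivative tau1 b Z w) (at w within S)"
proof -
  have nz: "1 + Z * (rho1 b w)\<^sup>2 \<noteq> 0" using wt_denominator_pos[OF assms(2), of b w] by simp
  note d = rho1_has_real_derivative[OF assms(1), of b S]
  have "((\<lambda>w. 1 + Z * (rho1 b w)\<^sup>2) has_real_derivative Z * (2 * rho1 b w * rho2 b w)) (at w within S)"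
    by (auto intro!: derivative_eq_intros d)
  from DERIV_divide[OF d this nz] show ?thesis
    unfolding tau_def[abs_def] tau1_def by (simp add: power2_eq_square algebra_simps)
qed

lemma continuous_on_rho_family:
  assumes "0 \<notin> S" "0 < Z"
  shows "continuous_on S (rho b)" "continuous_on S (rho1 b)" "continuous_on S (rho2 b)"
    "continuous_on S (wt b Z)" "continuous_on S (tau1 b Z)"
proof -
  have nz: "\<forall>w\<in>S. 1 + Z * (rho1 b w)\<^sup>2 \<noteq> 0"
    using wt_denominator_pos[OF assms(2)] by (metis less_irrefl)
  show 1: "continuous_on S (rho b)"
    unfolding rho_def[abs_def] divide_inverse by (intro continuous_intros) (use assms in auto)
  show 2: "continuous_on S (rho1 b)"
    unfolding rho1_def[abs_def] by (intro continuous_intros) (use assms in auto)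
  show 3: "continuous_on S (rho2 b)"
    unfolding rho2_def[abs_def] by (intro continuous_intros) (use assms in auto)
  show "continuous_on S (wt b Z)"
    unfolding wt_def[abs_def] by (intro continuous_intros 2 nz)
  show "continuous_on S (tau1 b Z)"
    unfolding tau1_def[abs_def] by (intro continuous_intros 2 3) (use nz in auto)
qed

lemma abs_tau1_le: "0 < Z \<Longrightarrow> \<bar>tau1 b Z w\<bar> \<le> \<bar>rho2 b w\<bar> * wt b Z w"
proof -
  assume Z: "0 < Z"
  let ?y = "Z * (rho1 b w)\<^sup>2"
  have y: "0 \<le> ?y" using Z by simp
  have "\<bar>tau1 b Z w\<bar> = \<bar>rho2 b w\<bar> * \<bar>1 - ?y\<bar> / (1 + ?y)\<^sup>2"
    by (simp add: tau1_def abs_mult)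
  also have "\<dots> \<le> \<bar>rho2 b w\<bar> * (1 + ?y) / (1 + ?y)\<^sup>2"
    using y by (intro divide_right_mono mult_left_mono) auto
  also have "\<dots> = \<bar>rho2 b w\<bar> * wt b Z w"
    using wt_denominator_pos[OF Z, of b w] by (simp add: wt_def power2_eq_square)
  finally show ?thesis .
qed

text \<open>These are the two bounds that \<open>sum_reciprocal_distance_le\<close> asks for when
  the boundary values of \<open>tau\<close> are summed over \<open>k\<close>: there
  \<open>k * |rho1|\<close> is the distance from \<open>k\<close> to the derivative of the
  phase.\<close>

lemma abs_tau_le:
  assumes "0 < Z"
  shows "\<bar>tau b Z w\<bar> \<le> 1 / (2 * sqrt Z)" and "Z * (\<bar>rho1 b w\<bar> * \<bar>tau b Z w\<bar>) \<le> 1"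
proof -
  note pos = wt_denominator_pos[OF assms, of b w]
  have "0 \<le> (1 - sqrt Z * \<bar>rho1 b w\<bar>)\<^sup>2" by simp
  then have "2 * sqrt Z * \<bar>rho1 b w\<bar> \<le> 1 + Z * (rho1 b w)\<^sup>2"
    using assms by (simp add: power2_diff power_mult_distrib)
  then show "\<bar>tau b Z w\<bar> \<le> 1 / (2 * sqrt Z)"
    using assms pos by (simp add: tau_def field_simps)
  have "Z * (\<bar>rho1 b w\<bar> * \<bar>tau b Z w\<bar>) = Z * (rho1 b w)\<^sup>2 / (1 + Z * (rho1 b w)\<^sup>2)"
    using pos by (simp add: tau_def abs_divide power2_eq_square)
  also have "\<dots> \<le> 1" using pos by simp
  finally show "Z * (\<bar>rho1 b w\<bar> * \<bar>tau b Z w\<bar>) \<le> 1" .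
qed

text \<open>On the fixed interval \<open>rho2\<close> is negative and bounded away from 0, so the
  weight is dominated by a multiple of \<open>- rho2 * wt\<close>, which up to sign and scale is the
  derivative of an arctangent of \<open>sqrt Z * rho1\<close>.\<close>

lemma wt_integral_le:
  assumes b: "0 < b" "b < 1" and \<kappa>: "1 \<le> \<kappa>"
  shows "\<exists>C>0. \<forall>Z>0. integral {1 / \<kappa>..\<kappa>} (wt b Z) \<le> C / sqrt Z"
proof -
  \<comment> \<open>The minimum of \<open>- rho2 b w\<close> over the interval, attained at
    \<open>w = \<kappa>\<close> because \<open>b - 2 < 0\<close>.\<close>
  define d where "d = (1 - b) * \<kappa> powr (b - 2)"
  have d: "0 < d" using b \<kappa> by (simp add: d_def)
  have lk: "1 / \<kappa> \<le> \<kappa>" using \<kappa> by (simp add: field_simps mult_ge1_I)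
  show ?thesis
  proof (intro exI[of _ "pi / d"] conjI allI impI)
    show "0 < pi / d" using d by simp
    fix Z :: real assume Z: "0 < Z"
    define A where "A = (\<lambda>w. arctan (sqrt Z * rho1 b w) / sqrt Z)"
    have A: "(A has_real_derivative rho2 b w * wt b Z w) (at w within {1 / \<kappa>..\<kappa>})"
      if "w \<in> {1 / \<kappa>..\<kappa>}" for w
    proof -
      have w: "0 < w" using that \<kappa> by (auto intro: less_le_trans[of _ "1 / \<kappa>"])
      have "(A has_real_derivative (inverse (1 + (sqrt Z * rho1 b w)\<^sup>2) * (sqrt Z * rho2 b w)) / sqrt Z)
         (at w within {1 / \<kappa>..\<kappa>})"
        unfolding A_def
        by (intro DERIV_cdivide DERIV_chain2[OF DERIV_arctan] DERIV_cmult rho1_has_real_derivative[OF w])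
      moreover have "inverse x * (y * z) / y = z * (1 / x)" if "y \<noteq> 0" for x y z :: real
        using that by (simp add: divide_simps)
      moreover have "(sqrt Z * rho1 b w)\<^sup>2 = Z * (rho1 b w)\<^sup>2" using Z by (simp add: power_mult_distrib)
      ultimately show ?thesis using Z by (simp add: wt_def)
    qed
    have I: "((\<lambda>w. (- 1 / d) * (rho2 b w * wt b Z w)) has_integral (- 1 / d) * (A \<kappa> - A (1 / \<kappa>))) {1 / \<kappa>..\<kappa>}"
      by (intro has_integral_mult_right real_FTC[OF lk A])
    have "integral {1 / \<kappa>..\<kappa>} (wt b Z) \<le> integral {1 / \<kappa>..\<kappa>} (\<lambda>w. (- 1 / d) * (rho2 b w * wt b Z w))"
    proof (rule integral_le)
      have "0 \<notin> {1 / \<kappa>..\<kappa>}" using \<kappa> by auto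
      then show "wt b Z integrable_on {1 / \<kappa>..\<kappa>}"
        by (intro integrable_continuous_interval continuous_on_rho_family Z)
      show "(\<lambda>w. (- 1 / d) * (rho2 b w * wt b Z w)) integrable_on {1 / \<kappa>..\<kappa>}"
        using I by blast
      fix w assume w: "w \<in> {1 / \<kappa>..\<kappa>}"
      then have w0: "0 < w" using \<kappa> by (auto intro: less_le_trans[of _ "1 / \<kappa>"])
      have "\<kappa> powr (b - 2) \<le> w powr (b - 2)" using w w0 b by (intro powr_mono2') auto
      then have "d \<le> (1 - b) * w powr (b - 2)" using b unfolding d_def by (intro mult_left_mono) auto
      then have "d \<le> - rho2 b w" by (simp add: rho2_def algebra_simps)
      then have "1 \<le> (- 1 / d) * rho2 b w" using d by (simp add: field_simps)
      moreover have "0 \<le> wt b Z w" using wt_denominator_pos[OF Z, of b w] by (simp add: wt_def)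
      ultimately show "wt b Z w \<le> (- 1 / d) * (rho2 b w * wt b Z w)"
        using mult_right_mono[of 1 "(- 1 / d) * rho2 b w" "wt b Z w"] by simp
    qed
    also have "\<dots> = (A (1 / \<kappa>) - A \<kappa>) / d" using integral_unique[OF I] by (simp add: diff_divide_distrib)
    also have "\<dots> \<le> (pi / sqrt Z) / d"
    proof (rule divide_right_mono)
      have "arctan (sqrt Z * rho1 b (1 / \<kappa>)) - arctan (sqrt Z * rho1 b \<kappa>) \<le> pi"
        using arctan_bounded[of "sqrt Z * rho1 b (1 / \<kappa>)"] arctan_bounded[of "sqrt Z * rho1 b \<kappa>"] by linarith
      then show "A (1 / \<kappa>) - A \<kappa> \<le> pi / sqrt Z"
        using Z by (simp add: A_def divide_right_mono flip: diff_divide_distrib)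
    qed (use d in simp)
    finally show "integral {1 / \<kappa>..\<kappa>} (wt b Z) \<le> pi / d / sqrt Z" by (simp add: mult.commute)
  qed
qed

text \<open>From \<open>1 = wt + Z * rho1 * tau\<close>; the second part contains the derivative
  \<open>l * rho1\<close> of the phase and is integrated by parts. The weight depends on
  \<open>Z\<close> and not on \<open>l\<close>: later \<open>l\<close> varies with \<open>n\<close>
  while \<open>Z\<close> belongs to the box, so for fixed \<open>w\<close> the weight factors out of
  the sum over \<open>n\<close>.\<close>

lemma stationary_integral_by_parts:
  assumes b: "b \<noteq> 0" and Z: "0 < Z" and w: "0 < x" "x \<le> y"
  shows "of_real l * integral {x..y} (\<lambda>w. e (l * rho b w)) =
     integral {x..y} (\<lambda>w. of_real (l * wt b Z w) * e (l * rho b w))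
     + of_real Z * ((of_real (tau b Z y) * e (l * rho b y) - of_real (tau b Z x) * e (l * rho b x)
        - integral {x..y} (\<lambda>w. of_real (tau1 b Z w) * e (l * rho b w))) / (2 * pi * \<i>))"
proof -
  have pos: "0 < w" if "w \<in> {x..y}" for w using that w by auto
  have n0: "0 \<notin> {x..y}" using w by auto
  note cont = continuous_on_rho_family[OF n0 Z, of b]
  have ct: "continuous_on {x..y} (tau b Z)"
    by (rule has_real_derivative_imp_continuous_on[OF tau_has_real_derivative[OF pos Z]])
  have P: "integral {x..y} (\<lambda>w. of_real (tau b Z w * (l * rho1 b w)) * e (l * rho b w)) =
     (of_real (tau b Z y) * e (l * rho b y) - of_real (tau b Z x) * e (l * rho b x)
        - integral {x..y} (\<lambda>w. of_real (tau1 b Z w) * e (l * rho b w))) / (2 * pi * \<i>)"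
  proof (rule integral_e_by_parts[OF w(2)])
    fix t assume t: "t \<in> {x..y}"
    show "((\<lambda>w. l * rho b w) has_real_derivative l * rho1 b t) (at t within {x..y})"
      by (intro DERIV_cmult rho_has_real_derivative b pos t)
    show "(tau b Z has_real_derivative tau1 b Z t) (at t within {x..y})"
      by (intro tau_has_real_derivative pos t Z)
  qed (intro continuous_intros cont)+
  have "of_real l * integral {x..y} (\<lambda>w. e (l * rho b w)) = integral {x..y} (\<lambda>w. of_real l * e (l * rho b w))"
    by simp
  also have "\<dots> = integral {x..y} (\<lambda>w. of_real (l * wt b Z w) * e (l * rho b w)
      + of_real Z * (of_real (tau b Z w * (l * rho1 b w)) * e (l * rho b w)))"
  proof (rule integral_cong)
    fix w
    have "l = l * ((1 + Z * (rho1 b w)\<^sup>2) / (1 + Z * (rho1 b w)\<^sup>2))"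
      using wt_denominator_pos[OF Z, of b w] by simp
    also have "\<dots> = l * wt b Z w + Z * (tau b Z w * (l * rho1 b w))"
      unfolding wt_def tau_def add_divide_distrib by (simp add: power2_eq_square algebra_simps)
    finally have "of_real l * e (l * rho b w) = of_real (l * wt b Z w + Z * (tau b Z w * (l * rho1 b w))) * e (l * rho b w)"
      by simp
    then show "of_real l * e (l * rho b w) = of_real (l * wt b Z w) * e (l * rho b w)
      + of_real Z * (of_real (tau b Z w * (l * rho1 b w)) * e (l * rho b w))"
      by (simp add: algebra_simps)
  qed
  also have "\<dots> = integral {x..y} (\<lambda>w. of_real (l * wt b Z w) * e (l * rho b w))
      + integral {x..y} (\<lambda>w. of_real Z * (of_real (tau b Z w * (l * rho1 b w)) * e (l * rho b w)))"
    by (intro integral_add integrable_continuous_interval continuous_intros cont ct)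
  also have "integral {x..y} (\<lambda>w. of_real Z * (of_real (tau b Z w * (l * rho1 b w)) * e (l * rho b w)))
      = of_real Z * integral {x..y} (\<lambda>w. of_real (tau b Z w * (l * rho1 b w)) * e (l * rho b w))"
    by simp
  finally show ?thesis unfolding P .
qed

text \<open>\<open>h\<close> is the zero of the derivative in \<open>t\<close>, that is
  \<open>k * h powr (1 - b) = b * Q\<close>; this eliminates \<open>Q\<close> in favour of
  \<open>k\<close> and \<open>h\<close>.\<close>

lemma power_phase_rescale:
  assumes b: "0 < b" "b < 1" and Q: "0 < Q" and k: "0 < k" and t: "0 < t"
    and h: "h = (b * Q / k) powr (1 / (1 - b))"
  shows "Q * t powr b - k * t = k * h * rho b (t / h)"
    and "k * rho1 b (t / h) = b * Q * t powr (b - 1) - k"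
proof -
  have h0: "0 < h" using b Q k by (simp add: h)
  have "h powr (1 - b) = b * Q / k" using b Q k by (simp add: h powr_powr)
  then have kb: "k * h powr (1 - b) = b * Q" using k by simp
  have "k * h * ((t / h) powr b / b) = k * (h / h powr b) * t powr b / b"
    using t h0 by (simp add: powr_divide)
  also have "h / h powr b = h powr (1 - b)" using h0 by (simp add: powr_diff)
  also have "k * h powr (1 - b) * t powr b / b = Q * t powr b" unfolding kb using b by simp
  finally show "Q * t powr b - k * t = k * h * rho b (t / h)"
    using h0 by (simp add: rho_def right_diff_distrib)
  have "k * (t / h) powr (b - 1) = k * (1 / h powr (b - 1)) * t powr (b - 1)"
    using t h0 by (simp add: powr_divide)
  also have "1 / h powr (b - 1) = h powr (1 - b)" using powr_minus_divide[of h "b - 1"] by simp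
  finally show "k * rho1 b (t / h) = b * Q * t powr (b - 1) - k"
    by (simp add: rho1_def right_diff_distrib kb)
qed

text \<open>Substitution \<open>t = h * w\<close> in \<open>stationary_integral_by_parts\<close>
  with \<open>l = k * h\<close>, divided by \<open>k\<close>. The endpoint terms are kept apart
  because they are later summed over \<open>k\<close> for fixed \<open>n\<close>, the integrals over
  \<open>n\<close> for fixed \<open>k\<close>.\<close>

lemma near_integral_by_parts:
  assumes b: "0 < b" "b < 1" and Q: "0 < Q" and k: "0 < k" and Z: "0 < Z" and uv: "0 < u" "u \<le> v"
    and h: "h = (b * Q / k) powr (1 / (1 - b))"
  shows "integral {u..v} (\<lambda>t. e (Q * t powr b - k * t)) =
     integral {u / h..v / h} (\<lambda>w. of_real (h * wt b Z w) * e (k * h * rho b w))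
     - of_real (Z / k) * integral {u / h..v / h} (\<lambda>w. of_real (tau1 b Z w) * e (k * h * rho b w)) / (2 * pi * \<i>)
     + of_real (Z / k) * (of_real (tau b Z (v / h)) * e (k * h * rho b (v / h))
        - of_real (tau b Z (u / h)) * e (k * h * rho b (u / h))) / (2 * pi * \<i>)"
proof -
  have h0: "0 < h" using b Q k by (simp add: h)
  have "integral {u / h..v / h} (\<lambda>w. e (Q * (h * w) powr b - k * (h * w))) =
      (1 / h) *\<^sub>R integral {u..v} (\<lambda>t. e (Q * t powr b - k * t))"
    using integral_stretch_real[of h u v "\<lambda>t. e (Q * t powr b - k * t)"] h0 uv
    by (simp add: image_divide_atLeastAtMost)
  moreover have "integral {u / h..v / h} (\<lambda>w. e (Q * (h * w) powr b - k * (h * w))) =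
      integral {u / h..v / h} (\<lambda>w. e (k * h * rho b w))"
  proof (rule integral_cong)
    fix w assume "w \<in> {u / h..v / h}"
    then have "0 < w" using uv h0 by (auto intro: less_le_trans[of _ "u / h"])
    then show "e (Q * (h * w) powr b - k * (h * w)) = e (k * h * rho b w)"
      using power_phase_rescale(1)[OF b Q k _ h, of "h * w"] h0 by simp
  qed
  ultimately have sub: "integral {u..v} (\<lambda>t. e (Q * t powr b - k * t)) =
      of_real h * integral {u / h..v / h} (\<lambda>w. e (k * h * rho b w))"
    using h0 by (simp add: scaleR_conv_of_real)
  have wt: "integral {u / h..v / h} (\<lambda>w. of_real (k * h * wt b Z w) * e (k * h * rho b w)) =
     of_real k * integral {u / h..v / h} (\<lambda>w. of_real (h * wt b Z w) * e (k * h * rho b w))"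
    by (simp add: mult.assoc flip: integral_mult_right)
  have "of_real (k * h) * integral {u / h..v / h} (\<lambda>w. e (k * h * rho b w)) =
     of_real k * integral {u / h..v / h} (\<lambda>w. of_real (h * wt b Z w) * e (k * h * rho b w))
     + of_real Z * ((of_real (tau b Z (v / h)) * e (k * h * rho b (v / h)) - of_real (tau b Z (u / h)) * e (k * h * rho b (u / h))
        - integral {u / h..v / h} (\<lambda>w. of_real (tau1 b Z w) * e (k * h * rho b w))) / (2 * pi * \<i>))"
    using stationary_integral_by_parts[of b Z "u / h" "v / h" "k * h"] b Z uv h0
    by (simp only: wt) (simp add: divide_right_mono)
  then have eq: "of_real k * integral {u..v} (\<lambda>t. e (Q * t powr b - k * t)) = \<dots>"
    unfolding sub by (simp add: mult.assoc)
  have solve: "I = W - Z' / k' * T / c + Z' / k' * (x - y) / c"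
    if "k' * I = k' * W + Z' * ((x - y - T) / c)" "k' \<noteq> 0" for I W Z' k' T c x y :: complex
  proof -
    have "I = (k' * W + Z' * ((x - y - T) / c)) / k'" using that by (simp add: eq_divide_eq mult.commute)
    also have "\<dots> = W - Z' / k' * T / c + Z' / k' * (x - y) / c"
      using that(2) by (simp add: add_divide_distrib diff_divide_distrib right_diff_distrib mult.commute)
    finally show ?thesis .
  qed
  have "complex_of_real k \<noteq> 0" using k by simp
  from solve[OF eq this] show ?thesis by simp
qed

text \<open>\<open>stat b c Q k x\<close> is the stationary point in \<open>t\<close> of \<open>Q x\<^sup>c t\<^sup>b - k t\<close>. When \<open>k\<close> is comparable with
  the derivatives of \<open>Q x\<^sup>c t\<^sup>b\<close> on the box (\<open>near_freq\<close>), it lies within a factor \<open>kap b c\<close> of the box.\<close>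

definition kap :: "real \<Rightarrow> real \<Rightarrow> real" where
  "kap b c = (2 powr (c + 2) / b) powr (1 / (1 - b))"

definition stat :: "real \<Rightarrow> real \<Rightarrow> real \<Rightarrow> real \<Rightarrow> real \<Rightarrow> real" where
  "stat b c Q k x = (b * (Q * x powr c) / k) powr (1 / (1 - b))"

definition near_freq :: "real \<Rightarrow> real \<Rightarrow> real \<Rightarrow> real \<Rightarrow> real \<Rightarrow> bool" where
  "near_freq b c Z H k \<longleftrightarrow> b / 4 * (Z / H) \<le> k \<and> k \<le> 2 powr (c + 1) * (Z / H)"

section \<open>Location of the stationary points\<close>

lemma near_freq_pos: "near_freq b c Z H k \<Longrightarrow> 0 < b \<Longrightarrow> 0 < Z \<Longrightarrow> 0 < H \<Longrightarrow> 0 < k"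
proof -
  assume "near_freq b c Z H k" "0 < b" "0 < Z" "0 < H"
  moreover from this have "0 < b / 4 * (Z / H)" by simp
  ultimately show "0 < k" unfolding near_freq_def by linarith
qed

lemma kap_ge_1:
  assumes "0 < b" "b < 1" "0 < c"
  shows "1 \<le> kap b c"
proof -
  have "1 \<le> 2 powr (c + 2)" using assms by (intro ge_one_powr_ge_zero) auto
  then have "1 \<le> 2 powr (c + 2) / b" using assms by (simp add: field_simps)
  then show ?thesis unfolding kap_def using assms by (intro ge_one_powr_ge_zero) auto
qed

lemma stat_pos: "0 < b \<Longrightarrow> 0 < Q \<Longrightarrow> 0 < k \<Longrightarrow> 0 < x \<Longrightarrow> 0 < stat b c Q k x"
  by (simp add: stat_def)

lemma stat_eq:
  assumes "0 < b" "b < 1" "0 < Q" "0 < k" "0 < x"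
  shows "stat b c Q k x = (b * Q / k) powr (1 / (1 - b)) * x powr (c / (1 - b))"
proof -
  have "stat b c Q k x = ((b * Q / k) * x powr c) powr (1 / (1 - b))" by (simp add: stat_def mult.assoc)
  also have "\<dots> = (b * Q / k) powr (1 / (1 - b)) * (x powr c) powr (1 / (1 - b))"
    using assms by (intro powr_mult)
  finally show ?thesis by (simp add: powr_powr)
qed

text \<open>Because \<open>0 < b < 1\<close>, the power \<open>t powr (b - 1)\<close> loses at most
  a factor 2 on a dyadic range. The thresholds of \<open>near_freq\<close> are half the lower and
  twice the upper bound obtained here.\<close>

lemma frequency_bounds:
  fixes b c Q H N Z x t :: real
  assumes b: "0 < b" "b < 1" and c: "0 < c" and Q: "0 < Q" and H: "0 < H" and N: "0 < N"
    and Z: "Z = Q * N powr c * H powr b" and x: "N \<le> x" "x \<le> 2 * N" and t: "H \<le> t" "t \<le> 2 * H"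
  shows "b / 2 * (Z / H) \<le> b * (Q * x powr c) * t powr (b - 1)"
    and "b * (Q * x powr c) * t powr (b - 1) \<le> 2 powr c * (Z / H)"
proof -
  have ZH: "Z / H = Q * N powr c * H powr (b - 1)" using powr_diff[of H b 1] H by (simp add: Z)
  have x1: "N powr c \<le> x powr c" using x N c by (intro powr_mono2) auto
  have x2: "x powr c \<le> 2 powr c * N powr c"
    using x N c powr_mono2[of c x "2 * N"] by (simp add: powr_mult)
  have t1: "t powr (b - 1) \<le> H powr (b - 1)" using t H b by (intro powr_mono2') auto
  have "H powr (b - 1) / 2 \<le> 2 powr (b - 1) * H powr (b - 1)"
  proof -
    have "(2::real) powr (-1) \<le> 2 powr (b - 1)" using b by (intro powr_mono) auto
    then have "1 / 2 \<le> (2::real) powr (b - 1)" by (simp add: powr_minus_divide)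
    then show ?thesis using mult_right_mono[of "1/2" "2 powr (b - 1)" "H powr (b - 1)"] by simp
  qed
  also have "\<dots> = (2 * H) powr (b - 1)" using H by (simp add: powr_mult)
  also have "\<dots> \<le> t powr (b - 1)" using t H b by (intro powr_mono2') auto
  finally have t2: "H powr (b - 1) / 2 \<le> t powr (b - 1)" .
  have "b / 2 * (Z / H) = b * (Q * N powr c) * (H powr (b - 1) / 2)" by (simp add: ZH)
  also have "\<dots> \<le> b * (Q * x powr c) * t powr (b - 1)"
    using b Q x1 t2 by (intro mult_mono) auto
  finally show "b / 2 * (Z / H) \<le> b * (Q * x powr c) * t powr (b - 1)" .
  have "b * (Q * x powr c) * t powr (b - 1) \<le> 1 * (Q * (2 powr c * N powr c)) * H powr (b - 1)"
    using b Q x2 t1 by (intro mult_mono) auto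
  then show "b * (Q * x powr c) * t powr (b - 1) \<le> 2 powr c * (Z / H)" by (simp add: ZH mult_ac)
qed

text \<open>For \<open>w = t / stat b c Q k x\<close> the power \<open>w powr (b - 1)\<close> is the
  ratio of the derivative at \<open>t\<close> to \<open>k\<close>, which
  \<open>frequency_bounds\<close> and \<open>near_freq\<close> confine to the range from
  \<open>1 / K0\<close> to \<open>K0\<close> with \<open>K0 = 2 powr (c + 2) / b\<close>. Raising to
  the power \<open>- 1 / (1 - b)\<close> produces \<open>kap b c\<close>.\<close>

lemma stationary_scale:
  assumes b: "0 < b" "b < 1" and c: "0 < c" and Q: "0 < Q" and H: "0 < H" and N: "0 < N"
    and Z: "Z = Q * N powr c * H powr b" and x: "N \<le> x" "x \<le> 2 * N" and t: "H \<le> t" "t \<le> 2 * H"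
    and k: "near_freq b c Z H k"
  shows "1 / kap b c \<le> t / stat b c Q k x" and "t / stat b c Q k x \<le> kap b c"
proof -
  have Z0: "0 < Z" using Q N H by (simp add: Z)
  have k0: "0 < k" by (rule near_freq_pos[OF k b(1) Z0 H])
  define K0 where "K0 = 2 powr (c + 2) / b"
  have K0: "1 \<le> K0"
  proof -
    have "1 \<le> 2 powr (c + 2)" using c by (intro ge_one_powr_ge_zero) auto
    then show ?thesis using b by (simp add: K0_def field_simps)
  qed
  define y where "y = b * (Q * x powr c) * t powr (b - 1) / k"
  have x0: "0 < x" and t0: "0 < t" using x t N H by auto
  have h0: "0 < stat b c Q k x" by (rule stat_pos[OF b(1) Q k0 x0])
  have "k * rho1 b (t / stat b c Q k x) = b * (Q * x powr c) * t powr (b - 1) - k"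
    by (rule power_phase_rescale(2)) (use b Q k0 x0 t0 in \<open>auto simp: stat_def\<close>)
  then have y: "(t / stat b c Q k x) powr (b - 1) = y"
    using k0 by (simp add: rho1_def y_def field_simps)
  have ZH: "0 < Z / H" using Z0 H by simp
  have f0: "0 \<le> b * (Q * x powr c) * t powr (b - 1)" using b Q by simp
  have "1 / K0 = (b / 2 * (Z / H)) / (2 powr (c + 1) * (Z / H))"
    using Z0 H b by (simp add: K0_def powr_add)
  also have "\<dots> \<le> y"
    unfolding y_def using frequency_bounds(1)[OF b c Q H N Z x t] k k0 b ZH f0 Z0 H
    by (intro frac_le) (auto simp: near_freq_def)
  finally have y1: "1 / K0 \<le> y" .
  have "y \<le> (2 powr c * (Z / H)) / (b / 4 * (Z / H))"
    unfolding y_def using frequency_bounds(2)[OF b c Q H N Z x t] k k0 b ZH f0 Z0 H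
    by (intro frac_le) (auto simp: near_freq_def)
  also have "\<dots> = K0" using Z0 H b by (simp add: K0_def powr_add)
  finally have y2: "y \<le> K0 * 1" by simp
  have y0: "0 < y" using y1 K0 by (meson divide_pos_pos less_le_trans zero_less_one)
  have w: "t / stat b c Q k x = y powr (- (1 / (1 - b)))"
  proof -
    have "((t / stat b c Q k x) powr (b - 1)) powr (- (1 / (1 - b))) = (t / stat b c Q k x) powr ((b - 1) * (- (1 / (1 - b))))"
      by (simp add: powr_powr)
    also have "(b - 1) * (- (1 / (1 - b))) = 1" using b by (simp add: field_simps)
    finally show ?thesis using t0 h0 by (simp add: y)
  qed
  have ab: "\<bar>- (1 / (1 - b))\<bar> = 1 / (1 - b)" using b by simp
  have kap: "kap b c = K0 powr (1 / (1 - b))" by (simp add: kap_def K0_def)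
  show "t / stat b c Q k x \<le> kap b c"
    using powr_comparable[of 1 K0 y "- (1 / (1 - b))"] y1 y2 K0 unfolding w ab kap by simp
  have "1 \<le> kap b c * y powr (- (1 / (1 - b)))"
    using powr_comparable[of y K0 1 "- (1 / (1 - b))"] y1 y2 y0 K0 unfolding ab kap by (simp add: field_simps)
  then show "1 / kap b c \<le> t / stat b c Q k x"
    using kap_ge_1[OF b c] unfolding w by (simp add: field_simps)
qed

text \<open>\<open>rho b\<close> vanishes where \<open>w powr (b - 1) = b\<close>, that is where
  \<open>rho1 b w = - (1 - b)\<close>; there the rescaled phase loses its dependence on
  \<open>n\<close>. The condition on \<open>rho1\<close> excludes that point by half the
  distance.\<close>

lemma rho_lower:
  assumes b: "0 < b" "b < 1" and w: "0 < \<kappa>" "1 / \<kappa> \<le> w" and s: "\<bar>rho1 b w\<bar> \<le> (1 - b) / 2"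
  shows "(1 - b) / (2 * b * \<kappa>) \<le> rho b w"
proof -
  have w0: "0 < w" using w by (meson divide_pos_pos less_le_trans zero_less_one)
  have "rho b w = w * (w powr (b - 1) / b - 1)"
    using w0 by (simp add: rho_def powr_diff right_diff_distrib)
  moreover have "(1 - b) / (2 * b) \<le> w powr (b - 1) / b - 1"
  proof -
    have "(1 + b) / 2 \<le> w powr (b - 1)" 
    proof -
      have "- ((1 - b) / 2) \<le> rho1 b w" using s by linarith
      then show ?thesis by (simp add: rho1_def field_simps)
    qed
    then have "((1 + b) / 2) / b \<le> w powr (b - 1) / b" using b by (intro divide_right_mono) auto
    then have "((1 + b) / 2) / b - 1 \<le> w powr (b - 1) / b - 1" by linarith
    moreover have "((1 + b) / 2) / b - 1 = (1 - b) / (2 * b)" using b by (simp add: field_simps)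
    ultimately show ?thesis by simp
  qed
  moreover have "(1 - b) / (2 * b * \<kappa>) = (1 / \<kappa>) * ((1 - b) / (2 * b))" by simp
  ultimately show ?thesis using w0 w b by (simp only:) (intro mult_mono, auto)
qed

lemma abs_rho_le:
  assumes b: "0 < b" "b < 1" and w: "1 \<le> \<kappa>" "0 < w" "w \<le> \<kappa>"
  shows "\<bar>rho b w\<bar> \<le> 2 * \<kappa> / b"
proof -
  have "w powr b \<le> \<kappa> powr b" using w b by (intro powr_mono2) auto
  also have "\<dots> \<le> \<kappa> powr 1" using w b by (intro powr_mono) auto
  finally have "w powr b \<le> \<kappa>" using w by simp
  then have "w powr b / b \<le> \<kappa> / b" using b by (simp add: divide_right_mono)
  moreover have "w \<le> \<kappa> / b" 
  proof -
    have "w * b \<le> \<kappa> * 1" using w b by (intro mult_mono) auto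
    then show ?thesis using b by (simp add: field_simps)
  qed
  moreover have "\<bar>rho b w\<bar> \<le> w powr b / b + w" unfolding rho_def using w b by (simp add: abs_le_iff)
  ultimately show ?thesis by simp
qed

text \<open>For fixed \<open>w\<close> the phase is \<open>A * real n powr \<gamma>\<close> with
  \<open>\<gamma> = c / (1 - b)\<close>, and \<open>b + c > 1\<close> excludes
  \<open>\<gamma> = 1\<close>. Its size is that of \<open>Z\<close>, since \<open>k\<close> is
  comparable with \<open>Z / H\<close>, the stationary point with \<open>H\<close>, and
  \<open>rho b w\<close> with 1.\<close>

lemma rescaled_sum_bound:
  assumes b: "0 < b" "b < 1" and c: "0 < c" "1 < b + c"
  shows "\<exists>C>0. \<forall>Q H N k w p q. 0 < Q \<longrightarrow> 0 < H \<longrightarrow> 0 < N \<longrightarrow> near_freq b c (Q * N powr c * H powr b) H k \<longrightarrow>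
     1 / kap b c \<le> w \<longrightarrow> w \<le> kap b c \<longrightarrow> \<bar>rho1 b w\<bar> \<le> (1 - b) / 2 \<longrightarrow> N \<le> real p \<longrightarrow> real q \<le> 2 * N \<longrightarrow>
     norm (\<Sum>n\<in>{p..q}. e (k * stat b c Q k (real n) * rho b w))
       \<le> C * (1 + sqrt (Q * N powr c * H powr b) + N / sqrt (Q * N powr c * H powr b))"
proof -
  define \<gamma> where "\<gamma> = c / (1 - b)"
  have g: "\<gamma> \<noteq> 0" "\<gamma> \<noteq> 1" using b c by (auto simp: \<gamma>_def)
  obtain C0 where C0: "C0 > 0" "\<And>A N p q. A \<noteq> 0 \<Longrightarrow> 0 < N \<Longrightarrow> N \<le> real p \<Longrightarrow> real q \<le> 2 * N \<Longrightarrow>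
    norm (\<Sum>n\<in>{p..q}. e (A * real n powr \<gamma>)) \<le> C0 * (1 + sqrt (\<bar>A\<bar> * N powr \<gamma>) + N / sqrt (\<bar>A\<bar> * N powr \<gamma>))"
    using monomial_sum_bound[OF g] by metis
  define \<kappa> where "\<kappa> = kap b c"
  have \<kappa>: "1 \<le> \<kappa>" unfolding \<kappa>_def by (rule kap_ge_1[OF b c(1)])
  define c1 where "c1 = b / 4 * (1 / \<kappa>) * ((1 - b) / (2 * b * \<kappa>))"
  define c2 where "c2 = 2 powr (c + 1) * \<kappa> * (2 * \<kappa> / b)"
  have c12: "0 < c1" "0 < c2" using b \<kappa> by (auto simp: c1_def c2_def)
  define C where "C = C0 * (1 + sqrt c2 + 1 / sqrt c1)"
  show ?thesis
  proof (intro exI[of _ C] conjI allI impI)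
    show "0 < C" using C0 c12 by (simp add: C_def add_pos_pos)
    fix Q H N k w :: real and p q :: nat
    assume Q: "0 < Q" and H: "0 < H" and N: "0 < N" and k: "near_freq b c (Q * N powr c * H powr b) H k"
      and w: "1 / kap b c \<le> w" "w \<le> kap b c" and s: "\<bar>rho1 b w\<bar> \<le> (1 - b) / 2"
      and p: "N \<le> real p" and q: "real q \<le> 2 * N"
    define Z where "Z = Q * N powr c * H powr b"
    have Z: "0 < Z" using Q N H by (simp add: Z_def)
    have kn: "near_freq b c Z H k" using k by (simp add: Z_def)
    have k0: "0 < k" by (rule near_freq_pos[OF kn b(1) Z H])
    have w0: "0 < w" using w \<kappa> by (metis \<kappa>_def divide_pos_pos less_le_trans zero_less_one)
    define A where "A = k * (b * Q / k) powr (1 / (1 - b)) * rho b w"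
    have r1: "(1 - b) / (2 * b * \<kappa>) \<le> rho b w" by (rule rho_lower) (use b w s \<kappa> in \<open>auto simp: \<kappa>_def\<close>)
    have r0: "0 < (1 - b) / (2 * b * \<kappa>)" using b \<kappa> by simp
    have r2: "rho b w \<le> 2 * \<kappa> / b" using abs_rho_le[OF b \<kappa> w0] w(2) by (simp add: \<kappa>_def)
    have r3: "0 \<le> rho b w" using r0 r1 by linarith
    have A0: "0 < A" using b Q k0 r1 r0 by (simp add: A_def)
    have hN: "A * N powr \<gamma> = k * stat b c Q k N * rho b w"
      using stat_eq[OF b Q k0 N, of c] by (simp add: A_def \<gamma>_def)
    have sc: "1 / \<kappa> \<le> H / stat b c Q k N" "H / stat b c Q k N \<le> \<kappa>"
      unfolding \<kappa>_def using stationary_scale[OF b c(1) Q H N Z_def _ _ _ _ kn, of N H] N H by auto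
    have st0: "0 < stat b c Q k N" by (rule stat_pos[OF b(1) Q k0 N])
    have st: "H / \<kappa> \<le> stat b c Q k N" "stat b c Q k N \<le> \<kappa> * H"
      using sc st0 \<kappa> by (auto simp: field_simps)
    have "c1 * Z = (b / 4 * (Z / H)) * (H / \<kappa>) * ((1 - b) / (2 * b * \<kappa>))"
      using H by (simp add: c1_def)
    also have "\<dots> \<le> k * stat b c Q k N * rho b w"
      using kn st r1 r0 r3 b Z H \<kappa> st0 k0 by (intro mult_mono) (auto simp: near_freq_def)
    finally have l: "c1 * Z \<le> A * N powr \<gamma>" by (simp add: hN)
    have "k * stat b c Q k N * rho b w \<le> (2 powr (c + 1) * (Z / H)) * (\<kappa> * H) * (2 * \<kappa> / b)"
      using kn st r2 r1 r0 r3 b Z H \<kappa> st0 k0 by (intro mult_mono) (auto simp: near_freq_def)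
    also have "\<dots> = c2 * Z" using H by (simp add: c2_def)
    finally have u: "A * N powr \<gamma> \<le> c2 * Z" by (simp add: hN)
    have An: "0 < A * N powr \<gamma>" using A0 N by simp
    have "norm (\<Sum>n\<in>{p..q}. e (A * real n powr \<gamma>)) \<le> C0 * (1 + sqrt (A * N powr \<gamma>) + N / sqrt (A * N powr \<gamma>))"
      using C0(2)[of A N p q] A0 N p q by simp
    also have "\<dots> \<le> C0 * (1 + sqrt (c2 * Z) + N / sqrt (c1 * Z))"
      using C0(1) l u N Z c12 An by (intro mult_left_mono add_mono divide_left_mono) auto
    also have "\<dots> = C0 * (1 + sqrt c2 * sqrt Z + (1 / sqrt c1) * (N / sqrt Z))"
      by (simp add: real_sqrt_mult)
    also have "\<dots> \<le> C0 * ((1 + sqrt c2 + 1 / sqrt c1) * (1 + sqrt Z + N / sqrt Z))"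
    proof (intro mult_left_mono)
      have "1 * 1 + sqrt c2 * sqrt Z + (1 / sqrt c1) * (N / sqrt Z) \<le>
          (1 + sqrt c2 + 1 / sqrt c1) * 1 + (1 + sqrt c2 + 1 / sqrt c1) * sqrt Z + (1 + sqrt c2 + 1 / sqrt c1) * (N / sqrt Z)"
        using c12 Z N by (intro add_mono mult_right_mono) auto
      then show "1 + sqrt c2 * sqrt Z + (1 / sqrt c1) * (N / sqrt Z) \<le> (1 + sqrt c2 + 1 / sqrt c1) * (1 + sqrt Z + N / sqrt Z)"
        by (simp only: distrib_left mult_1_left)
    qed (use C0 in auto)
    also have "(\<Sum>n\<in>{p..q}. e (A * real n powr \<gamma>)) = (\<Sum>n\<in>{p..q}. e (k * stat b c Q k (real n) * rho b w))"
    proof (rule sum.cong)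
      fix n assume "n \<in> {p..q}"
      then have "0 < real n" using p N by auto
      from stat_eq[OF b Q k0 this, of c]
      show "e (A * real n powr \<gamma>) = e (k * stat b c Q k (real n) * rho b w)" by (simp add: A_def \<gamma>_def mult_ac)
    qed simp
    finally show "norm (\<Sum>n\<in>{p..q}. e (k * stat b c Q k (real n) * rho b w))
       \<le> C * (1 + sqrt (Q * N powr c * H powr b) + N / sqrt (Q * N powr c * H powr b))"
      by (simp add: C_def Z_def mult.assoc)
  qed
qed

definition endpoint_term :: "real \<Rightarrow> real \<Rightarrow> real \<Rightarrow> real \<Rightarrow> real \<Rightarrow> real \<Rightarrow> real \<Rightarrow> complex" where
  "endpoint_term b Z k h l u v = of_real (Z / k) * (of_real (tau b Z (v / h)) * e (l * rho b (v / h))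
        - of_real (tau b Z (u / h)) * e (l * rho b (u / h))) / (2 * pi * \<i>)"

text \<open>Along each curve \<open>t = B x\<^bsup>c / (1 - b)\<^esup>\<close> the stationary point \<open>stat b c Q k x\<close> is a fixed
  multiple of \<open>t\<close>; a region is required to meet these curves in intervals.\<close>

definition dyadic_region :: "real \<Rightarrow> real \<Rightarrow> real \<Rightarrow> real \<Rightarrow> (real \<Rightarrow> real \<Rightarrow> bool) \<Rightarrow> bool" where
  "dyadic_region b c H N R \<longleftrightarrow>
     (\<forall>t x. R t x \<longrightarrow> H \<le> t \<and> t \<le> 2 * H \<and> N \<le> x \<and> x \<le> 2 * N) \<and>
     (\<forall>B>0. \<forall>x y z. x \<le> y \<longrightarrow> y \<le> z \<longrightarrow> R (B * x powr (c / (1 - b))) x \<longrightarrow> R (B * z powr (c / (1 - b))) z \<longrightarrow> R (B * y powr (c / (1 - b))) y)"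

text \<open>Sum over \<open>n\<close> and integral over \<open>w\<close> are interchanged. Where
  \<open>|rho1|\<close> is small, \<open>rescaled_sum_bound\<close> gives cancellation and the
  integral of \<open>wt\<close> a factor \<open>1 / sqrt Z\<close>; elsewhere \<open>wt\<close> is
  at most of order \<open>1 / Z\<close> and counting \<open>n\<close> suffices, which accounts for
  the last term \<open>N / Z\<close>. An empty section in \<open>t\<close> is encoded by
  \<open>U n > V n\<close>.\<close>

lemma near_frequency_sum:
  assumes b: "0 < b" "b < 1" and c: "0 < c" "1 < b + c"
  shows "\<exists>C>0. \<forall>Q H N k R U V. 0 < Q \<longrightarrow> 0 < H \<longrightarrow> 1 \<le> N \<longrightarrow> near_freq b c (Q * N powr c * H powr b) H k \<longrightarrow>
     dyadic_region b c H N R \<longrightarrow>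
     (\<forall>n::nat. {t. R t (real n)} = {U n..V n}) \<longrightarrow>
     norm (\<Sum>n\<in>{n. U n \<le> V n}. integral {U n..V n} (\<lambda>t. e (Q * real n powr c * t powr b - k * t))
        - endpoint_term b (Q * N powr c * H powr b) k (stat b c Q k (real n)) (k * stat b c Q k (real n)) (U n) (V n))
       \<le> C * H * ((1 + sqrt (Q * N powr c * H powr b) + N / sqrt (Q * N powr c * H powr b)) / sqrt (Q * N powr c * H powr b)
             + N / (Q * N powr c * H powr b))"
proof -
  define \<kappa> where "\<kappa> = kap b c"
  have \<kappa>: "1 \<le> \<kappa>" unfolding \<kappa>_def by (rule kap_ge_1[OF b c(1)])
  have \<kappa>l: "1 / \<kappa> \<le> \<kappa>" "0 < 1 / \<kappa>" using \<kappa> by (auto intro: order_trans[of _ 1])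
  obtain C0 where C0: "C0 > 0" "\<And>Q H N k w p q. 0 < Q \<Longrightarrow> 0 < H \<Longrightarrow> 0 < N \<Longrightarrow> near_freq b c (Q * N powr c * H powr b) H k \<Longrightarrow>
     1 / \<kappa> \<le> w \<Longrightarrow> w \<le> \<kappa> \<Longrightarrow> \<bar>rho1 b w\<bar> \<le> (1 - b) / 2 \<Longrightarrow> N \<le> real p \<Longrightarrow> real q \<le> 2 * N \<Longrightarrow>
     norm (\<Sum>n\<in>{p..q}. e (k * stat b c Q k (real n) * rho b w))
       \<le> C0 * (1 + sqrt (Q * N powr c * H powr b) + N / sqrt (Q * N powr c * H powr b))"
    using rescaled_sum_bound[OF b c] unfolding \<kappa>_def by metis
  obtain C1 where C1: "C1 > 0" "\<And>Z. 0 < Z \<Longrightarrow> integral {1 / \<kappa>..\<kappa>} (wt b Z) \<le> C1 / sqrt Z"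
    using wt_integral_le[OF b \<kappa>] by metis
  define s0 where "s0 = (1 - b) / 2"
  have s0: "0 < s0" using b by (simp add: s0_def)
  \<comment> \<open>Bounds \<open>|rho2 b w|\<close> on the interval; the exponent 2 is chosen
    because \<open>|b - 2| \<le> 2\<close>.\<close>
  define s1 where "s1 = \<kappa> powr 2"
  have s1: "0 < s1" using \<kappa> by (simp add: s1_def)
  \<comment> \<open>The two parts of \<open>D1\<close> and of \<open>D2\<close> stem from the
    amplitudes \<open>h n * wt\<close> and \<open>tau1\<close>; the latter comes with the factor
    \<open>Z / k \<le> 4 / b * H\<close>.\<close>
  define D1 where "D1 = 2 * \<kappa> + 4 / b * s1"
  define D2 where "D2 = 2 * \<kappa> + 8 / b * s1"
  have D: "0 < D1" "0 < D2" using \<kappa> b s1 by (auto simp: D1_def D2_def intro!: add_pos_pos)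
  define C where "C = D1 * C0 * C1 + D2 * \<kappa> / s0\<^sup>2"
  show ?thesis
  proof (intro exI[of _ C] conjI allI impI)
    show "0 < C" using C0 C1 D \<kappa> s0 by (simp add: C_def add_pos_pos)
    fix Q H N k :: real and R :: "real \<Rightarrow> real \<Rightarrow> bool" and U V :: "nat \<Rightarrow> real"
    assume Q: "0 < Q" and H: "0 < H" and N1: "1 \<le> N" and k: "near_freq b c (Q * N powr c * H powr b) H k"
      and reg: "dyadic_region b c H N R"
      and UV: "\<forall>n::nat. {t. R t (real n)} = {U n..V n}"
    have R: "(\<forall>t x. R t x \<longrightarrow> H \<le> t \<and> t \<le> 2 * H \<and> N \<le> x \<and> x \<le> 2 * N)"
      and conv: "(\<forall>B>0. \<forall>x y z. x \<le> y \<longrightarrow> y \<le> z \<longrightarrow> R (B * x powr (c / (1 - b))) x \<longrightarrow> R (B * z powr (c / (1 - b))) z \<longrightarrow> R (B * y powr (c / (1 - b))) y)"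
      using reg unfolding dyadic_region_def by blast+
    define Z where "Z = Q * N powr c * H powr b"
    have N: "0 < N" using N1 by simp
    have Z: "0 < Z" using Q N H by (simp add: Z_def)
    have kn: "near_freq b c Z H k" using k by (simp add: Z_def)
    have k0: "0 < k" by (rule near_freq_pos[OF kn b(1) Z H])
    define S where "S = 1 + sqrt Z + N / sqrt Z"
    have S: "0 < S" using Z N by (simp add: S_def add_pos_pos)
    define I where "I = {n. U n \<le> V n}"
    have RUV: "R t (real n) \<longleftrightarrow> U n \<le> t \<and> t \<le> V n" for t n
      using UV by (auto simp: set_eq_iff)
    have I: "N \<le> real n" "real n \<le> 2 * N" "H \<le> U n" "V n \<le> 2 * H" "U n \<le> V n" if "n \<in> I" for n
      using that R RUV[of "U n" n] RUV[of "V n" n] by (auto simp: I_def)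
    have finI: "finite I"
    proof (rule finite_subset)
      show "I \<subseteq> {..nat \<lceil>2 * N\<rceil>}" using I(2) by (force simp: le_nat_iff intro: le_ceiling_iff[THEN iffD2])
    qed simp
    have cardI: "real (card I) \<le> 2 * N"
    proof -
      have "I \<subseteq> {nat \<lceil>N\<rceil>..nat \<lfloor>2 * N\<rfloor>}" using I(1,2) by (force simp: nat_le_iff le_nat_iff ceiling_le_iff le_floor_iff)
      then have "card I \<le> card {nat \<lceil>N\<rceil>..nat \<lfloor>2 * N\<rfloor>}" by (intro card_mono) auto
      also have "real \<dots> \<le> 2 * N" using N1 by (simp, linarith)
      finally show ?thesis by simp
    qed
    define h where "h = (\<lambda>n. stat b c Q k (real n))"
    have h0: "0 < h n" if "n \<in> I" for n
      unfolding h_def by (rule stat_pos[OF b(1) Q k0]) (use I(1)[OF that] N in auto)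
    have sub: "{U n / h n..V n / h n} \<subseteq> {1 / \<kappa>..\<kappa>}" if n: "n \<in> I" for n
    proof -
      have "1 / \<kappa> \<le> U n / h n" unfolding \<kappa>_def h_def
        by (rule stationary_scale(1)[OF b c(1) Q H N Z_def I(1,2)[OF n] _ _ kn]) (use I[OF n] in auto)
      moreover have "V n / h n \<le> \<kappa>" unfolding \<kappa>_def h_def
        by (rule stationary_scale(2)[OF b c(1) Q H N Z_def I(1,2)[OF n] _ _ kn]) (use I[OF n] in auto)
      ultimately show ?thesis by auto
    qed
    have hb: "h n \<le> \<kappa> * H" if n: "n \<in> I" for n
    proof -
      have "1 / \<kappa> \<le> H / h n" unfolding \<kappa>_def h_def
        by (rule stationary_scale(1)[OF b c(1) Q H N Z_def I(1,2)[OF n] _ _ kn]) (use H in auto)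
      then show ?thesis using h0[OF n] \<kappa> by (simp add: field_simps)
    qed
    define J where "J = (\<lambda>w. {n\<in>I. w \<in> {U n / h n..V n / h n}})"
    \<comment> \<open>For fixed \<open>w\<close> the point \<open>h n * w\<close> runs along a curve
      \<open>t = B * x powr (c / (1 - b))\<close>, so the second clause of
      \<open>dyadic_region\<close> makes the admissible \<open>n\<close> consecutive.\<close>
    have J_interval: "\<exists>p q. J w = {p..q}" if w: "w \<in> {1 / \<kappa>..\<kappa>}" for w
    proof -
      define B where "B = (b * Q / k) powr (1 / (1 - b)) * w"
      have w0: "0 < w" using w \<kappa>l(2) by (simp only: atLeastAtMost_iff) linarith
      have B: "0 < B" using b Q k0 w0 by (simp add: B_def)
      have mem: "n \<in> J w \<longleftrightarrow> R (B * real n powr (c / (1 - b))) (real n)" if "0 < n" for n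
      proof -
        have eq: "B * real n powr (c / (1 - b)) = h n * w"
          using stat_eq[OF b Q k0, of "real n" c] that by (simp add: B_def h_def)
        have hn: "0 < h n" unfolding h_def by (rule stat_pos[OF b(1) Q k0]) (use that in simp)
        show ?thesis unfolding eq RUV J_def I_def using hn by (auto simp: field_simps)
      qed
      have J0: "0 < n" if "n \<in> J w" for n using that I(1)[of n] N by (auto simp: J_def)
      have "finite (J w)" unfolding J_def using finI by simp
      then show ?thesis
      proof (rule finite_convex_nat_set)
        fix x y z assume xz: "x \<in> J w" "z \<in> J w" and y: "x \<le> y" "y \<le> z"
        have "R (B * real y powr (c / (1 - b))) (real y)"
          using conv B xz y mem[of x] mem[of z] J0 by (meson of_nat_le_iff)
        then show "y \<in> J w" using mem[of y] J0[OF xz(1)] y by simp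
      qed auto
    qed
    have Sb: "norm (\<Sum>n\<in>{p..q}. e (k * h n * rho b w)) \<le> C0 * S"
      if "w \<in> {1 / \<kappa>..\<kappa>}" "\<bar>rho1 b w\<bar> \<le> s0" "N \<le> real p" "real q \<le> 2 * N" for w p q
      unfolding h_def S_def Z_def by (rule C0(2)[OF Q H N k]) (use that in \<open>auto simp: s0_def\<close>)
    have wt_small: "wt b Z w \<le> 1 / (Z * s0\<^sup>2)" if "\<not> \<bar>rho1 b w\<bar> \<le> s0" for w
    proof -
      have "s0\<^sup>2 \<le> (rho1 b w)\<^sup>2" using that s0 power_mono[of s0 "\<bar>rho1 b w\<bar>" 2] by simp
      then have "Z * s0\<^sup>2 \<le> 1 + Z * (rho1 b w)\<^sup>2" using Z by (simp add: add_increasing mult_left_mono)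
      then show ?thesis unfolding wt_def using Z s0 wt_denominator_pos[OF Z, of b w] by (intro divide_left_mono) auto
    qed
    have wt0: "0 \<le> wt b Z w" for w using wt_denominator_pos[OF Z, of b w] by (simp add: wt_def)
    have n0: "0 \<notin> {1 / \<kappa>..\<kappa>}" using \<kappa>l by auto
    note cont = continuous_on_rho_family[OF n0 Z, of b]
    \<comment> \<open>One estimate for both amplitudes: \<open>A\<close> measures the sum over
      \<open>n\<close> with cancellation where \<open>|rho1|\<close> is small, \<open>A'\<close> the
      single terms elsewhere.\<close>
    have amp: "norm (\<Sum>n\<in>I. integral {U n / h n..V n / h n} (\<lambda>w. of_real (g n w) * e (k * h n * rho b w))) \<le> 
        A * (C0 * S) * (C1 / sqrt Z) + A' * (2 * N) / (Z * s0\<^sup>2) * \<kappa>"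
      if g: "\<And>n. n \<in> I \<Longrightarrow> continuous_on {1 / \<kappa>..\<kappa>} (g n)" and A: "0 \<le> A" "0 \<le> A'"
        and g1: "\<And>w. w \<in> {1 / \<kappa>..\<kappa>} \<Longrightarrow> \<bar>rho1 b w\<bar> \<le> s0 \<Longrightarrow> 
            norm (\<Sum>n\<in>J w. of_real (g n w) * e (k * h n * rho b w)) \<le> wt b Z w * (A * (C0 * S))"
        and g2: "\<And>n w. n \<in> I \<Longrightarrow> w \<in> {1 / \<kappa>..\<kappa>} \<Longrightarrow> \<bar>g n w\<bar> \<le> wt b Z w * A'"
      for g :: "nat \<Rightarrow> real \<Rightarrow> real" and A A' :: real
    proof -
      define G where "G = (\<lambda>w. wt b Z w * (A * (C0 * S)) + A' * (2 * N) / (Z * s0\<^sup>2))"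
      have iw: "wt b Z integrable_on {1 / \<kappa>..\<kappa>}" by (intro integrable_continuous_interval cont)
      have G: "(G has_integral integral {1 / \<kappa>..\<kappa>} (wt b Z) * (A * (C0 * S)) + (\<kappa> - 1 / \<kappa>) *\<^sub>R (A' * (2 * N) / (Z * s0\<^sup>2))) {1 / \<kappa>..\<kappa>}"
        unfolding G_def
      proof (rule has_integral_add[OF has_integral_mult_left[OF integrable_integral[OF iw]]])
        show "((\<lambda>_. x) has_integral (\<kappa> - 1 / \<kappa>) *\<^sub>R x) {1 / \<kappa>..\<kappa>}" for x :: real
          using has_integral_const_real[of x "1 / \<kappa>" \<kappa>] \<kappa>l by (simp del: real_scaleR_def)
      qed
      have "norm (\<Sum>n\<in>I. integral {U n / h n..V n / h n} (\<lambda>w. of_real (g n w) * e (k * h n * rho b w))) \<le> 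
        integral {1 / \<kappa>..\<kappa>} (wt b Z) * (A * (C0 * S)) + (\<kappa> - 1 / \<kappa>) *\<^sub>R (A' * (2 * N) / (Z * s0\<^sup>2))"
      proof (rule norm_sum_integrals_le[OF finI \<kappa>l(1) _ sub G])
        fix n assume "n \<in> I"
        then show "continuous_on {1 / \<kappa>..\<kappa>} (\<lambda>w. of_real (g n w) * e (k * h n * rho b w))"
          by (intro continuous_intros g cont)
      next
        fix w assume w: "w \<in> {1 / \<kappa>..\<kappa>}"
        have pos: "0 \<le> A' * (2 * N) / (Z * s0\<^sup>2)" using A N Z by simp
        have "norm (\<Sum>n\<in>J w. of_real (g n w) * e (k * h n * rho b w)) \<le> G w"
        proof (cases "\<bar>rho1 b w\<bar> \<le> s0")
          case True
          then show ?thesis using g1[OF w True] pos by (simp add: G_def)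
        next
          case False
          have "norm (\<Sum>n\<in>J w. of_real (g n w) * e (k * h n * rho b w)) \<le> (\<Sum>n\<in>J w. A' / (Z * s0\<^sup>2))"
          proof (rule sum_norm_le)
            fix n assume "n \<in> J w"
            then have "n \<in> I" by (simp add: J_def)
            then have "\<bar>g n w\<bar> \<le> wt b Z w * A'" using g2 w by blast
            also have "\<dots> \<le> 1 / (Z * s0\<^sup>2) * A'" using wt_small[OF False] A by (intro mult_right_mono)
            finally show "norm (of_real (g n w) * e (k * h n * rho b w)) \<le> A' / (Z * s0\<^sup>2)" by (simp add: norm_mult)
          qed
          also have "\<dots> = real (card (J w)) * (A' / (Z * s0\<^sup>2))" by simp
          also have "\<dots> \<le> (2 * N) * (A' / (Z * s0\<^sup>2))"
          proof (intro mult_right_mono)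
            have "card (J w) \<le> card I" using finI by (intro card_mono) (auto simp: J_def)
            then show "real (card (J w)) \<le> 2 * N" using cardI by linarith
          qed (use A Z in auto)
          also have "\<dots> = A' * (2 * N) / (Z * s0\<^sup>2)" by simp
          also have "\<dots> \<le> G w" using wt0[of w] A C0 S by (simp add: G_def)
          finally show ?thesis .
        qed
        then show "norm (\<Sum>n\<in>{n\<in>I. w \<in> {U n / h n..V n / h n}}. of_real (g n w) * e (k * h n * rho b w)) \<le> G w"
          by (simp only: J_def)
      qed
      also have "\<dots> \<le> (C1 / sqrt Z) * (A * (C0 * S)) + \<kappa> * (A' * (2 * N) / (Z * s0\<^sup>2))"
      proof (rule add_mono)
        show "integral {1 / \<kappa>..\<kappa>} (wt b Z) * (A * (C0 * S)) \<le> (C1 / sqrt Z) * (A * (C0 * S))"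
          using A C0(1) S by (intro mult_right_mono C1(2)[OF Z]) simp
        have "0 \<le> A' * (2 * N) / (Z * s0\<^sup>2)" using A N Z by simp
        then show "(\<kappa> - 1 / \<kappa>) *\<^sub>R (A' * (2 * N) / (Z * s0\<^sup>2)) \<le> \<kappa> * (A' * (2 * N) / (Z * s0\<^sup>2))"
          unfolding real_scaleR_def using \<kappa> by (intro mult_right_mono) auto
      qed
      finally show ?thesis by (simp add: mult.commute)
    qed
    have g1': "norm (\<Sum>n\<in>J w. of_real (h n * wt b Z w) * e (k * h n * rho b w)) \<le> wt b Z w * (2 * \<kappa> * H * (C0 * S))"
      if w: "w \<in> {1 / \<kappa>..\<kappa>}" "\<bar>rho1 b w\<bar> \<le> s0" for w
    proof -
      obtain p q where pq: "J w = {p..q}" using J_interval[OF w(1)] by blast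
      show ?thesis
      proof (cases "p \<le> q")
        case False
        then show ?thesis unfolding pq using wt0[of w] \<kappa> H C0 S by simp
      next
        case True
        have pI: "n \<in> I" if "n \<in> {p..q}" for n using that unfolding pq[symmetric] by (simp add: J_def)
        \<comment> \<open>The factor \<open>h n\<close> grows with \<open>n\<close> and is removed
          by Abel summation at the cost of twice its last value.\<close>
        have "norm (\<Sum>n\<in>{p..q}. of_real (h n) * e (k * h n * rho b w)) \<le> 2 * h q * (C0 * S)"
        proof (rule abel_summation_mono[OF True])
          fix n assume n: "p \<le> n" "n < q"
          then have "n \<in> I" "Suc n \<in> I" using pI by auto
          then have "0 < real n" using I(1)[of n] N by linarith
          then show "h n \<le> h (Suc n)" unfolding h_def stat_def using b c Q k0
            by (intro powr_mono2 divide_right_mono mult_left_mono) auto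
        next
          fix r assume r: "p \<le> r" "r \<le> q"
          have "N \<le> real p" "real r \<le> 2 * N" using I(1)[OF pI] I(2)[OF pI] r by auto
          then show "norm (\<Sum>n\<in>{p..r}. e (k * h n * rho b w)) \<le> C0 * S" by (intro Sb w)
        qed (use h0[OF pI, of p] h0[OF pI, of q] True in auto)
        also have "\<dots> \<le> 2 * (\<kappa> * H) * (C0 * S)"
          using hb[OF pI, of q] True C0 S by (intro mult_right_mono) auto
        finally have "wt b Z w * norm (\<Sum>n\<in>{p..q}. of_real (h n) * e (k * h n * rho b w)) \<le> wt b Z w * (2 * (\<kappa> * H) * (C0 * S))"
          using wt0 by (intro mult_left_mono)
        moreover have "(\<Sum>n\<in>J w. of_real (h n * wt b Z w) * e (k * h n * rho b w)) =
            of_real (wt b Z w) * (\<Sum>n\<in>{p..q}. of_real (h n) * e (k * h n * rho b w))"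
          unfolding pq by (simp add: sum_distrib_left mult_ac)
        ultimately show ?thesis using wt0[of w] by (simp add: norm_mult mult.assoc)
      qed
    qed
    have T1: "norm (\<Sum>n\<in>I. integral {U n / h n..V n / h n} (\<lambda>w. of_real (h n * wt b Z w) * e (k * h n * rho b w))) \<le> 
        2 * \<kappa> * H * (C0 * S) * (C1 / sqrt Z) + \<kappa> * H * (2 * N) / (Z * s0\<^sup>2) * \<kappa>"
    proof (rule amp)
      fix n w assume "n \<in> I" "w \<in> {1 / \<kappa>..\<kappa>}"
      then show "\<bar>h n * wt b Z w\<bar> \<le> wt b Z w * (\<kappa> * H)"
        using mult_right_mono[OF hb[of n] wt0[of w]] h0[of n] wt0[of w] by (simp add: abs_mult mult_ac)
    qed (use g1' \<kappa> H in \<open>auto intro!: continuous_intros cont\<close>)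
    have rho2b: "\<bar>rho2 b w\<bar> \<le> s1" if w: "w \<in> {1 / \<kappa>..\<kappa>}" for w
    proof -
      have w0: "0 < w" using w \<kappa>l(2) by (simp only: atLeastAtMost_iff) linarith
      have "w powr (b - 2) \<le> \<kappa> powr \<bar>b - 2\<bar> * 1 powr (b - 2)"
        using w \<kappa> by (intro powr_comparable) auto
      also have "\<dots> \<le> \<kappa> powr 2" unfolding powr_one_eq_one mult_1_right using \<kappa> b by (intro powr_mono) auto
      finally have "w powr (b - 2) \<le> s1" by (simp add: s1_def)
      moreover have "\<bar>rho2 b w\<bar> \<le> 1 * w powr (b - 2)" unfolding rho2_def abs_mult using b by (intro mult_mono) auto
      ultimately show ?thesis by simp
    qed
    have tau1b: "\<bar>tau1 b Z w\<bar> \<le> wt b Z w * s1" if w: "w \<in> {1 / \<kappa>..\<kappa>}" for w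
      using abs_tau1_le[OF Z, of b w] mult_right_mono[OF rho2b[OF w] wt0[of w]] by (simp add: mult.commute)
    have T2: "norm (\<Sum>n\<in>I. integral {U n / h n..V n / h n} (\<lambda>w. of_real (tau1 b Z w) * e (k * h n * rho b w))) \<le> 
        s1 * (C0 * S) * (C1 / sqrt Z) + s1 * (2 * N) / (Z * s0\<^sup>2) * \<kappa>"
    proof (rule amp)
      fix w assume w: "w \<in> {1 / \<kappa>..\<kappa>}" "\<bar>rho1 b w\<bar> \<le> s0"
      obtain p q where pq: "J w = {p..q}" using J_interval[OF w(1)] by blast
      have "norm (\<Sum>n\<in>{p..q}. e (k * h n * rho b w)) \<le> C0 * S"
      proof (cases "p \<le> q")
        case True
        then have "p \<in> J w" "q \<in> J w" unfolding pq by auto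
        then have "p \<in> I" "q \<in> I" by (simp_all add: J_def)
        then show ?thesis using I(1)[of p] I(2)[of q] by (intro Sb w)
      qed (use C0 S in auto)
      then have "\<bar>tau1 b Z w\<bar> * norm (\<Sum>n\<in>{p..q}. e (k * h n * rho b w)) \<le> (wt b Z w * s1) * (C0 * S)"
        using tau1b[OF w(1)] by (intro mult_mono) (auto intro: order_trans[OF abs_ge_zero])
      then show "norm (\<Sum>n\<in>J w. of_real (tau1 b Z w) * e (k * h n * rho b w)) \<le> wt b Z w * (s1 * (C0 * S))"
        unfolding pq by (simp add: norm_mult mult.assoc flip: sum_distrib_left)
    qed (use tau1b s1 cont in auto)
    have Zk: "Z / k \<le> 4 / b * H"
    proof -
      have "b / 4 * (Z / H) \<le> k" using kn by (simp add: near_freq_def)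
      then show ?thesis using b H k0 Z by (simp add: field_simps)
    qed
    have "(\<Sum>n\<in>I. integral {U n..V n} (\<lambda>t. e (Q * real n powr c * t powr b - k * t)) - endpoint_term b Z k (h n) (k * h n) (U n) (V n)) =
       (\<Sum>n\<in>I. integral {U n / h n..V n / h n} (\<lambda>w. of_real (h n * wt b Z w) * e (k * h n * rho b w)))
       - of_real (Z / k) * (\<Sum>n\<in>I. integral {U n / h n..V n / h n} (\<lambda>w. of_real (tau1 b Z w) * e (k * h n * rho b w))) / (2 * pi * \<i>)"
      unfolding sum_distrib_left sum_divide_distrib sum_subtractf[symmetric]
    proof (rule sum.cong[OF refl])
      fix n assume n: "n \<in> I"
      have "0 < real n" using I(1)[OF n] N by linarith
      then have "0 < Q * real n powr c" using Q by simp
      moreover have "0 < U n" using I(3)[OF n] H by simp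
      ultimately show "integral {U n..V n} (\<lambda>t. e (Q * real n powr c * t powr b - k * t)) - endpoint_term b Z k (h n) (k * h n) (U n) (V n) =
        integral {U n / h n..V n / h n} (\<lambda>w. of_real (h n * wt b Z w) * e (k * h n * rho b w))
       - of_real (Z / k) * integral {U n / h n..V n / h n} (\<lambda>w. of_real (tau1 b Z w) * e (k * h n * rho b w)) / (2 * pi * \<i>)"
        using near_integral_by_parts[OF b _ k0 Z _ I(5)[OF n], of "Q * real n powr c" "h n"]
        by (simp add: endpoint_term_def h_def stat_def)
    qed
    also have "norm \<dots> \<le> (2 * \<kappa> * H * (C0 * S) * (C1 / sqrt Z) + \<kappa> * H * (2 * N) / (Z * s0\<^sup>2) * \<kappa>)
       + (4 / b * H) * (s1 * (C0 * S) * (C1 / sqrt Z) + s1 * (2 * N) / (Z * s0\<^sup>2) * \<kappa>)"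
    proof (intro order_trans[OF norm_triangle_ineq4] add_mono T1)
      let ?T = "\<Sum>n\<in>I. integral {U n / h n..V n / h n} (\<lambda>w. of_real (tau1 b Z w) * e (k * h n * rho b w))"
      have "norm (of_real (Z / k) * ?T / (2 * pi * \<i>)) = (Z / k) * norm ?T / (2 * pi)"
        using Z k0 by (simp add: norm_mult norm_divide)
      also have "\<dots> \<le> (Z / k) * norm ?T / 1" using pi_gt3 Z k0 by (intro divide_left_mono) auto
      also have "\<dots> \<le> (4 / b * H) * (s1 * (C0 * S) * (C1 / sqrt Z) + s1 * (2 * N) / (Z * s0\<^sup>2) * \<kappa>)"
        using Zk T2 b H by (simp only: div_by_1) (intro mult_mono, auto)
      finally show "norm (of_real (Z / k) * ?T / (2 * pi * \<i>)) \<le> (4 / b * H) * (s1 * (C0 * S) * (C1 / sqrt Z) + s1 * (2 * N) / (Z * s0\<^sup>2) * \<kappa>)" .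
    qed
    also have "\<dots> = D1 * C0 * C1 * (H * (S / sqrt Z)) + D2 * \<kappa> / s0\<^sup>2 * (H * (N / Z))"
      unfolding D1_def D2_def by (simp add: algebra_simps add_divide_distrib)
    also have "\<dots> \<le> C * (H * (S / sqrt Z)) + C * (H * (N / Z))"
    proof -
      have "D1 * C0 * C1 * (H * (S / sqrt Z)) \<le> C * (H * (S / sqrt Z))"
        using C0 C1 D \<kappa> s0 H S Z by (intro mult_right_mono) (auto simp: C_def)
      moreover have "D2 * \<kappa> / s0\<^sup>2 * (H * (N / Z)) \<le> C * (H * (N / Z))"
        using C0 C1 D \<kappa> s0 H N Z by (intro mult_right_mono) (auto simp: C_def)
      ultimately show ?thesis by simp
    qed
    finally have fin: "norm (\<Sum>n\<in>I. integral {U n..V n} (\<lambda>t. e (Q * real n powr c * t powr b - k * t))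
        - endpoint_term b Z k (h n) (k * h n) (U n) (V n)) \<le> C * (H * (S / sqrt Z)) + C * (H * (N / Z))" .
    have "C * (H * (S / sqrt Z)) + C * (H * (N / Z)) = C * H * (S / sqrt Z + N / Z)"
      by (simp add: distrib_left)
    with fin show "norm (\<Sum>n\<in>{n. U n \<le> V n}. integral {U n..V n} (\<lambda>t. e (Q * real n powr c * t powr b - k * t))
        - endpoint_term b (Q * N powr c * H powr b) k (stat b c Q k (real n)) (k * stat b c Q k (real n)) (U n) (V n))
       \<le> C * H * ((1 + sqrt (Q * N powr c * H powr b) + N / sqrt (Q * N powr c * H powr b)) / sqrt (Q * N powr c * H powr b)
             + N / (Q * N powr c * H powr b))"
      unfolding I_def[symmetric] Z_def[symmetric] S_def[symmetric] h_def by simp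
  qed
qed

section \<open>Dyadic boxes\<close>

lemma card_dyadic_nat_le:
  fixes N :: real
  assumes "1 \<le> N"
  shows "finite {n::nat. N \<le> real n \<and> real n \<le> 2 * N}"
    and "real (card {n::nat. N \<le> real n \<and> real n \<le> 2 * N}) \<le> 2 * N"
proof -
  have sub: "{n::nat. N \<le> real n \<and> real n \<le> 2 * N} \<subseteq> {1..nat \<lfloor>2 * N\<rfloor>}"
  proof
    fix n assume "n \<in> {n::nat. N \<le> real n \<and> real n \<le> 2 * N}"
    then have "1 \<le> real n" "real n \<le> 2 * N" using assms by auto
    then show "n \<in> {1..nat \<lfloor>2 * N\<rfloor>}" by (simp add: le_nat_floor)
  qed
  show "finite {n::nat. N \<le> real n \<and> real n \<le> 2 * N}" using finite_subset[OF sub] by simp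
  have "card {n::nat. N \<le> real n \<and> real n \<le> 2 * N} \<le> nat \<lfloor>2 * N\<rfloor>"
    using card_mono[OF _ sub] by simp
  also have "real (nat \<lfloor>2 * N\<rfloor>) \<le> 2 * N" using assms by simp
  finally show "real (card {n::nat. N \<le> real n \<and> real n \<le> 2 * N}) \<le> 2 * N" by simp
qed

text \<open>The sum over \<open>k\<close> is taken with absolute values. At an endpoint
  \<open>t\<close>, \<open>k * |rho1|\<close> equals the distance of \<open>k\<close> from the
  derivative of the phase at \<open>t\<close>, so \<open>abs_tau_le\<close> supplies a uniform bound
  of order \<open>H / sqrt Z\<close> and a decay in that distance, and summation costs one
  logarithm.\<close>

lemma sum_endpoint_terms_le:
  assumes b: "0 < b" "b < 1" and c: "0 < c" and Q: "0 < Q" and H: "0 < H" and N: "0 < N"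
    and Z: "Z = Q * N powr c * H powr b" and x: "N \<le> x" "x \<le> 2 * N"
    and u: "H \<le> u" "u \<le> 2 * H" and v: "H \<le> v" "v \<le> 2 * H"
    and K: "2 powr c * (Z / H) \<le> real K" and S: "S \<subseteq> {- int K..int K}" and near: "\<And>k. k \<in> S \<Longrightarrow> near_freq b c Z H (real_of_int k)"
  shows "(\<Sum>k\<in>S. norm (endpoint_term b Z k (stat b c Q k x) (k * stat b c Q k x) u v))
    \<le> 8 / b * (H / sqrt Z) + 4 * harm (2 * K + 1)"
proof -
  have Z0: "0 < Z" using Q N H by (simp add: Z)
  have k0: "0 < real_of_int k" if "k \<in> S" for k by (rule near_freq_pos[OF near[OF that] b(1) Z0 H])
  have x0: "0 < x" using x N by simp
  define g where "g = (\<lambda>t (k::int). Z / k * \<bar>tau b Z (t / stat b c Q k x)\<bar>)"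
  have G: "sum (g t) S \<le> 2 * (2 / b * (H / sqrt Z)) + 2 * 1 * harm (2 * K + 1)"
    if t: "H \<le> t" "t \<le> 2 * H" for t
  proof (rule sum_reciprocal_distance_le[OF S])
    have t0: "0 < t" using t H by simp
    have "0 \<le> b * (Q * x powr c) * t powr (b - 1)" using b Q by simp
    then show "\<bar>b * (Q * x powr c) * t powr (b - 1)\<bar> \<le> real K"
      using frequency_bounds(2)[OF b c Q H N Z x t] K by simp
    fix k assume k: "k \<in> S"
    have Zk: "Z / k \<le> 4 / b * H"
    proof -
      have "b / 4 * (Z / H) \<le> k" using near[OF k] by (simp add: near_freq_def)
      then show ?thesis using b H k0[OF k] Z0 by (simp add: field_simps)
    qed
    have "g t k \<le> (4 / b * H) * (1 / (2 * sqrt Z))"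
      unfolding g_def using Zk abs_tau_le(1)[OF Z0] b H by (intro mult_mono) auto
    then show "g t k \<le> 2 / b * (H / sqrt Z)" by simp
    have "k * rho1 b (t / stat b c Q k x) = b * (Q * x powr c) * t powr (b - 1) - k"
      by (rule power_phase_rescale(2)) (use b Q k0[OF k] x0 t0 in \<open>auto simp: stat_def\<close>)
    then have "\<bar>k - b * (Q * x powr c) * t powr (b - 1)\<bar> = \<bar>k * rho1 b (t / stat b c Q k x)\<bar>"
      by (simp add: abs_minus_commute)
    also have "\<dots> = k * \<bar>rho1 b (t / stat b c Q k x)\<bar>" using k0[OF k] by (simp add: abs_mult)
    finally have "\<bar>k - b * (Q * x powr c) * t powr (b - 1)\<bar> * g t k =
        Z * (\<bar>rho1 b (t / stat b c Q k x)\<bar> * \<bar>tau b Z (t / stat b c Q k x)\<bar>)"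
      using k0[OF k] by (simp add: g_def)
    also have "\<dots> \<le> 1" by (rule abs_tau_le(2)[OF Z0])
    finally show "\<bar>k - b * (Q * x powr c) * t powr (b - 1)\<bar> * g t k \<le> 1" .
  qed (use b H Z0 in auto)
  have "(\<Sum>k\<in>S. norm (endpoint_term b Z k (stat b c Q k x) (k * stat b c Q k x) u v)) \<le> (\<Sum>k\<in>S. g v k + g u k)"
  proof (rule sum_mono)
    fix k assume k: "k \<in> S"
    let ?h = "stat b c Q k x"
    let ?E = "of_real (tau b Z (v / ?h)) * e (k * ?h * rho b (v / ?h)) - of_real (tau b Z (u / ?h)) * e (k * ?h * rho b (u / ?h))"
    have "norm (endpoint_term b Z k ?h (k * ?h) u v) = Z / k * norm ?E / (2 * pi)"
      using Z0 k0[OF k] by (simp add: endpoint_term_def norm_mult norm_divide)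
    also have "\<dots> \<le> Z / k * norm ?E / 1" using pi_gt3 Z0 k0[OF k] by (intro divide_left_mono) auto
    also have "\<dots> \<le> Z / k * (\<bar>tau b Z (v / ?h)\<bar> + \<bar>tau b Z (u / ?h)\<bar>)"
    proof -
      have "norm ?E \<le> \<bar>tau b Z (v / ?h)\<bar> + \<bar>tau b Z (u / ?h)\<bar>"
        by (rule order_trans[OF norm_triangle_ineq4]) (simp add: norm_mult)
      then show ?thesis using Z0 k0[OF k] by (simp only: div_by_1) (intro mult_left_mono, auto)
    qed
    finally show "norm (endpoint_term b Z k ?h (k * ?h) u v) \<le> g v k + g u k"
      by (simp add: g_def distrib_left)
  qed
  also have "\<dots> = sum (g v) S + sum (g u) S" by (rule sum.distrib)
  finally show ?thesis using G[OF u] G[OF v] by simp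
qed

text \<open>For each \<open>n\<close>, Poisson summation in \<open>h\<close> has an error of
  logarithmic size, the frequencies failing \<open>near_freq\<close> fall to the first derivative
  test, and the endpoint terms give \<open>H / sqrt Z\<close> and a logarithm. Only the remaining
  integrals are summed over \<open>n\<close> first. The inner case distinction reflects that
  \<open>near_freq\<close> admits no integer unless \<open>H\<close> is at most of order
  \<open>Z\<close>.\<close>

lemma large_box_sum:
  assumes b: "0 < b" "b < 1" and c: "0 < c" "1 < b + c" and z0: "0 < z0"
  shows "\<exists>C>0. \<forall>Q H N R. 0 < Q \<longrightarrow> 1 \<le> H \<longrightarrow> 1 \<le> N \<longrightarrow> z0 \<le> Q * N powr c * H powr b \<longrightarrow> Q * N powr c * H powr b \<le> H\<^sup>2 \<longrightarrow>
     dyadic_region b c H N R \<longrightarrow> (\<forall>n::nat. \<exists>u v. {t. R t (real n)} = {u..v}) \<longrightarrow>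
     norm (\<Sum>n\<in>{n::nat. N \<le> real n \<and> real n \<le> 2 * N}. \<Sum>h\<in>{h::nat. R (real h) (real n)}. e (Q * real n powr c * real h powr b))
       \<le> C * (N * (H / sqrt (Q * N powr c * H powr b)) * (1 + ln (2 + Q * N powr c * H powr b))
            + (if H \<le> C * (Q * N powr c * H powr b) then Q * N powr c * H powr b else 0))"
proof -
  obtain C0 where C0: "C0 > 0" and C0': "\<forall>Q H N k R U V. 0 < Q \<longrightarrow> 0 < H \<longrightarrow> 1 \<le> N \<longrightarrow> near_freq b c (Q * N powr c * H powr b) H k \<longrightarrow>
     dyadic_region b c H N R \<longrightarrow>
     (\<forall>n::nat. {t. R t (real n)} = {U n..V n}) \<longrightarrow>
     norm (\<Sum>n\<in>{n. U n \<le> V n}. integral {U n..V n} (\<lambda>t. e (Q * real n powr c * t powr b - k * t))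
        - endpoint_term b (Q * N powr c * H powr b) k (stat b c Q k (real n)) (k * stat b c Q k (real n)) (U n) (V n))
       \<le> C0 * H * ((1 + sqrt (Q * N powr c * H powr b) + N / sqrt (Q * N powr c * H powr b)) / sqrt (Q * N powr c * H powr b)
             + N / (Q * N powr c * H powr b))"
    using near_frequency_sum[OF b c] by blast
  define L where "L = 2 powr c"
  have L: "1 \<le> L" unfolding L_def using c by (intro ge_one_powr_ge_zero) auto
  define Ch where "Ch = 1 + ln (4 * L + 5)"
  have Ch: "1 \<le> Ch" unfolding Ch_def using L by simp
  define C1 where "C1 = 2 * (7 + 8 * (L + 1) * Ch) + 2 * (16 / b * L + 20 / b / sqrt z0) + 2 * (8 / b + 4 * Ch) + 4 * L * C0"
  define C2 where "C2 = 2 * L * C0 * (1 + 1 / sqrt z0)"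
  define C where "C = C1 + C2 + 2 * L"
  have C12: "0 < C1" "0 < C2" using L Ch b z0 C0 by (auto simp: C1_def C2_def intro!: add_pos_pos add_pos_nonneg mult_pos_pos)
  show ?thesis
  proof (intro exI[of _ C] conjI allI impI)
    show "0 < C" using C12 L by (simp add: C_def)
    fix Q H N :: real and R :: "real \<Rightarrow> real \<Rightarrow> bool"
    assume Q: "0 < Q" and H1: "1 \<le> H" and N1: "1 \<le> N"
      and Zz: "z0 \<le> Q * N powr c * H powr b" and ZH: "Q * N powr c * H powr b \<le> H\<^sup>2"
      and reg: "dyadic_region b c H N R"
      and ex: "\<forall>n::nat. \<exists>u v. {t. R t (real n)} = {u..v}"
    have R: "(\<forall>t x. R t x \<longrightarrow> H \<le> t \<and> t \<le> 2 * H \<and> N \<le> x \<and> x \<le> 2 * N)"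
      using reg unfolding dyadic_region_def by blast
    define Z where "Z = Q * N powr c * H powr b"
    have H: "0 < H" and N: "0 < N" using H1 N1 by auto
    have Z: "0 < Z" using Q N H by (simp add: Z_def)
    note Zz = Zz[folded Z_def] and ZH = ZH[folded Z_def]
    define l where "l = 1 + ln (2 + Z)"
    have l: "1 \<le> l" using Z by (simp add: l_def)
    define r where "r = H / sqrt Z"
    \<comment> \<open>By \<open>Z \<le> H^2\<close>; it lets bounds of order \<open>N\<close> be
      absorbed into \<open>N * r * l\<close>.\<close>
    have r: "1 \<le> r"
    proof -
      have "sqrt Z \<le> H" using ZH H real_le_lsqrt[of H Z] by simp
      then show ?thesis using Z by (simp add: r_def)
    qed
    obtain U V where UV: "\<forall>n::nat. {t. R t (real n)} = {U n..V n}" using ex by metis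
    have RUV: "R t (real n) \<longleftrightarrow> U n \<le> t \<and> t \<le> V n" for t n
      using UV by (auto simp: set_eq_iff)
    define I where "I = {n. U n \<le> V n}"
    have I: "N \<le> real n" "real n \<le> 2 * N" "H \<le> U n" "U n \<le> 2 * H" "H \<le> V n" "V n \<le> 2 * H" "U n \<le> V n" if "n \<in> I" for n
      using that R RUV[of "U n" n] RUV[of "V n" n] by (auto simp: I_def)
    define Ns where "Ns = {n::nat. N \<le> real n \<and> real n \<le> 2 * N}"
    have INs: "I \<subseteq> Ns" using I by (auto simp: Ns_def)
    have fNs: "finite Ns" "real (card Ns) \<le> 2 * N" unfolding Ns_def by (rule card_dyadic_nat_le[OF N1])+
    have fI: "finite I" "real (card I) \<le> 2 * N"
      using finite_subset[OF INs fNs(1)] card_mono[OF fNs(1) INs] fNs(2) by auto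
    define M where "M = L * (Z / H)"
    have M0: "0 < M" using L Z H by (simp add: M_def)
    define K where "K = nat \<lceil>2 * M\<rceil> + 1"
    have "real (nat \<lceil>2 * M\<rceil>) = of_int \<lceil>2 * M\<rceil>" using M0 by simp
    then have K: "1 \<le> K" "2 * M \<le> real K" "real (2 * K + 1) \<le> 4 * M + 5"
      unfolding K_def by (simp_all, linarith+)
    have hK: "harm (2 * K + 1) \<le> Ch * l"
    proof -
      have "4 * M + 5 \<le> (4 * L + 5) * (2 + Z)"
      proof -
        have "Z / H \<le> Z / 1" using H1 Z by (intro divide_left_mono) auto
        then have "M \<le> L * Z" unfolding M_def using L by (intro mult_left_mono) auto
        moreover have "(4 * L + 5) * (2 + Z) = 8 * L + 10 + 4 * (L * Z) + 5 * Z" by (simp add: algebra_simps)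
        ultimately show ?thesis using L Z by linarith
      qed
      have "harm (2 * K + 1) \<le> 1 + ln (real (2 * K + 1))" by (rule harm_le_one_plus_ln) simp
      also have "ln (real (2 * K + 1)) \<le> ln ((4 * L + 5) * (2 + Z))"
        using K(3) \<open>4 * M + 5 \<le> _\<close> by (intro ln_mono) auto
      also have "\<dots> = ln (4 * L + 5) + ln (2 + Z)" using L Z by (intro ln_mult_pos) auto
      finally have "harm (2 * K + 1) \<le> Ch + ln (2 + Z)" by (simp add: Ch_def)
      also have "\<dots> \<le> Ch * 1 + Ch * ln (2 + Z)" using Ch Z mult_right_mono[of 1 Ch "ln (2 + Z)"] by simp
      also have "\<dots> = Ch * l" by (simp add: l_def distrib_left)
      finally show ?thesis .
    qed
    define \<Phi> where "\<Phi> = (\<lambda>n (k::int). integral {U n..V n} (\<lambda>t. e (Q * real n powr c * t powr b - k * t)))"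
    define \<Sigma> where "\<Sigma> = (\<lambda>n. \<Sum>h\<in>{h::nat. R (real h) (real n)}. e (Q * real n powr c * real h powr b))"
    define f where "f = (\<lambda>n t. b * (Q * real n powr c) * t powr (b - 1))"
    define f' where "f' = (\<lambda>n t. b * (Q * real n powr c) * (b - 1) * t powr (b - 1 - 1))"
    have Fd: "((\<lambda>t. Q * real n powr c * t powr b) has_real_derivative f n t) (at t within {U n..V n})"
      and fd: "(f n has_real_derivative f' n t) (at t within {U n..V n})"
      and fM: "b / 2 * (Z / H) \<le> f n t" "f n t \<le> M" and f'n: "f' n t \<le> 0" and f'L: "\<bar>f' n t\<bar> \<le> L"
      if n: "n \<in> I" and t: "t \<in> {U n..V n}" for n t
    proof -
      have tH: "H \<le> t" "t \<le> 2 * H" using t I[OF n] by auto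
      then have t0: "0 < t" using H by simp
      show "((\<lambda>t. Q * real n powr c * t powr b) has_real_derivative f n t) (at t within {U n..V n})"
        using powr_has_real_derivative[OF t0, of "Q * real n powr c" b] by (simp add: f_def mult_ac)
      show "(f n has_real_derivative f' n t) (at t within {U n..V n})"
        unfolding f_def f'_def by (rule powr_has_real_derivative[OF t0])
      show "b / 2 * (Z / H) \<le> f n t" and fM: "f n t \<le> M"
        unfolding f_def M_def L_def using frequency_bounds[OF b c(1) Q H N Z_def I(1,2)[OF n] tH] by auto
      have f0: "0 \<le> f n t" using b Q by (simp add: f_def)
      have eq: "f' n t = - ((1 - b) * f n t / t)"
      proof -
        have p: "t powr (b - 1 - 1) = t powr (b - 1) / t" using powr_diff[of t "b - 1" 1] t0 by simp
        have "x * (b - 1) * (y / t) = - ((1 - b) * (x * y) / t)" for x y using t0 by (simp add: field_simps)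
        then show ?thesis unfolding f_def f'_def p .
      qed
      have nn: "0 \<le> (1 - b) * f n t / t" using f0 b t0 by simp
      show "f' n t \<le> 0" using eq nn by simp
      have "\<bar>f' n t\<bar> = (1 - b) * f n t / t"
        by (simp only: eq abs_minus_cancel abs_of_nonneg[OF nn])
      also have "\<dots> \<le> 1 * M / H" using b f0 fM tH H by (intro frac_le mult_mono) auto
      also have "\<dots> = L * (Z / H\<^sup>2)" using H by (simp add: M_def power2_eq_square)
      \<comment> \<open>Here \<open>Z \<le> H^2\<close> bounds the second derivative, which keeps
        the error of Poisson summation up to real endpoints logarithmic.\<close>
      also have "\<dots> \<le> L * 1" using ZH H L by (intro mult_left_mono) auto
      finally show "\<bar>f' n t\<bar> \<le> L" by simp
    qed
    have cf': "continuous_on {U n..V n} (f' n)" if n: "n \<in> I" for n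
    proof -
      have "0 \<notin> {U n..V n}" using I(3)[OF n] H by auto
      then show ?thesis unfolding f'_def by (intro continuous_intros) auto
    qed
    have err: "norm (\<Sigma> n - (\<Sum>k\<in>{- int K..int K}. \<Phi> n k)) \<le> 7 + 8 * (L + 1) * (Ch * l)" if n: "n \<in> I" for n
    proof -
      have "\<Sigma> n = (\<Sum>h\<in>{\<lceil>U n\<rceil>..\<lfloor>V n\<rfloor>}. e (Q * real n powr c * real_of_int h powr b))"
        unfolding \<Sigma>_def
      proof (rule sum.reindex_bij_witness[of _ nat int])
        fix h assume "h \<in> {\<lceil>U n\<rceil>..\<lfloor>V n\<rfloor>}"
        then have h: "U n \<le> of_int h" "of_int h \<le> V n" by (auto simp: ceiling_le_iff le_floor_iff)
        then have "0 < h" using I(3)[OF n] H by linarith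
        then show "int (nat h) = h" "nat h \<in> {h::nat. R (real h) (real n)}" using h by (auto simp: RUV)
      qed (auto simp: RUV ceiling_le_iff le_floor_iff)
      moreover have "norm ((\<Sum>h\<in>{\<lceil>U n\<rceil>..\<lfloor>V n\<rfloor>}. e (Q * real n powr c * real_of_int h powr b)) - (\<Sum>k\<in>{- int K..int K}. \<Phi> n k))
        \<le> 7 + 8 * (L + 1) * harm (2 * K + 1)"
        unfolding \<Phi>_def
      proof (rule poisson_sum_real_endpoints[where f = "f n" and f' = "f' n" and \<sigma> = "-1" and M = M])
        fix t assume t: "t \<in> {U n..V n}"
        have "0 \<le> b / 2 * (Z / H)" using b Z H by simp
        then show "\<bar>f n t\<bar> \<le> M" using fM[OF n t] by linarith
      qed (use I[OF n] Fd[OF n] fd[OF n] cf'[OF n] f'n[OF n] f'L[OF n] K in auto)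
      moreover have "7 + 8 * (L + 1) * harm (2 * K + 1) \<le> 7 + 8 * (L + 1) * (Ch * l)"
        using hK L by (intro add_left_mono mult_left_mono) auto
      ultimately show ?thesis by simp
    qed
    define NK where "NK = {k\<in>{- int K..int K}. near_freq b c Z H (real_of_int k)}"
    define FK where "FK = {- int K..int K} - NK"
    have eqM: "2 powr (c + 1) * (Z / H) = 2 * M" by (simp add: M_def L_def powr_add)
    have NKs: "NK \<subseteq> {- int K..int K}" by (auto simp: NK_def)
    have far: "norm (\<Sum>k\<in>FK. \<Phi> n k) \<le> (4 * M + 5) * (4 / b * (H / Z))" if n: "n \<in> I" for n
    proof -
      have "norm (\<Phi> n k) \<le> 4 / b * (H / Z)" if k: "k \<in> FK" for k
      proof -
        \<comment> \<open>The derivative lies between \<open>2 * \<mu>\<close> and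
          \<open>M \<ge> \<mu>\<close>, so it stays at distance \<open>\<mu>\<close> from every
          \<open>k < \<mu>\<close> and from every \<open>k > 2 * M\<close>.\<close>
        define \<mu> where "\<mu> = b / 4 * (Z / H)"
        have mu: "0 < \<mu>" using b Z H by (simp add: \<mu>_def)
        have nk: "k < \<mu> \<or> 2 * M < k" 
        proof -
          have "\<not> near_freq b c Z H (real_of_int k)" using k by (auto simp: FK_def NK_def)
          then show ?thesis by (auto simp only: near_freq_def eqM \<mu>_def not_le de_Morgan_conj)
        qed
        have muM: "\<mu> \<le> M"
        proof -
          have "b / 4 \<le> L" using b L by simp
          then show ?thesis unfolding \<mu>_def M_def using Z H by (intro mult_right_mono) auto
        qed
        have "norm (\<Phi> n k) \<le> 1 / \<mu>"
          unfolding \<Phi>_def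
        proof (rule first_derivative_test[where f = "\<lambda>t. f n t - k" and f' = "f' n" and \<sigma> = "-1"])
          fix t assume t: "t \<in> {U n..V n}"
          show "((\<lambda>t. Q * real n powr c * t powr b - k * t) has_real_derivative f n t - k) (at t within {U n..V n})"
            by (rule derivative_eq_intros Fd[OF n t] refl | simp)+
          show "((\<lambda>t. f n t - k) has_real_derivative f' n t) (at t within {U n..V n})"
            by (rule derivative_eq_intros fd[OF n t] refl | simp)+
          have "2 * \<mu> = b / 2 * (Z / H)" by (simp add: \<mu>_def)
          then have "2 * \<mu> \<le> f n t" using fM(1)[OF n t] by (simp only:)
          then show "\<mu> \<le> \<bar>f n t - k\<bar>" using nk fM(2)[OF n t] muM by linarith
        qed (use I[OF n] cf'[OF n] f'n[OF n] mu in auto)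
        then show ?thesis by (simp add: \<mu>_def)
      qed
      then have "norm (\<Sum>k\<in>FK. \<Phi> n k) \<le> (\<Sum>k\<in>FK. 4 / b * (H / Z))" by (rule sum_norm_le)
      also have "\<dots> = real (card FK) * (4 / b * (H / Z))" by simp
      also have "\<dots> \<le> (4 * M + 5) * (4 / b * (H / Z))"
      proof (intro mult_right_mono)
        have "card FK \<le> card {- int K..int K}" by (intro card_mono) (auto simp: FK_def)
        also have "\<dots> = 2 * K + 1" by simp
        finally show "real (card FK) \<le> 4 * M + 5" using K(3) by linarith
      qed (use b H Z in auto)
      finally show ?thesis .
    qed
    define E where "E = (\<lambda>n (k::int). endpoint_term b Z k (stat b c Q k (real n)) (k * stat b c Q k (real n)) (U n) (V n))"
    have ends: "norm (\<Sum>k\<in>NK. E n k) \<le> 8 / b * r + 4 * (Ch * l)" if n: "n \<in> I" for n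
    proof -
      have "norm (\<Sum>k\<in>NK. E n k) \<le> (\<Sum>k\<in>NK. norm (E n k))" by (rule norm_sum)
      also have "\<dots> \<le> 8 / b * (H / sqrt Z) + 4 * harm (2 * K + 1)"
        unfolding E_def
        by (rule sum_endpoint_terms_le[OF b c(1) Q H N Z_def I(1,2)[OF n] I(3,4)[OF n] I(5,6)[OF n] _ NKs])
          (use K(2) M0 in \<open>auto simp: NK_def M_def L_def\<close>)
      finally show ?thesis using hK by (simp add: r_def)
    qed
    have near: "norm (\<Sum>n\<in>I. \<Phi> n k - E n k) \<le> C0 * H * ((1 + sqrt Z + N / sqrt Z) / sqrt Z + N / Z)" if k: "k \<in> NK" for k
    proof -
      have kn: "near_freq b c (Q * N powr c * H powr b) H (real_of_int k)" using k by (simp add: NK_def Z_def)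
      show ?thesis
        unfolding \<Phi>_def E_def I_def Z_def
        by (rule C0'[rule_format, OF Q H N1 kn reg UV[rule_format]])
    qed
    have nearsum: "norm (\<Sum>k\<in>NK. \<Sum>n\<in>I. \<Phi> n k - E n k) \<le> (if H \<le> 2 * L * Z then C2 * Z else 0) + 4 * L * C0 * N"
    proof (cases "H \<le> 2 * L * Z")
      case False
      then have "2 * M < 1" using H by (simp add: M_def field_simps)
      \<comment> \<open>A near frequency would be a positive integer not exceeding
        \<open>2 * M\<close>.\<close>
      have "NK = {}"
      proof (rule ccontr)
        assume "NK \<noteq> {}"
        then obtain k where k: "near_freq b c Z H (real_of_int k)" by (auto simp: NK_def)
        have "0 < real_of_int k" by (rule near_freq_pos[OF k b(1) Z H])
        then have "1 \<le> real_of_int k" by simp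
        moreover have "real_of_int k \<le> 2 * M" using k by (simp only: near_freq_def eqM)
        ultimately show False using \<open>2 * M < 1\<close> by linarith
      qed
      then show ?thesis using False L C0 N by simp
    next
      case True
      have "NK \<subseteq> {1..\<lfloor>2 * M\<rfloor>}"
      proof
        fix k assume "k \<in> NK"
        then have k: "near_freq b c Z H (real_of_int k)" by (auto simp: NK_def)
        have "0 < real_of_int k" by (rule near_freq_pos[OF k b(1) Z H])
        moreover have "real_of_int k \<le> 2 * M" using k by (simp only: near_freq_def eqM)
        ultimately show "k \<in> {1..\<lfloor>2 * M\<rfloor>}" by (auto simp: le_floor_iff)
      qed
      then have "card NK \<le> card {1..\<lfloor>2 * M\<rfloor>}" by (intro card_mono) auto
      also have "\<dots> = nat \<lfloor>2 * M\<rfloor>" by simp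
      finally have "real (card NK) \<le> real (nat \<lfloor>2 * M\<rfloor>)" by simp
      also have "\<dots> \<le> 2 * M" using M0 by simp
      finally have cNK: "real (card NK) \<le> 2 * M" .
      have "norm (\<Sum>k\<in>NK. \<Sum>n\<in>I. \<Phi> n k - E n k) \<le> (\<Sum>k\<in>NK. C0 * H * ((1 + sqrt Z + N / sqrt Z) / sqrt Z + N / Z))"
        by (intro sum_norm_le near)
      also have "\<dots> = real (card NK) * (C0 * H * ((1 + sqrt Z + N / sqrt Z) / sqrt Z + N / Z))" by simp
      also have "\<dots> \<le> (2 * M) * (C0 * H * ((1 + sqrt Z + N / sqrt Z) / sqrt Z + N / Z))"
        using cNK C0 H N Z by (intro mult_right_mono) auto
      also have "\<dots> = 2 * L * C0 * (Z * ((1 + sqrt Z + N / sqrt Z) / sqrt Z + N / Z))"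
        using H by (simp add: M_def)
      \<comment> \<open>The number of frequencies, of order \<open>Z / H\<close>, has cancelled the
        factor \<open>H\<close>. Of the three resulting terms, \<open>Z\<close> is kept,
        \<open>sqrt Z\<close> is absorbed by it through \<open>Z \<ge> z0\<close>, and
        \<open>N\<close> will go into \<open>N * r * l\<close>.\<close>
      also have "Z * ((1 + sqrt Z + N / sqrt Z) / sqrt Z + N / Z) = sqrt Z + Z + 2 * N"
      proof -
        have "Z / sqrt Z = sqrt Z" using Z by (simp add: real_div_sqrt)
        moreover have "Z * ((1 + sqrt Z + N / sqrt Z) / sqrt Z + N / Z) =
            Z / sqrt Z + (Z / sqrt Z) * sqrt Z + N * (Z / (sqrt Z * sqrt Z)) + N * (Z / Z)"
          by (simp add: algebra_simps add_divide_distrib)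
        ultimately show ?thesis using Z by simp
      qed
      also have "2 * L * C0 * (sqrt Z + Z + 2 * N) \<le> 2 * L * C0 * ((1 + 1 / sqrt z0) * Z + 2 * N)"
      proof -
        have "sqrt z0 \<le> sqrt Z" using Zz by simp
        then have "sqrt z0 * sqrt Z \<le> sqrt Z * sqrt Z" using Z by (intro mult_right_mono) auto
        then have "sqrt Z \<le> (1 / sqrt z0) * Z" using z0 Z by (simp add: field_simps)
        then show ?thesis using L C0 by (intro mult_left_mono) (auto simp: distrib_right)
      qed
      also have "\<dots> = C2 * Z + 4 * L * C0 * N" by (simp add: C2_def algebra_simps)
      finally show ?thesis using True by simp
    qed
    have Hz: "H / Z \<le> r / sqrt z0"
    proof -
      have "H / Z = r / sqrt Z" using Z by (simp add: r_def)
      also have "\<dots> \<le> r / sqrt z0" using Zz z0 r by (intro divide_left_mono) auto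
      finally show ?thesis .
    qed
    have far': "(4 * M + 5) * (4 / b * (H / Z)) \<le> 16 / b * L + 20 / b / sqrt z0 * r"
    proof -
      have "(4 * M + 5) * (4 / b * (H / Z)) = 16 / b * L + 20 / b * (H / Z)"
        using H Z by (simp add: M_def algebra_simps)
      also have "20 / b * (H / Z) \<le> 20 / b * (r / sqrt z0)" using Hz b by (intro mult_left_mono) auto
      finally show ?thesis by simp
    qed
    \<comment> \<open>In order: Poisson error, far frequencies, endpoint terms, and the near
      integrals without their endpoint terms. Only in the last one is the sum over \<open>n\<close>
      innermost.\<close>
    have tot: "(\<Sum>n\<in>Ns. \<Sigma> n) = (\<Sum>n\<in>I. \<Sigma> n - (\<Sum>k\<in>{- int K..int K}. \<Phi> n k)) + (\<Sum>n\<in>I. \<Sum>k\<in>FK. \<Phi> n k)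
        + (\<Sum>n\<in>I. \<Sum>k\<in>NK. E n k) + (\<Sum>k\<in>NK. \<Sum>n\<in>I. \<Phi> n k - E n k)"
    proof -
      have "(\<Sum>n\<in>Ns. \<Sigma> n) = (\<Sum>n\<in>I. \<Sigma> n)"
        by (rule sum.mono_neutral_right[OF fNs(1) INs]) (auto simp: \<Sigma>_def RUV I_def intro!: sum.neutral)
      moreover have "(\<Sum>k\<in>{- int K..int K}. \<Phi> n k) = (\<Sum>k\<in>FK. \<Phi> n k) + (\<Sum>k\<in>NK. \<Phi> n k)" for n
        unfolding FK_def by (rule sum.subset_diff[OF NKs]) simp
      moreover have "(\<Sum>k\<in>NK. \<Sum>n\<in>I. \<Phi> n k - E n k) = (\<Sum>n\<in>I. \<Sum>k\<in>NK. \<Phi> n k) - (\<Sum>n\<in>I. \<Sum>k\<in>NK. E n k)"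
        by (simp add: sum_subtractf sum.swap[of _ NK I])
      ultimately show ?thesis by (simp add: sum_subtractf sum.distrib)
    qed
    have cI: "norm (\<Sum>n\<in>I. g n) \<le> 2 * N * B" if "\<And>n. n \<in> I \<Longrightarrow> norm (g n) \<le> B" "0 \<le> B" for g :: "nat \<Rightarrow> complex" and B
    proof -
      have "norm (\<Sum>n\<in>I. g n) \<le> (\<Sum>n\<in>I. B)" by (intro sum_norm_le that)
      also have "\<dots> = real (card I) * B" by simp
      also have "\<dots> \<le> 2 * N * B" using fI that by (intro mult_right_mono) auto
      finally show ?thesis .
    qed
    have p0: "0 \<le> Ch * l" "0 \<le> r" "0 \<le> l" using Ch l r by auto
    have "norm (\<Sum>n\<in>Ns. \<Sigma> n) \<le> 2 * N * (7 + 8 * (L + 1) * (Ch * l)) + 2 * N * (16 / b * L + 20 / b / sqrt z0 * r)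
       + 2 * N * (8 / b * r + 4 * (Ch * l)) + ((if H \<le> 2 * L * Z then C2 * Z else 0) + 4 * L * C0 * N)"
      unfolding tot
    proof (intro order_trans[OF norm_triangle_ineq] add_mono nearsum cI err ends)
      show "norm (\<Sum>k\<in>FK. \<Phi> n k) \<le> 16 / b * L + 20 / b / sqrt z0 * r" if "n \<in> I" for n
        using far[OF that] far' by linarith
    qed (use p0 L b z0 in auto)
    also have "\<dots> \<le> C1 * (N * r * l) + (if H \<le> 2 * L * Z then C2 * Z else 0)"
    proof -
      have rl: "1 \<le> r * l" "l \<le> r * l" "r \<le> r * l" using r l by (auto simp: mult_ge1_I)
      have "2 * (7 + 8 * (L + 1) * (Ch * l)) \<le> 2 * (7 + 8 * (L + 1) * Ch) * (r * l)"
      proof -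
        have "8 * (L + 1) * Ch * l \<le> 8 * (L + 1) * Ch * (r * l)" using L Ch rl by (intro mult_left_mono) auto
        then show ?thesis using rl by (simp add: algebra_simps)
      qed
      moreover have "2 * (16 / b * L + 20 / b / sqrt z0 * r) \<le> 2 * (16 / b * L + 20 / b / sqrt z0) * (r * l)"
      proof -
        have "16 / b * L * 1 + 20 / b / sqrt z0 * r \<le> 16 / b * L * (r * l) + 20 / b / sqrt z0 * (r * l)"
          using rl b L z0 by (intro add_mono mult_left_mono) auto
        then have "2 * (16 / b * L * 1 + 20 / b / sqrt z0 * r) \<le> 2 * (16 / b * L * (r * l) + 20 / b / sqrt z0 * (r * l))"
          by (rule mult_left_mono) simp
        then show ?thesis by (simp only: mult_1_right distrib_right mult.assoc)
      qed
      moreover have "2 * (8 / b * r + 4 * (Ch * l)) \<le> 2 * (8 / b + 4 * Ch) * (r * l)"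
      proof -
        have "8 / b * r + 4 * Ch * l \<le> 8 / b * (r * l) + 4 * Ch * (r * l)"
          using rl b Ch by (intro add_mono mult_left_mono) auto
        then show ?thesis by (simp add: distrib_right mult.assoc)
      qed
      moreover have "4 * L * C0 * 1 \<le> 4 * L * C0 * (r * l)" using rl L C0 by (intro mult_left_mono) auto
      ultimately have "2 * (7 + 8 * (L + 1) * (Ch * l)) + 2 * (16 / b * L + 20 / b / sqrt z0 * r) + 2 * (8 / b * r + 4 * (Ch * l)) + 4 * L * C0
          \<le> C1 * (r * l)" unfolding C1_def by (simp add: distrib_right)
      then have "N * (2 * (7 + 8 * (L + 1) * (Ch * l)) + 2 * (16 / b * L + 20 / b / sqrt z0 * r) + 2 * (8 / b * r + 4 * (Ch * l)) + 4 * L * C0)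
          \<le> N * (C1 * (r * l))" using N by (intro mult_left_mono) auto
      then show ?thesis by (simp add: algebra_simps)
    qed
    also have "\<dots> \<le> C * (N * r * l) + C * (if H \<le> C * Z then Z else 0)"
    proof (intro add_mono mult_right_mono)
      show "C1 \<le> C" using C12 L by (simp add: C_def)
      show "(if H \<le> 2 * L * Z then C2 * Z else 0) \<le> C * (if H \<le> C * Z then Z else 0)"
      proof (cases "H \<le> 2 * L * Z")
        case True
        also have "2 * L * Z \<le> C * Z" using C12 Z by (intro mult_right_mono) (auto simp: C_def)
        finally have "H \<le> C * Z" .
        moreover have "C2 * Z \<le> C * Z" using C12 L Z by (intro mult_right_mono) (auto simp: C_def)
        ultimately show ?thesis using True by simp
      qed (use C12 L Z in \<open>simp add: C_def\<close>)
    qed (use N p0 in auto)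
    finally show "norm (\<Sum>n\<in>{n::nat. N \<le> real n \<and> real n \<le> 2 * N}. \<Sum>h\<in>{h::nat. R (real h) (real n)}. e (Q * real n powr c * real h powr b))
       \<le> C * (N * (H / sqrt (Q * N powr c * H powr b)) * (1 + ln (2 + Q * N powr c * H powr b))
            + (if H \<le> C * (Q * N powr c * H powr b) then Q * N powr c * H powr b else 0))"
      unfolding Ns_def \<Sigma>_def Z_def[symmetric] l_def[symmetric] r_def[symmetric] by (simp only: distrib_left)
  qed
qed

section \<open>Regions cut out by monomial inequalities\<close>

lemma powr_le_max:
  fixes x y z p :: real
  assumes "0 < x" "x \<le> y" "y \<le> z"
  shows "y powr p \<le> max (x powr p) (z powr p)"
proof (cases "0 \<le> p")
  case True
  then have "y powr p \<le> z powr p" using assms by (intro powr_mono2) auto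
  then show ?thesis by simp
next
  case False
  then have "y powr p \<le> x powr p" using assms by (intro powr_mono2') auto
  then show ?thesis by simp
qed

text \<open>The inequality amounts to \<open>t powr (p - s) \<le> \<beta> / \<alpha>\<close>, and a
  power, whatever the sign of its exponent, is largest at an end of an interval.\<close>

lemma monomial_inequality_between:
  fixes x y z \<alpha> \<beta> p s :: real
  assumes "0 < x" "x \<le> y" "y \<le> z" "0 < \<alpha>"
    and "\<alpha> * x powr p \<le> \<beta> * x powr s" "\<alpha> * z powr p \<le> \<beta> * z powr s"
  shows "\<alpha> * y powr p \<le> \<beta> * y powr s"
proof -
  have iff: "\<alpha> * t powr p \<le> \<beta> * t powr s \<longleftrightarrow> t powr (p - s) \<le> \<beta> / \<alpha>" if "0 < t" for t
    using that assms(4) by (simp add: powr_diff field_simps)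
  have "max (x powr (p - s)) (z powr (p - s)) \<le> \<beta> / \<alpha>"
    using assms iff[of x] iff[of z] by simp
  then have "y powr (p - s) \<le> \<beta> / \<alpha>" using powr_le_max[OF assms(1-3), of "p - s"] by linarith
  then show ?thesis using iff[of y] assms by simp
qed

text \<open>The cutoffs \<open>H'\<close> and \<open>N'\<close> come from the partial sums that Abel
  summation requires; \<open>q\<close> stands for the factor of \<open>D\<close> formed from
  \<open>a\<close>, \<open>b\<close>, \<open>c\<close>. The variables are real so that
  \<open>t\<close> can be integrated over and \<open>x\<close> can run along curves.\<close>

definition box_region :: "real \<Rightarrow> real \<Rightarrow> real \<Rightarrow> real \<Rightarrow> real \<Rightarrow> real \<Rightarrow> real \<Rightarrow> real \<Rightarrow> real \<Rightarrow> real \<Rightarrow> real \<Rightarrow> real \<Rightarrow> bool" where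
  "box_region a b c q m T H N H' N' t x \<longleftrightarrow> H \<le> t \<and> t \<le> 2 * H \<and> N \<le> x \<and> x \<le> 2 * N \<and> t \<le> H' \<and> x \<le> N' \<and>
     t powr b * x powr c * m powr (- a) \<le> T \<and> (t * x * m) powr (2 / 3) * q \<le> t powr b * x powr c * m powr (- a)"

text \<open>On a curve \<open>t = B * x powr \<gamma>\<close> every condition compares monomials in
  \<open>x\<close>. Upper bounds on increasing monomials pass down from \<open>z\<close>, lower
  bounds up from \<open>x\<close>, and the condition with a monomial on each side is covered by
  \<open>monomial_inequality_between\<close>.\<close>

lemma dyadic_region_box_region:
  assumes b: "0 < b" "b < 1" and c: "0 < c" and q: "0 < q" and m: "0 < m" and N: "0 < N"
  shows "dyadic_region b c H N (box_region a b c q m T H N H' N')"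
  unfolding dyadic_region_def
proof (intro conjI allI impI)
  fix t x assume "box_region a b c q m T H N H' N' t x"
  then show "H \<le> t" "t \<le> 2 * H" "N \<le> x" "x \<le> 2 * N" by (auto simp: box_region_def)
next
  fix B x y z :: real
  define \<gamma> where "\<gamma> = c / (1 - b)"
  have g: "0 \<le> \<gamma>" using b c by (simp add: \<gamma>_def)
  let ?R = "box_region a b c q m T H N H' N'"
  assume B: "0 < B" and xyz: "x \<le> y" "y \<le> z"
    and Rx: "?R (B * x powr (c / (1 - b))) x" and Rz: "?R (B * z powr (c / (1 - b))) z"
  note Rx = Rx[folded \<gamma>_def, unfolded box_region_def] and Rz = Rz[folded \<gamma>_def, unfolded box_region_def]
  have x0: "0 < x" using Rx N by auto
  have y0: "0 < y" and z0: "0 < z" using x0 xyz by auto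
  have l: "B * x powr \<gamma> \<le> B * y powr \<gamma>" "B * y powr \<gamma> \<le> B * z powr \<gamma>"
    using B xyz x0 y0 g by (auto intro!: mult_left_mono powr_mono2)
  have X: "(B * y powr \<gamma>) powr b * y powr c * m powr (- a) \<le> (B * z powr \<gamma>) powr b * z powr c * m powr (- a)"
    using l B y0 xyz b c g by (intro mult_right_mono mult_mono powr_mono2) auto
  have eq1: "(B * t powr \<gamma> * t * m) powr (2 / 3) * q = ((B * m) powr (2 / 3) * q) * t powr (2 / 3 * (\<gamma> + 1))" if "0 < t" for t
  proof -
    have "B * t powr \<gamma> * t * m = (B * m) * t powr (\<gamma> + 1)" using that by (simp add: powr_add)
    then have "(B * t powr \<gamma> * t * m) powr (2 / 3) = (B * m) powr (2 / 3) * (t powr (\<gamma> + 1)) powr (2 / 3)"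
      using B m by (simp only: powr_mult)
    then show ?thesis by (simp add: powr_powr mult.commute)
  qed
  have eq2: "(B * t powr \<gamma>) powr b * t powr c * m powr (- a) = (B powr b * m powr (- a)) * t powr (\<gamma> * b + c)" if "0 < t" for t
    using B by (simp add: powr_mult powr_powr powr_add)
  have "(B * y powr \<gamma> * y * m) powr (2 / 3) * q \<le> (B * y powr \<gamma>) powr b * y powr c * m powr (- a)"
    unfolding eq1[OF y0] eq2[OF y0]
    by (rule monomial_inequality_between[OF x0 xyz])
      (use Rx Rz B m q in \<open>auto simp: eq1[OF x0] eq1[OF z0] eq2[OF x0] eq2[OF z0]\<close>)
  then show "?R (B * y powr (c / (1 - b))) y"
    unfolding \<gamma>_def[symmetric] box_region_def using Rx Rz l X xyz by auto
qed

text \<open>A compact connected subset of the line is a closed interval; connectedness comes from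
  comparing monomials in \<open>t\<close> alone. For \<open>x\<close> out of range the empty
  interval \<open>{1..0}\<close> serves.\<close>

lemma box_region_section:
  assumes q: "0 < q" and b: "0 < b" and m: "0 < m" and N: "0 < N" and H: "0 < H"
  shows "\<exists>u v. {t. box_region a b c q m T H N H' N' t x} = {u..v}"
proof (cases "N \<le> x \<and> x \<le> 2 * N \<and> x \<le> N'")
  case False
  then have "{t. box_region a b c q m T H N H' N' t x} = {1..0}" by (auto simp: box_region_def)
  then show ?thesis by blast
next
  case True
  then have x: "0 < x" using N by auto
  define S where "S = {t. box_region a b c q m T H N H' N' t x}"
  define X where "X = (\<lambda>t. t powr b * x powr c * m powr (- a))"
  define Y where "Y = (\<lambda>t. (t * x * m) powr (2 / 3) * q)"
  have S_eq: "S = {t\<in>{H..2 * H}. t \<le> H'} \<inter> {t\<in>{H..2 * H}. X t \<le> T} \<inter> {t\<in>{H..2 * H}. Y t \<le> X t}"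
    using True by (auto simp: S_def box_region_def X_def Y_def)
  have cX: "continuous_on {H..2 * H} X" and cY: "continuous_on {H..2 * H} Y"
    unfolding X_def Y_def using H x m by (auto intro!: continuous_intros)
  have "compact S"
  proof -
    have "closed S" unfolding S_eq
      by (intro closed_Int continuous_on_closed_Collect_le cX cY continuous_intros closed_atLeastAtMost)
    moreover have "bounded S" by (rule bounded_subset[of "{H..2 * H}"]) (auto simp: S_eq)
    ultimately show ?thesis by (simp add: compact_eq_bounded_closed)
  qed
  moreover have "connected S"
    unfolding is_interval_connected_1[symmetric] is_interval_1
  proof (intro ballI allI impI)
    fix t1 t3 t assume 13: "t1 \<in> S" "t3 \<in> S" and "t1 \<le> t \<and> t \<le> t3"
    then have t: "t1 \<le> t" "t \<le> t3" by auto
    have t1: "0 < t1" using 13 H by (auto simp: S_eq)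
    then have t0: "0 < t" "0 < t3" using t by auto
    have Xm: "X t \<le> X t3" unfolding X_def using t t0 b by (intro mult_right_mono powr_mono2) auto
    have eqY: "Y r = ((x * m) powr (2 / 3) * q) * r powr (2 / 3)" if "0 < r" for r
      using that x m by (simp add: Y_def powr_mult)
    have eqX: "X r = (x powr c * m powr (- a)) * r powr b" for r by (simp add: X_def)
    have "Y t \<le> X t" unfolding eqX eqY[OF t0(1)]
      by (rule monomial_inequality_between[OF t1 t])
        (use 13 x m q in \<open>auto simp: S_eq eqX[symmetric] eqY[OF t1, symmetric] eqY[OF t0(2), symmetric]\<close>)
    then show "t \<in> S" using 13 t Xm by (auto simp: S_eq)
  qed
  ultimately show ?thesis unfolding S_def using connected_compact_interval_1 by blast
qed

lemma box_region_convex_second: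
  assumes q: "0 < q" and c: "0 < c" and m: "0 < m" and N: "0 < N" and t: "0 < t"
    and R: "box_region a b c q m T H N H' N' t x" "box_region a b c q m T H N H' N' t z" and xyz: "x \<le> y" "y \<le> z"
  shows "box_region a b c q m T H N H' N' t y"
proof -
  note R = R[unfolded box_region_def]
  have x0: "0 < x" using R N by auto
  have y0: "0 < y" and z0: "0 < z" using x0 xyz by auto
  have X: "t powr b * y powr c * m powr (- a) \<le> t powr b * z powr c * m powr (- a)"
    using y0 xyz c by (intro mult_right_mono mult_left_mono powr_mono2) auto
  have eqY: "(t * r * m) powr (2 / 3) * q = ((t * m) powr (2 / 3) * q) * r powr (2 / 3)" if "0 < r" for r
    using that t m by (simp add: powr_mult)
  have eqX: "t powr b * r powr c * m powr (- a) = (t powr b * m powr (- a)) * r powr c" for r by simp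
  have "(t * y * m) powr (2 / 3) * q \<le> t powr b * y powr c * m powr (- a)"
    unfolding eqX eqY[OF y0]
    by (rule monomial_inequality_between[OF x0 xyz])
      (use R t m q in \<open>auto simp: eqX[symmetric] eqY[OF x0, symmetric] eqY[OF z0, symmetric]\<close>)
  then show ?thesis unfolding box_region_def using R X xyz by auto
qed

text \<open>For \<open>Z \<le> H^2\<close> this is \<open>large_box_sum\<close>. Otherwise the order
  of summation is reversed and \<open>monomial_sum_bound\<close> is applied in \<open>n\<close> for
  each of the \<open>O(H)\<close> values of \<open>h\<close>, giving \<open>H * sqrt Z\<close> and
  once more \<open>N * H / sqrt Z\<close>.\<close>

lemma unweighted_box_bound:
  assumes b: "0 < b" "b < 1" and c: "0 < c" "c < 1" "1 < b + c" and z0: "0 < z0" and q: "0 < q" and \<kappa>: "0 < \<kappa>"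
  shows "\<exists>C>0. \<forall>m T H N H' N'. 0 < m \<longrightarrow> 1 \<le> H \<longrightarrow> 1 \<le> N \<longrightarrow> z0 \<le> \<kappa> * m powr (- a) * N powr c * H powr b \<longrightarrow>
     norm (\<Sum>n\<in>{n::nat. N \<le> real n \<and> real n \<le> 2 * N}. \<Sum>h\<in>{h::nat. box_region a b c q m T H N H' N' (real h) (real n)}.
        e (\<kappa> * m powr (- a) * real n powr c * real h powr b))
     \<le> C * (N * (H / sqrt (\<kappa> * m powr (- a) * N powr c * H powr b)) * (1 + ln (2 + \<kappa> * m powr (- a) * N powr c * H powr b))
        + (if \<kappa> * m powr (- a) * N powr c * H powr b \<le> H\<^sup>2
           then (if H \<le> C * (\<kappa> * m powr (- a) * N powr c * H powr b) then \<kappa> * m powr (- a) * N powr c * H powr b else 0)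
           else H * sqrt (\<kappa> * m powr (- a) * N powr c * H powr b)))"
proof -
  obtain C1 where C1: "C1 > 0" and C1': "\<forall>Q H N R. 0 < Q \<longrightarrow> 1 \<le> H \<longrightarrow> 1 \<le> N \<longrightarrow> z0 \<le> Q * N powr c * H powr b \<longrightarrow> Q * N powr c * H powr b \<le> H\<^sup>2 \<longrightarrow>
     dyadic_region b c H N R \<longrightarrow> (\<forall>n::nat. \<exists>u v. {t. R t (real n)} = {u..v}) \<longrightarrow>
     norm (\<Sum>n\<in>{n::nat. N \<le> real n \<and> real n \<le> 2 * N}. \<Sum>h\<in>{h::nat. R (real h) (real n)}. e (Q * real n powr c * real h powr b))
       \<le> C1 * (N * (H / sqrt (Q * N powr c * H powr b)) * (1 + ln (2 + Q * N powr c * H powr b))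
            + (if H \<le> C1 * (Q * N powr c * H powr b) then Q * N powr c * H powr b else 0))"
    using large_box_sum[OF b c(1,3) z0] by blast
  obtain C2 where C2: "C2 > 0" and C2': "\<forall>A N p r. A \<noteq> 0 \<longrightarrow> 0 < N \<longrightarrow> N \<le> real p \<longrightarrow> real r \<le> 2 * N \<longrightarrow>
    norm (\<Sum>n\<in>{p..r}. e (A * real n powr c)) \<le> C2 * (1 + sqrt (\<bar>A\<bar> * N powr c) + N / sqrt (\<bar>A\<bar> * N powr c))"
    using monomial_sum_bound[of c] c by auto
  define C3 where "C3 = 2 * C2 * (1 / sqrt z0 + 2)"
  have C3: "0 < C3" "2 * C2 \<le> C3" using C2 z0 by (auto simp: C3_def add_pos_pos algebra_simps)
  define C where "C = C1 + C3"
  show ?thesis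
  proof (intro exI[of _ C] conjI allI impI)
    show "0 < C" using C1 C3 by (simp add: C_def)
    fix m T H N H' N' :: real
    assume m: "0 < m" and H1: "1 \<le> H" and N1: "1 \<le> N" and Zz: "z0 \<le> \<kappa> * m powr (- a) * N powr c * H powr b"
    define Q where "Q = \<kappa> * m powr (- a)"
    define Z where "Z = Q * N powr c * H powr b"
    define R where "R = box_region a b c q m T H N H' N'"
    have Q: "0 < Q" using \<kappa> m by (simp add: Q_def)
    have H: "0 < H" and N: "0 < N" using H1 N1 by auto
    have Z: "0 < Z" using Q N H by (simp add: Z_def)
    have Zz: "z0 \<le> Z" using Zz by (simp add: Z_def Q_def)
    have reg: "dyadic_region b c H N R" unfolding R_def by (rule dyadic_region_box_region[OF b c(1) q m N])
    have sec: "\<forall>n::nat. \<exists>u v. {t. R t (real n)} = {u..v}" unfolding R_def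
      by (intro allI box_region_section[OF q b(1) m N H])
    define l where "l = 1 + ln (2 + Z)"
    have l: "1 \<le> l" using Z by (simp add: l_def)
    define Y where "Y = N * (H / sqrt Z) * l"
    have Y0: "0 \<le> Y" using N H Z l by (simp add: Y_def)
    let ?S = "\<Sum>n\<in>{n::nat. N \<le> real n \<and> real n \<le> 2 * N}. \<Sum>h\<in>{h::nat. R (real h) (real n)}. e (Q * real n powr c * real h powr b)"
    have goal: "norm ?S \<le> C * (Y + (if Z \<le> H\<^sup>2 then (if H \<le> C * Z then Z else 0) else H * sqrt Z))"
    proof (cases "Z \<le> H\<^sup>2")
      case True
      have "norm ?S \<le> C1 * (Y + (if H \<le> C1 * Z then Z else 0))"
        using C1'[rule_format, OF Q H1 N1 _ _ reg, of ] sec Zz True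
        unfolding Z_def[symmetric] l_def[symmetric] Y_def[symmetric] by blast
      also have "\<dots> \<le> C * (Y + (if H \<le> C * Z then Z else 0))"
      proof (intro mult_mono add_left_mono)
        have "C1 * Z \<le> C * Z" using C3 Z by (intro mult_right_mono) (auto simp: C_def)
        show "(if H \<le> C1 * Z then Z else 0) \<le> (if H \<le> C * Z then Z else 0)"
        proof (cases "H \<le> C1 * Z")
          case True
          then have "H \<le> C * Z" using \<open>C1 * Z \<le> C * Z\<close> by linarith
          then show ?thesis using Z by simp
        qed (use Z in simp)
      qed (use C1 C3 Y0 Z in \<open>auto simp: C_def\<close>)
      finally show ?thesis using True by simp
    next
      case False
      define Hs where "Hs = {h::nat. H \<le> real h \<and> real h \<le> 2 * H}"
      define Ns where "Ns = {n::nat. N \<le> real n \<and> real n \<le> 2 * N}"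
      have fH: "finite Hs" "real (card Hs) \<le> 2 * H" unfolding Hs_def by (rule card_dyadic_nat_le[OF H1])+
      have fN: "finite Ns" unfolding Ns_def by (rule card_dyadic_nat_le[OF N1])
      have RH: "R (real h) (real n) \<Longrightarrow> h \<in> Hs \<and> n \<in> Ns" for h n by (auto simp: R_def box_region_def Hs_def Ns_def)
      have inner: "norm (\<Sum>n\<in>{n\<in>Ns. R (real h) (real n)}. e (Q * real n powr c * real h powr b)) \<le> C2 * ((1 / sqrt z0 + 2) * sqrt Z + N / sqrt Z)"
        if h: "h \<in> Hs" for h
      proof -
        have hH: "H \<le> real h" "real h \<le> 2 * H" using h by (auto simp: Hs_def)
        have h0: "0 < real h" using hH H by simp
        define A where "A = Q * real h powr b"
        have A: "0 < A" using Q h0 by (simp add: A_def)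
        have hb: "H powr b \<le> real h powr b" using hH H b by (intro powr_mono2) auto
        have hb2: "real h powr b \<le> 2 powr b * H powr b" using hH H b powr_mono2[of b "real h" "2 * H"] by (simp add: powr_mult)
        have "(2::real) powr b \<le> 2 powr 1" using b by (intro powr_mono) auto
        then have hb3: "real h powr b \<le> 4 * H powr b" using hb2 mult_right_mono[of "2 powr b" 4 "H powr b"] by simp
        have ZA: "Z \<le> A * N powr c" using mult_left_mono[OF hb, of "Q * N powr c"] Q N by (simp add: Z_def A_def mult_ac)
        have ZA2: "A * N powr c \<le> 4 * Z" using mult_left_mono[OF hb3, of "Q * N powr c"] Q N by (simp add: Z_def A_def mult_ac)
        obtain p r where pr: "{n\<in>Ns. R (real h) (real n)} = {p..r}"
        proof (rule finite_convex_nat_set[of "{n\<in>Ns. R (real h) (real n)}"])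
          fix x y z assume "x \<in> {n\<in>Ns. R (real h) (real n)}" "z \<in> {n\<in>Ns. R (real h) (real n)}" "x \<le> y" "y \<le> z"
          then have "R (real h) (real y)"
            unfolding R_def using box_region_convex_second[OF q c(1) m N h0, of a b T H H' N' "real x" "real z" "real y"] by simp
          then show "y \<in> {n\<in>Ns. R (real h) (real n)}" using RH by blast
        qed (use fN in auto)
        have "norm (\<Sum>n\<in>{p..r}. e (A * real n powr c)) \<le> C2 * (1 + 2 * sqrt Z + N / sqrt Z)"
        proof (cases "p \<le> r")
          case False
          then show ?thesis using C2 Z N by simp
        next
          case True
          then have "p \<in> {n\<in>Ns. R (real h) (real n)}" "r \<in> {n\<in>Ns. R (real h) (real n)}" unfolding pr by auto
          then have pr': "N \<le> real p" "real r \<le> 2 * N" by (auto simp: Ns_def)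
          have "norm (\<Sum>n\<in>{p..r}. e (A * real n powr c)) \<le> C2 * (1 + sqrt (A * N powr c) + N / sqrt (A * N powr c))"
            using C2'[rule_format, of A N p r] A N pr' by simp
          also have "\<dots> \<le> C2 * (1 + sqrt (4 * Z) + N / sqrt Z)"
            using C2 ZA ZA2 Z N A by (intro mult_left_mono add_mono divide_left_mono) auto
          finally show ?thesis by (simp add: real_sqrt_mult)
        qed
        also have "\<dots> \<le> C2 * ((1 / sqrt z0 + 2) * sqrt Z + N / sqrt Z)"
        proof -
          have "1 \<le> sqrt Z / sqrt z0" using Zz z0 by simp
          then show ?thesis using C2 by (intro mult_left_mono) (auto simp: distrib_right)
        qed
        finally show ?thesis unfolding pr by (simp add: A_def mult_ac)
      qed
      have "?S = (\<Sum>n\<in>Ns. \<Sum>h\<in>Hs. if R (real h) (real n) then e (Q * real n powr c * real h powr b) else 0)"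
        unfolding Ns_def[symmetric]
      proof (rule sum.cong[OF refl])
        fix n
        have eq: "{h::nat. R (real h) (real n)} = {h\<in>Hs. R (real h) (real n)}" using RH by blast
        show "(\<Sum>h\<in>{h::nat. R (real h) (real n)}. e (Q * real n powr c * real h powr b)) =
            (\<Sum>h\<in>Hs. if R (real h) (real n) then e (Q * real n powr c * real h powr b) else 0)"
          unfolding eq by (rule sum.inter_filter[OF fH(1)])
      qed
      also have "\<dots> = (\<Sum>h\<in>Hs. \<Sum>n\<in>Ns. if R (real h) (real n) then e (Q * real n powr c * real h powr b) else 0)"
        by (rule sum.swap)
      also have "\<dots> = (\<Sum>h\<in>Hs. \<Sum>n\<in>{n\<in>Ns. R (real h) (real n)}. e (Q * real n powr c * real h powr b))"
        by (simp add: sum.inter_filter[OF fN])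
      finally have S: "?S = \<dots>" .
      have "norm ?S \<le> (\<Sum>h\<in>Hs. C2 * ((1 / sqrt z0 + 2) * sqrt Z + N / sqrt Z))"
        unfolding S by (intro sum_norm_le inner)
      also have "\<dots> = real (card Hs) * (C2 * ((1 / sqrt z0 + 2) * sqrt Z + N / sqrt Z))" by simp
      also have "\<dots> \<le> (2 * H) * (C2 * ((1 / sqrt z0 + 2) * sqrt Z + N / sqrt Z))"
        using fH C2 z0 Z N by (intro mult_right_mono) auto
      also have "\<dots> = C3 * (H * sqrt Z) + 2 * C2 * (N * (H / sqrt Z) * 1)"
        by (simp add: C3_def algebra_simps)
      also have "\<dots> \<le> C * (H * sqrt Z) + C * Y"
        unfolding Y_def using C1 C2 C3 H Z N l by (intro add_mono mult_mono) (auto simp: C_def)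
      finally show ?thesis using False by (simp add: distrib_left)
    qed
    then show "norm (\<Sum>n\<in>{n::nat. N \<le> real n \<and> real n \<le> 2 * N}. \<Sum>h\<in>{h::nat. box_region a b c q m T H N H' N' (real h) (real n)}.
        e (\<kappa> * m powr (- a) * real n powr c * real h powr b))
     \<le> C * (N * (H / sqrt (\<kappa> * m powr (- a) * N powr c * H powr b)) * (1 + ln (2 + \<kappa> * m powr (- a) * N powr c * H powr b))
        + (if \<kappa> * m powr (- a) * N powr c * H powr b \<le> H\<^sup>2
           then (if H \<le> C * (\<kappa> * m powr (- a) * N powr c * H powr b) then \<kappa> * m powr (- a) * N powr c * H powr b else 0)
           else H * sqrt (\<kappa> * m powr (- a) * N powr c * H powr b)))"
      unfolding R_def Y_def l_def Z_def Q_def .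
  qed
qed

text \<open>Two nested summations by parts. The unweighted sums over all rectangles with the same
  lower corner must obey the bound, which is why \<open>box_region\<close> carries upper cutoffs in
  both variables.\<close>

lemma abel_summation_two_variables:
  fixes F :: "nat \<Rightarrow> nat \<Rightarrow> complex" and w v :: "nat \<Rightarrow> real"
  assumes le: "p \<le> q" "p' \<le> q'"
    and w: "\<And>h. p \<le> h \<Longrightarrow> h < q \<Longrightarrow> w (Suc h) \<le> w h" "0 \<le> w q"
    and v: "\<And>n. p' \<le> n \<Longrightarrow> n < q' \<Longrightarrow> v (Suc n) \<le> v n" "0 \<le> v q'"
    and B: "\<And>r s. p \<le> r \<Longrightarrow> r \<le> q \<Longrightarrow> p' \<le> s \<Longrightarrow> s \<le> q' \<Longrightarrow> norm (\<Sum>n\<in>{p'..s}. \<Sum>h\<in>{p..r}. F h n) \<le> B"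
  shows "norm (\<Sum>h\<in>{p..q}. \<Sum>n\<in>{p'..q'}. of_real (w h * v n) * F h n) \<le> w p * (v p' * B)"
proof -
  have "norm (\<Sum>h\<in>{p..q}. of_real (w h) * (\<Sum>n\<in>{p'..q'}. of_real (v n) * F h n)) \<le> w p * (v p' * B)"
  proof (rule abel_summation_antimono[OF le(1) w])
    fix r assume r: "p \<le> r" "r \<le> q"
    have "norm (\<Sum>n\<in>{p'..q'}. of_real (v n) * (\<Sum>h\<in>{p..r}. F h n)) \<le> v p' * B"
      by (rule abel_summation_antimono[OF le(2) v]) (use B r in auto)
    then show "norm (\<Sum>h\<in>{p..r}. \<Sum>n\<in>{p'..q'}. of_real (v n) * F h n) \<le> v p' * B"
      by (subst sum.swap) (simp add: sum_distrib_left)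
  qed
  then show ?thesis by (simp add: sum_distrib_left mult.assoc)
qed

section \<open>The sum over all boxes\<close>

text \<open>Monomials in \<open>H\<close>, \<open>N\<close>, \<open>m\<close> are expressed in the
  coordinates that a box controls: the phase monomial, the length \<open>H\<close>, and the product
  \<open>H * N * m\<close>.\<close>

lemma monomial_identity:
  fixes a b c p r s H N m :: real
  assumes "0 < H" "0 < N" "0 < m"
  shows "(m powr (- a) * N powr c * H powr b) powr r * H powr p * (H * N * m) powr s =
     m powr (- a * r + s) * N powr (c * r + s) * H powr (b * r + p + s)"
proof -
  have "(m powr (- a) * N powr c * H powr b) powr r = m powr (- a * r) * N powr (c * r) * H powr (b * r)"
    using assms by (simp add: powr_mult powr_powr)
  moreover have "(H * N * m) powr s = H powr s * N powr s * m powr s"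
    using assms by (simp add: powr_mult)
  ultimately show ?thesis by (simp only: powr_add mult_ac)
qed

lemma powr_le_larger_exponent:
  fixes Z z0 x y :: real
  assumes "0 < z0" "z0 \<le> Z" "x \<le> y"
  shows "Z powr x \<le> z0 powr (x - y) * Z powr y"
proof -
  have "(Z / z0) powr x \<le> (Z / z0) powr y" using assms by (intro powr_mono) auto
  then show ?thesis using assms by (simp add: powr_divide powr_diff field_simps)
qed

text \<open>With \<open>Q = H * N * m\<close> the three left-hand sides are, up to constants,
  \<open>sqrt Q / m\<close>, \<open>Z powr (3/2) * sqrt (m / (H * N)) / m\<close> and
  \<open>Z * sqrt (H * m / N) / m\<close>. The quotients under the roots become monomials in
  \<open>Z\<close>, \<open>H\<close>, \<open>Q\<close> with positive exponents at \<open>H\<close>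
  and \<open>Q\<close>, so the upper bounds for these two may be inserted.\<close>

lemma weighted_box_exponents:
  fixes a b c z0 \<kappa> K C0 :: real
  defines "E \<equiv> 3 / 4 + (2 * a - c) / (2 * (a + c))"
  assumes abc: "0 < a" "a < c" "c < b" "b + c - a = 1" "c < 2 * a"
    and pos: "0 < z0" "0 < \<kappa>" "0 < K" "0 < C0"
  shows "\<exists>C>0. \<forall>H N m Z W. 0 < H \<longrightarrow> 0 < N \<longrightarrow> 0 < m \<longrightarrow> Z = \<kappa> * m powr (- a) * N powr c * H powr b \<longrightarrow>
     W = H powr (- 1 / 2 + b / 2) * N powr (- 1 / 2 + c / 2) * m powr (- 1 / 2 - a / 2) \<longrightarrow> z0 \<le> Z \<longrightarrow> H * N * m \<le> K * Z powr (3 / 2) \<longrightarrow>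
     W * (N * (H / sqrt Z)) \<le> C * (Z powr E / m) \<and> (H \<le> C0 * Z \<longrightarrow> W * Z \<le> C * (Z powr E / m)) \<and>
     (H \<le> sqrt Z \<longrightarrow> W * (H * sqrt Z) \<le> C * (Z powr E / m))"
proof -
  \<comment> \<open>Solutions of the linear equations \<open>exps\<close>: with \<open>r\<close>,
    \<open>s\<close>, \<open>p1\<close> the monomial of \<open>monomial_identity\<close> is
    \<open>m / (H * N)\<close>; with \<open>p2\<close> in place of \<open>p1\<close> it is
    \<open>H * m / N\<close>.\<close>
  define r where "r = - 2 / (a + c)"
  define s where "s = (c - a) / (a + c)"
  define p1 where "p1 = 2 * (b - c) / (a + c)"
  define p2 where "p2 = 2 * (a + b) / (a + c)"
  have ac: "0 < a + c" using abc by simp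
  have s: "0 < s" "0 < p1" "0 < p2" using abc by (auto simp: s_def p1_def p2_def)
  have ac0: "a + c \<noteq> 0" using ac by linarith
  have div: "(a + c) / (a + c) = 1" "- (a + c) / (a + c) = - 1" "x * (a + c) / (a + c) = x" for x
  proof -
    have "y / y = 1" "- y / y = - 1" "x * y / y = x" if "y \<noteq> 0" for x y :: real using that by simp_all
    from this[OF ac0] show "(a + c) / (a + c) = 1" "- (a + c) / (a + c) = - 1" "x * (a + c) / (a + c) = x" .
  qed
  have exps: "- a * r + s = 1" "c * r + s = - 1" "b * r + p1 + s = - 1" "b * r + p2 + s = 1"
  proof -
    have "- a * (- 2) + (c - a) = a + c" "c * (- 2) + (c - a) = - (a + c)"
      "b * (- 2) + 2 * (b - c) + (c - a) = - (a + c)" "b * (- 2) + 2 * (a + b) + (c - a) = a + c"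
      by simp_all
    then have "- a * r + s = (a + c) / (a + c)" "c * r + s = - (a + c) / (a + c)"
      "b * r + p1 + s = - (a + c) / (a + c)" "b * r + p2 + s = (a + c) / (a + c)"
      unfolding r_def s_def p1_def p2_def times_divide_eq_right add_divide_distrib[symmetric] by (simp_all only:)
    then show "- a * r + s = 1" "c * r + s = - 1" "b * r + p1 + s = - 1" "b * r + p2 + s = 1"
      by (simp_all only: div)
  qed
  \<comment> \<open>The exponent belonging to \<open>H \<le> sqrt Z\<close>, where
    \<open>H powr p2\<close> contributes only \<open>p2 / 2\<close>. It falls short of
    \<open>E\<close> by \<open>(b - c) / (2 * (a + c))\<close>.\<close>
  define E2 where "E2 = 1 + (r + p2 / 2 + 3 / 2 * s) / 2"
  have E: "E = 3 / 2 + (r + p1 + 3 / 2 * s) / 2"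
  proof -
    have "r + p1 + 3 / 2 * s = (- 2 + 2 * (b - c) + 3 / 2 * (c - a)) / (a + c)"
      unfolding r_def p1_def s_def by (simp only: times_divide_eq_right add_divide_distrib)
    also have "- 2 + 2 * (b - c) + 3 / 2 * (c - a) = - (3 / 2) * (a + c) + (2 * a - c)"
      using abc(4) by (simp add: field_simps)
    also have "(- (3 / 2) * (a + c) + (2 * a - c)) / (a + c) = - (3 / 2) + (2 * a - c) / (a + c)"
      by (simp only: add_divide_distrib[of "- (3 / 2) * (a + c)" "2 * a - c"] div)
    finally have 1: "r + p1 + 3 / 2 * s = - (3 / 2) + (2 * a - c) / (a + c)" .
    have 2: "(2 * a - c) / (2 * (a + c)) = (2 * a - c) / (a + c) / 2" by simp
    have "3 / 4 + y / 2 = 3 / 2 + (- (3 / 2) + y) / 2" for y :: real by (simp add: field_simps)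
    then show ?thesis unfolding E_def 1 2 .
  qed
  have EE2: "E2 \<le> E"
  proof -
    have "E - E2 = (1 / 2 + p1 / 2) - p2 / 4" by (simp add: E E2_def field_simps)
    also have "\<dots> = (b - c) / (2 * (a + c))"
    proof -
      have "1 / 2 = (a + c) / (2 * (a + c))" "p1 / 2 = 2 * (b - c) / (2 * (a + c))" "p2 / 4 = (a + b) / (2 * (a + c))"
      proof -
        have "1 / 2 = y / (2 * y)" "2 * z / y / 2 = 2 * z / (2 * y)" "2 * z / y / 4 = z / (2 * y)" if "y \<noteq> 0" for y z :: real
          using that by simp_all
        from this[OF ac0] show "1 / 2 = (a + c) / (2 * (a + c))" "p1 / 2 = 2 * (b - c) / (2 * (a + c))" "p2 / 4 = (a + b) / (2 * (a + c))"
          unfolding p1_def p2_def by blast+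
      qed
      moreover have "a + c + 2 * (b - c) - (a + b) = b - c" by simp
      ultimately show ?thesis by (simp only: add_divide_distrib[symmetric] diff_divide_distrib[symmetric])
    qed
    also have "\<dots> \<ge> 0" using ac abc by simp
    finally show ?thesis by simp
  qed
  \<comment> \<open>By \<open>c < 2 * a\<close>; the exponent \<open>3/4\<close> is that of the
    first term, \<open>sqrt Q / m\<close>.\<close>
  have E34: "3 / 4 \<le> E" using abc ac by (simp add: E_def)
  define k where "k = 1 / sqrt \<kappa>"
  have k: "0 < k" using pos by (simp add: k_def)
  define A1 where "A1 = k * sqrt K * z0 powr (3 / 4 - E)"
  define A2 where "A2 = k * ((1 / \<kappa>) powr r * C0 powr p1 * K powr s) powr (1 / 2)"
  define A3 where "A3 = k * ((1 / \<kappa>) powr r * K powr s) powr (1 / 2) * z0 powr (E2 - E)"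
  have A: "0 < A1" "0 < A2" "0 < A3" using k pos by (auto simp: A1_def A2_def A3_def)
  show ?thesis
  proof (intro exI[of _ "A1 + A2 + A3"] conjI allI impI)
    show "0 < A1 + A2 + A3" using A by simp
    fix H N m Z W :: real
    assume H: "0 < H" and N: "0 < N" and m: "0 < m" and Z_def: "Z = \<kappa> * m powr (- a) * N powr c * H powr b"
      and W_def: "W = H powr (- 1 / 2 + b / 2) * N powr (- 1 / 2 + c / 2) * m powr (- 1 / 2 - a / 2)"
      and Zz: "z0 \<le> Z" and P: "H * N * m \<le> K * Z powr (3 / 2)"
    have Z: "0 < Z" using Zz pos by simp
    define X where "X = m powr (- a) * N powr c * H powr b"
    have X: "0 < X" using H N m by (simp add: X_def)
    have XZ: "X = (1 / \<kappa>) * Z" using pos by (simp add: X_def Z_def)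
    define Q where "Q = H * N * m"
    have Q: "0 < Q" using H N m by (simp add: Q_def)
    \<comment> \<open>The exponents in \<open>omega\<close> are half of those of the phase minus one
      half, so the weight depends on \<open>X\<close> and \<open>Q\<close> alone.\<close>
    have W: "W = X powr (1 / 2) * Q powr (- 1 / 2)"
    proof -
      have "X powr (1 / 2) * H powr 0 * Q powr (- 1 / 2) =
          m powr (- a * (1 / 2) + - 1 / 2) * N powr (c * (1 / 2) + - 1 / 2) * H powr (b * (1 / 2) + 0 + - 1 / 2)"
        unfolding X_def Q_def by (rule monomial_identity[OF H N m])
      then show ?thesis using H by (simp add: W_def mult_ac algebra_simps)
    qed
    have Xk: "X powr (1 / 2) = k * sqrt Z" using Z pos by (simp add: XZ k_def powr_half_sqrt real_sqrt_divide)
    have sq: "Q powr (- 1 / 2) = 1 / sqrt Q" using Q by (simp add: powr_minus_divide powr_half_sqrt)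
    have W': "W = k * sqrt Z / sqrt Q" unfolding W Xk sq by simp
    have C: "A * (Z powr E / m) \<le> (A1 + A2 + A3) * (Z powr E / m)" if "A \<in> {A1, A2, A3}" for A
      using that A m by (intro mult_right_mono) auto
    have sqQ: "sqrt Q \<le> sqrt K * Z powr (3 / 4)"
    proof -
      have "sqrt Q \<le> sqrt (K * Z powr (3 / 2))" using P by (simp add: Q_def)
      also have "sqrt (Z powr (3 / 2)) = Z powr (3 / 4)" using Z by (simp add: powr_half_sqrt[symmetric] powr_powr)
      then have "sqrt (K * Z powr (3 / 2)) = sqrt K * Z powr (3 / 4)" by (simp add: real_sqrt_mult)
      finally show ?thesis .
    qed
    have "W * (N * (H / sqrt Z)) = k * (N * H / sqrt Q)" using Z by (simp add: W')
    also have "N * H / sqrt Q = sqrt Q / m"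
    proof -
      have "N * H * m = sqrt Q * sqrt Q" using Q by (simp add: Q_def)
      then show ?thesis using Q m by (simp add: field_simps)
    qed
    also have "k * (sqrt Q / m) \<le> k * ((sqrt K * Z powr (3 / 4)) / m)"
      using sqQ k m by (intro mult_left_mono divide_right_mono) auto
    also have "\<dots> \<le> k * ((sqrt K * (z0 powr (3 / 4 - E) * Z powr E)) / m)"
      using powr_le_larger_exponent[OF pos(1) Zz E34] k m pos by (intro mult_left_mono divide_right_mono) auto
    also have "\<dots> = A1 * (Z powr E / m)" by (simp add: A1_def)
    also have "\<dots> \<le> (A1 + A2 + A3) * (Z powr E / m)" by (rule C) simp
    finally show "W * (N * (H / sqrt Z)) \<le> (A1 + A2 + A3) * (Z powr E / m)" .
    have Xr: "X powr r = (1 / \<kappa>) powr r * Z powr r" using Z pos unfolding XZ by (intro powr_mult) 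
    have Qs: "Q powr s \<le> K powr s * Z powr (3 / 2 * s)"
    proof -
      have "Q powr s \<le> (K * Z powr (3 / 2)) powr s" using P Q s by (intro powr_mono2) (auto simp: Q_def)
      also have "\<dots> = K powr s * Z powr (3 / 2 * s)" using pos by (simp add: powr_mult powr_powr)
      finally show ?thesis .
    qed
    {
      assume HC: "H \<le> C0 * Z"
      have id: "X powr r * H powr p1 * Q powr s = m / (H * N)"
      proof -
        have "X powr r * H powr p1 * Q powr s = m powr (- a * r + s) * N powr (c * r + s) * H powr (b * r + p1 + s)"
          unfolding X_def Q_def by (rule monomial_identity[OF H N m])
        then show ?thesis unfolding exps using H N m by (simp add: powr_minus_divide)
      qed
      have "H powr p1 \<le> (C0 * Z) powr p1" using HC H s by (intro powr_mono2) auto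
      also have "\<dots> = C0 powr p1 * Z powr p1" using pos Z by (simp add: powr_mult)
      finally have Hp: "H powr p1 \<le> C0 powr p1 * Z powr p1" .
      have "m / (H * N) \<le> ((1 / \<kappa>) powr r * Z powr r) * (C0 powr p1 * Z powr p1) * (K powr s * Z powr (3 / 2 * s))"
        unfolding id[symmetric] Xr using Hp Qs by (intro mult_mono) auto
      also have "\<dots> = ((1 / \<kappa>) powr r * C0 powr p1 * K powr s) * Z powr (r + p1 + 3 / 2 * s)"
        by (simp add: powr_add mult_ac)
      finally have mHN: "m / (H * N) \<le> ((1 / \<kappa>) powr r * C0 powr p1 * K powr s) * Z powr (r + p1 + 3 / 2 * s)" .
      have "W * Z = k * (sqrt Z * Z) * sqrt (m / (H * N)) / m"
      proof -
        have "1 / sqrt Q = sqrt (m / (H * N)) / m"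
        proof -
          have "m / (H * N) = m\<^sup>2 / Q" using H N m by (simp add: Q_def power2_eq_square)
          then show ?thesis using m Q by (simp add: real_sqrt_divide)
        qed
        then show ?thesis unfolding W' by (metis (no_types, opaque_lifting) mult.assoc mult.commute mult_1_right times_divide_eq_right)
      qed
      also have "sqrt Z * Z = Z powr (3 / 2)" using Z powr_add[of Z "1 / 2" 1] by (simp add: powr_half_sqrt)
      also have "k * Z powr (3 / 2) * sqrt (m / (H * N)) / m \<le> k * Z powr (3 / 2) * sqrt (((1 / \<kappa>) powr r * C0 powr p1 * K powr s) * Z powr (r + p1 + 3 / 2 * s)) / m"
        using mHN k m by (intro divide_right_mono mult_left_mono) auto
      also have "sqrt (((1 / \<kappa>) powr r * C0 powr p1 * K powr s) * Z powr (r + p1 + 3 / 2 * s)) =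
          ((1 / \<kappa>) powr r * C0 powr p1 * K powr s) powr (1 / 2) * Z powr ((r + p1 + 3 / 2 * s) / 2)"
        using pos Z by (simp add: powr_half_sqrt[symmetric] powr_mult powr_powr)
      also have "k * Z powr (3 / 2) * (((1 / \<kappa>) powr r * C0 powr p1 * K powr s) powr (1 / 2) * Z powr ((r + p1 + 3 / 2 * s) / 2)) / m = A2 * (Z powr E / m)"
        unfolding E A2_def by (simp add: powr_add mult_ac)
      also have "\<dots> \<le> (A1 + A2 + A3) * (Z powr E / m)" by (rule C) simp
      finally show "W * Z \<le> (A1 + A2 + A3) * (Z powr E / m)" .
    }
    {
      assume HZ: "H \<le> sqrt Z"
      have id: "X powr r * H powr p2 * Q powr s = H * m / N"
      proof -
        have "X powr r * H powr p2 * Q powr s = m powr (- a * r + s) * N powr (c * r + s) * H powr (b * r + p2 + s)"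
          unfolding X_def Q_def by (rule monomial_identity[OF H N m])
        then show ?thesis unfolding exps using H N m by (simp add: powr_minus_divide)
      qed
      have "H powr p2 \<le> (Z powr (1 / 2)) powr p2" using HZ H Z s by (intro powr_mono2) (auto simp: powr_half_sqrt)
      also have "\<dots> = Z powr (p2 / 2)" by (simp add: powr_powr)
      finally have Hp: "H powr p2 \<le> Z powr (p2 / 2)" .
      have "H * m / N \<le> ((1 / \<kappa>) powr r * Z powr r) * (Z powr (p2 / 2)) * (K powr s * Z powr (3 / 2 * s))"
        unfolding id[symmetric] Xr using Hp Qs by (intro mult_mono) auto
      also have "\<dots> = ((1 / \<kappa>) powr r * K powr s) * Z powr (r + p2 / 2 + 3 / 2 * s)"
        by (simp add: powr_add mult_ac)
      finally have HmN: "H * m / N \<le> ((1 / \<kappa>) powr r * K powr s) * Z powr (r + p2 / 2 + 3 / 2 * s)" .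
      have "W * (H * sqrt Z) = k * (sqrt Z * sqrt Z) * (H / sqrt Q)" by (simp add: W')
      also have "H / sqrt Q = sqrt (H * m / N) / m"
      proof -
        have "H * m / N = (H * m)\<^sup>2 / Q" using H N m by (simp add: Q_def power2_eq_square)
        then show ?thesis using H m Q by (simp add: real_sqrt_divide)
      qed
      also have "k * (sqrt Z * sqrt Z) * (sqrt (H * m / N) / m) \<le> k * Z * (sqrt (((1 / \<kappa>) powr r * K powr s) * Z powr (r + p2 / 2 + 3 / 2 * s)) / m)"
        using HmN k m Z H N by (intro mult_mono divide_right_mono) auto
      also have "sqrt (((1 / \<kappa>) powr r * K powr s) * Z powr (r + p2 / 2 + 3 / 2 * s)) =
          ((1 / \<kappa>) powr r * K powr s) powr (1 / 2) * Z powr ((r + p2 / 2 + 3 / 2 * s) / 2)"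
        using pos Z by (simp add: powr_half_sqrt[symmetric] powr_mult powr_powr)
      also have "k * Z * (((1 / \<kappa>) powr r * K powr s) powr (1 / 2) * Z powr ((r + p2 / 2 + 3 / 2 * s) / 2) / m) =
          k * ((1 / \<kappa>) powr r * K powr s) powr (1 / 2) * (Z powr E2 / m)"
        unfolding E2_def using Z by (simp add: powr_add mult_ac)
      also have "\<dots> \<le> k * ((1 / \<kappa>) powr r * K powr s) powr (1 / 2) * ((z0 powr (E2 - E) * Z powr E) / m)"
        using powr_le_larger_exponent[OF pos(1) Zz EE2] k m pos by (intro mult_left_mono divide_right_mono) auto
      also have "\<dots> = A3 * (Z powr E / m)" by (simp add: A3_def)
      also have "\<dots> \<le> (A1 + A2 + A3) * (Z powr E / m)" by (rule C) simp
      finally show "W * (H * sqrt Z) \<le> (A1 + A2 + A3) * (Z powr E / m)" .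
    }
  qed
qed

section \<open>Dyadic decomposition of the sum\<close>

lemma floor_log_eq_iff:
  assumes "1 \<le> h"
  shows "floor_log h = i \<longleftrightarrow> h \<in> {2 ^ i..2 ^ Suc i - 1}"
proof
  assume "floor_log h = i"
  then show "h \<in> {2 ^ i..2 ^ Suc i - 1}"
    using floor_log_exp2_le[of h] floor_log_exp2_gt[of h] assms by auto
next
  assume "h \<in> {2 ^ i..2 ^ Suc i - 1}"
  then have "2 ^ i \<le> h" "h < 2 * 2 ^ i" using assms by auto
  then show "floor_log h = i" using assms by (intro floor_log_eqI) auto
qed

lemma log_power_bound:
  fixes \<delta> A :: real
  assumes "0 < \<delta>" "0 < A"
  shows "\<exists>C>0. \<forall>T\<ge>1. 1 + ln (2 + A * T powr (3 / 2)) \<le> C * T powr \<delta>"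
proof (intro exI[of _ "1 + ln (2 + A) + (3 / 2) / \<delta>"] conjI allI impI)
  have l: "0 \<le> ln (2 + A)" using assms by simp
  then show "0 < 1 + ln (2 + A) + (3 / 2) / \<delta>" using assms by (simp add: add_pos_nonneg)
  fix T :: real assume T: "1 \<le> T"
  have "1 \<le> T powr (3 / 2)" using T by (intro ge_one_powr_ge_zero) auto
  then have "2 + A * T powr (3 / 2) \<le> (2 + A) * T powr (3 / 2)" by (simp add: distrib_right)
  then have "ln (2 + A * T powr (3 / 2)) \<le> ln ((2 + A) * T powr (3 / 2))"
    using assms T by (intro ln_mono) (auto intro!: add_pos_pos)
  also have "\<dots> = ln (2 + A) + 3 / 2 * ln T" using assms T by (simp add: ln_mult ln_powr)
  also have "\<dots> \<le> ln (2 + A) + 3 / 2 * (T powr \<delta> / \<delta>)"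
    using ln_powr_bound[OF T assms(1)] by simp
  finally have 1: "1 + ln (2 + A * T powr (3 / 2)) \<le> (1 + ln (2 + A)) * 1 + (3 / 2) / \<delta> * T powr \<delta>" by simp
  have "(1 + ln (2 + A)) * 1 \<le> (1 + ln (2 + A)) * T powr \<delta>"
    using T assms l ge_one_powr_ge_zero[of T \<delta>] by (intro mult_left_mono) auto
  with 1 show "1 + ln (2 + A * T powr (3 / 2)) \<le> (1 + ln (2 + A) + (3 / 2) / \<delta>) * T powr \<delta>"
    by (simp add: distrib_right)
qed

text \<open>The size of a nonempty box is read off one of its points: comparing the corner with a
  point of \<open>D\<close> gives \<open>z0 \<le> Z \<le> \<kappa> * T\<close> and
  \<open>H * N * m \<le> K * Z powr (3/2)\<close>. The unweighted bound is uniform over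
  subrectangles, so Abel summation multiplies it only by the weight at the corner.\<close>

lemma dyadic_box_bound:
  fixes a b c :: real
  defines "E \<equiv> 3 / 4 + (2 * a - c) / (2 * (a + c))"
  assumes abc: "0 < a" "a < c" "c < b" "b + c - a = 1" "c < 2 * a" and \<kappa>: "0 < \<kappa>"
  shows "\<exists>C>0. \<forall>T i j m. 0 < T \<longrightarrow> 1 \<le> m \<longrightarrow>
    norm (\<Sum>p\<in>{p\<in>D a b c T. (\<lambda>(h, n, m). (floor_log h, floor_log n, m)) p = (i, j, m)}.
        of_real (omega a b c p) * e (\<kappa> * monom_phase a b c p))
      \<le> C * (T powr E * (1 + ln (2 + \<kappa> * T)) / real m)"
proof -
  have bc: "0 < b" "b < 1" "0 < c" "c < 1" "1 < b + c" using abc by auto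
  define q where "q = (a * b * c) powr (- 1 / 3)"
  have q: "0 < q" using abc by (simp add: q_def)
  \<comment> \<open>A point of \<open>D\<close> has phase at least \<open>q\<close>, as
    \<open>h * n * m \<ge> 1\<close>, and passing to the corner of the box loses at most
    \<open>2 powr b * 2 powr c \<le> 4\<close>.\<close>
  define z0 where "z0 = \<kappa> * q / 4"
  have z0: "0 < z0" using \<kappa> q by (simp add: z0_def)
  \<comment> \<open>From \<open>(H * N * m) powr (2/3) * q \<le> 4 * Z / \<kappa>\<close>, solved
    for the product.\<close>
  define K where "K = (4 / (\<kappa> * q)) powr (3 / 2)"
  have K: "0 < K" using \<kappa> q by (simp add: K_def)
  obtain C1 where C1: "0 < C1" and C1': "\<forall>m T H N H' N'. 0 < m \<longrightarrow> 1 \<le> H \<longrightarrow> 1 \<le> N \<longrightarrow> z0 \<le> \<kappa> * m powr (- a) * N powr c * H powr b \<longrightarrow>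
     norm (\<Sum>n\<in>{n::nat. N \<le> real n \<and> real n \<le> 2 * N}. \<Sum>h\<in>{h::nat. box_region a b c q m T H N H' N' (real h) (real n)}.
        e (\<kappa> * m powr (- a) * real n powr c * real h powr b))
     \<le> C1 * (N * (H / sqrt (\<kappa> * m powr (- a) * N powr c * H powr b)) * (1 + ln (2 + \<kappa> * m powr (- a) * N powr c * H powr b))
        + (if \<kappa> * m powr (- a) * N powr c * H powr b \<le> H\<^sup>2
           then (if H \<le> C1 * (\<kappa> * m powr (- a) * N powr c * H powr b) then \<kappa> * m powr (- a) * N powr c * H powr b else 0)
           else H * sqrt (\<kappa> * m powr (- a) * N powr c * H powr b)))"
    using unweighted_box_bound[OF bc z0 q \<kappa>] by blast
  obtain C2 where C2: "0 < C2" and C2': "\<forall>H N m Z W. 0 < H \<longrightarrow> 0 < N \<longrightarrow> 0 < m \<longrightarrow> Z = \<kappa> * m powr (- a) * N powr c * H powr b \<longrightarrow>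
     W = H powr (- 1 / 2 + b / 2) * N powr (- 1 / 2 + c / 2) * m powr (- 1 / 2 - a / 2) \<longrightarrow> z0 \<le> Z \<longrightarrow> H * N * m \<le> K * Z powr (3 / 2) \<longrightarrow>
     W * (N * (H / sqrt Z)) \<le> C2 * (Z powr E / m) \<and> (H \<le> C1 * Z \<longrightarrow> W * Z \<le> C2 * (Z powr E / m)) \<and>
     (H \<le> sqrt Z \<longrightarrow> W * (H * sqrt Z) \<le> C2 * (Z powr E / m))"
    using weighted_box_exponents[OF abc z0 \<kappa> K C1] unfolding E_def by blast
  have E0: "0 \<le> E" using abc by (simp add: E_def)
  define C where "C = 2 * C1 * C2 * \<kappa> powr E"
  show ?thesis
  proof (intro exI[of _ C] conjI allI impI)
    show "0 < C" using C1 C2 \<kappa> by (simp add: C_def)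
    fix T :: real and i j m :: nat
    assume T: "0 < T" and m1: "1 \<le> m"
    define \<Delta> where "\<Delta> = {p\<in>D a b c T. (\<lambda>(h, n, m). (floor_log h, floor_log n, m)) p = (i, j, m)}"
    define l where "l = 1 + ln (2 + \<kappa> * T)"
    have l: "1 \<le> l" using \<kappa> T by (simp add: l_def)
    have "norm (\<Sum>p\<in>\<Delta>. of_real (omega a b c p) * e (\<kappa> * monom_phase a b c p)) \<le> C * (T powr E * l / real m)"
    proof (cases "\<Delta> = {}")
      case True
      then show ?thesis using C1 C2 \<kappa> l by (simp add: C_def)
    next
      case False
      define H N where "H = (2::real) ^ i" and "N = (2::real) ^ j"
      have H1: "1 \<le> H" and N1: "1 \<le> N" by (auto simp: H_def N_def)
      have m: "0 < real m" using m1 by simp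
      define Z where "Z = \<kappa> * real m powr (- a) * N powr c * H powr b"
      have Z: "0 < Z" using \<kappa> m H1 N1 by (simp add: Z_def)
      define W where "W = H powr (- 1 / 2 + b / 2) * N powr (- 1 / 2 + c / 2) * real m powr (- 1 / 2 - a / 2)"
      define p1 q1 p2 q2 where "p1 = (2::nat) ^ i" and "q1 = (2::nat) ^ Suc i - 1" and "p2 = (2::nat) ^ j" and "q2 = (2::nat) ^ Suc j - 1"
      have le: "p1 \<le> q1" "p2 \<le> q2" by (auto simp: p1_def q1_def p2_def q2_def Suc_leI less_imp_diff_less)
      have rp: "real p1 = H" "real p2 = N" by (auto simp: p1_def p2_def H_def N_def)
      have rq: "real q1 \<le> 2 * H" "real q2 \<le> 2 * N" by (auto simp: q1_def q2_def H_def N_def of_nat_diff)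
      have pp: "1 \<le> p1" "1 \<le> p2" by (auto simp: p1_def p2_def)
      have \<Delta>_iff: "(h, n, m') \<in> \<Delta> \<longleftrightarrow> m' = m \<and> h \<in> {p1..q1} \<and> n \<in> {p2..q2} \<and> (h, n, m) \<in> D a b c T" for h n m'
      proof -
        have "1 \<le> h \<and> 1 \<le> n" if "(h, n, m) \<in> D a b c T" using that by (simp add: D_def)
        then show ?thesis unfolding \<Delta>_def p1_def q1_def p2_def q2_def
          using floor_log_eq_iff[of h i] floor_log_eq_iff[of n j] by auto
      qed
      have D_iff: "(h, n, m) \<in> D a b c T \<longleftrightarrow> 1 \<le> h \<and> 1 \<le> n \<and>
          (real h * real n * real m) powr (2 / 3) * q \<le> real h powr b * real n powr c * real m powr (- a) \<and>
          real h powr b * real n powr c * real m powr (- a) \<le> T" for h n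
        using m1 by (simp add: D_def monom_phase_def q_def)
      obtain h0 n0 where hn0: "h0 \<in> {p1..q1}" "n0 \<in> {p2..q2}" "(h0, n0, m) \<in> D a b c T"
        using False \<Delta>_iff by fastforce
      have h0: "H \<le> real h0" "real h0 \<le> 2 * H" using hn0(1) rp rq by (auto simp flip: rp)
      have n0: "N \<le> real n0" "real n0 \<le> 2 * N" using hn0(2) rp rq by (auto simp flip: rp)
      define X where "X = real h0 powr b * real n0 powr c * real m powr (- a)"
      have XT: "X \<le> T" and Xq: "(real h0 * real n0 * real m) powr (2 / 3) * q \<le> X"
        using hn0(3) by (auto simp: D_iff X_def)
      have ZX: "Z \<le> \<kappa> * X"
      proof -
        have "H powr b * N powr c * real m powr (- a) \<le> X" unfolding X_def
          using h0 n0 H1 N1 bc by (intro mult_right_mono mult_mono powr_mono2) auto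
        then have "\<kappa> * (H powr b * N powr c * real m powr (- a)) \<le> \<kappa> * X" using \<kappa> by (intro mult_left_mono) auto
        then show ?thesis by (simp add: Z_def mult_ac)
      qed
      have XZ: "X \<le> 4 * Z / \<kappa>"
      proof -
        have two: "(2::real) powr b \<le> 2" "(2::real) powr c \<le> 2"
          using powr_mono[of b 1 "2::real"] powr_mono[of c 1 "2::real"] bc by auto
        have "real h0 powr b \<le> (2 * H) powr b" using h0 H1 bc by (intro powr_mono2) auto
        also have "\<dots> \<le> 2 * H powr b" using H1 two mult_right_mono[OF two(1), of "H powr b"] by (simp add: powr_mult)
        finally have hb: "real h0 powr b \<le> 2 * H powr b" .
        have "real n0 powr c \<le> (2 * N) powr c" using n0 N1 bc by (intro powr_mono2) auto
        also have "\<dots> \<le> 2 * N powr c" using N1 two mult_right_mono[OF two(2), of "N powr c"] by (simp add: powr_mult)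
        finally have nc: "real n0 powr c \<le> 2 * N powr c" .
        have "X \<le> (2 * H powr b) * (2 * N powr c) * real m powr (- a)"
          unfolding X_def using hb nc by (intro mult_mono) auto
        also have "\<dots> = 4 * Z / \<kappa>" using \<kappa> by (simp add: Z_def mult_ac)
        finally show ?thesis .
      qed
      have zZ: "z0 \<le> Z"
      proof -
        have "1 * 1 * 1 \<le> real h0 * real n0 * real m" using h0 n0 m1 H1 N1 by (intro mult_mono) auto
        then have "1 \<le> (real h0 * real n0 * real m) powr (2 / 3)" by (intro ge_one_powr_ge_zero) auto
        then have "1 * q \<le> (real h0 * real n0 * real m) powr (2 / 3) * q" using q by (intro mult_right_mono) auto
        then have "q \<le> X" using Xq by linarith
        then have "q \<le> 4 * Z / \<kappa>" using XZ by simp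
        then show ?thesis using \<kappa> by (simp add: z0_def field_simps)
      qed
      have PK: "H * N * real m \<le> K * Z powr (3 / 2)"
      proof -
        define P where "P = H * N * real m"
        have P: "0 < P" using H1 N1 m by (simp add: P_def)
        have "P \<le> real h0 * real n0 * real m" unfolding P_def using h0 n0 H1 N1 by (intro mult_mono) auto
        then have "P powr (2 / 3) \<le> (real h0 * real n0 * real m) powr (2 / 3)" using P by (intro powr_mono2) auto
        then have "P powr (2 / 3) * q \<le> (real h0 * real n0 * real m) powr (2 / 3) * q" using q by (intro mult_right_mono) auto
        then have "P powr (2 / 3) * q \<le> 4 * Z / \<kappa>" using Xq XZ by linarith
        then have "P powr (2 / 3) \<le> (4 / (\<kappa> * q)) * Z" using q \<kappa> by (simp add: field_simps)
        then have "(P powr (2 / 3)) powr (3 / 2) \<le> ((4 / (\<kappa> * q)) * Z) powr (3 / 2)" by (intro powr_mono2) auto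
        moreover have "(P powr (2 / 3)) powr (3 / 2) = P" using P by (simp add: powr_powr)
        moreover have "((4 / (\<kappa> * q)) * Z) powr (3 / 2) = K * Z powr (3 / 2)"
          unfolding K_def using q \<kappa> Z by (intro powr_mult)
        ultimately show ?thesis unfolding P_def[symmetric] by (simp only:)
      qed
      define B where "B = C1 * (N * (H / sqrt Z) * (1 + ln (2 + Z)) + (if Z \<le> H\<^sup>2 then (if H \<le> C1 * Z then Z else 0) else H * sqrt Z))"
      \<comment> \<open>Points outside \<open>D\<close> count as 0, so that partial sums run over
        full rectangles, as Abel summation needs.\<close>
      define F where "F = (\<lambda>h n. if (h, n, m) \<in> D a b c T then e (\<kappa> * monom_phase a b c (h, n, m)) else 0)"
      have part: "norm (\<Sum>n\<in>{p2..s}. \<Sum>h\<in>{p1..r}. F h n) \<le> B" if r: "p1 \<le> r" "r \<le> q1" and s: "p2 \<le> s" "s \<le> q2" for r s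
      proof -
        let ?R = "\<lambda>h n. box_region a b c q (real m) T H N (real r) (real s) (real h) (real n)"
        \<comment> \<open>The cutoffs \<open>real r\<close> and \<open>real s\<close> turn the part
          of \<open>D\<close> in the rectangle with upper corner \<open>(r, s)\<close> into a
          \<open>box_region\<close>.\<close>
        have R_iff: "?R h n \<longleftrightarrow> h \<in> {p1..r} \<and> n \<in> {p2..s} \<and> (h, n, m) \<in> D a b c T" for h n
        proof -
          have "real r \<le> 2 * H" "real s \<le> 2 * N" using r s rq by linarith+
          then show ?thesis unfolding D_iff box_region_def rp[symmetric] using pp by auto
        qed
        have "(\<Sum>n\<in>{p2..s}. \<Sum>h\<in>{p1..r}. F h n) = (\<Sum>n\<in>{p2..s}. \<Sum>h\<in>{h. ?R h n}. e (\<kappa> * real m powr (- a) * real n powr c * real h powr b))"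
        proof (rule sum.cong[OF refl])
          fix n assume n: "n \<in> {p2..s}"
          have eq: "{h. ?R h n} = {h\<in>{p1..r}. (h, n, m) \<in> D a b c T}" using n R_iff by auto
          show "(\<Sum>h\<in>{p1..r}. F h n) = (\<Sum>h\<in>{h. ?R h n}. e (\<kappa> * real m powr (- a) * real n powr c * real h powr b))"
            unfolding eq F_def by (subst sum.inter_filter[symmetric]) (auto simp: monom_phase_def mult_ac)
        qed
        also have "\<dots> = (\<Sum>n\<in>{n::nat. N \<le> real n \<and> real n \<le> 2 * N}. \<Sum>h\<in>{h. ?R h n}. e (\<kappa> * real m powr (- a) * real n powr c * real h powr b))"
        proof (rule sum.mono_neutral_left)
          show "finite {n::nat. N \<le> real n \<and> real n \<le> 2 * N}" by (rule card_dyadic_nat_le(1)[OF N1])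
          show "{p2..s} \<subseteq> {n::nat. N \<le> real n \<and> real n \<le> 2 * N}" using s rq(2) by (auto simp flip: rp(2))
          show "\<forall>n\<in>{n::nat. N \<le> real n \<and> real n \<le> 2 * N} - {p2..s}. (\<Sum>h\<in>{h. ?R h n}. e (\<kappa> * real m powr (- a) * real n powr c * real h powr b)) = 0"
            unfolding R_iff by auto
        qed
        finally show ?thesis
          unfolding B_def Z_def using C1'[rule_format, OF m H1 N1, of T "real r" "real s"] zZ by (simp add: Z_def)
      qed
      \<comment> \<open>Both weights decrease, since \<open>b < 1\<close> and \<open>c < 1\<close>
        make their exponents negative.\<close>
      have W: "norm (\<Sum>h\<in>{p1..q1}. \<Sum>n\<in>{p2..q2}. of_real (real h powr (- 1 / 2 + b / 2) * real n powr (- 1 / 2 + c / 2)) * F h n)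
          \<le> real p1 powr (- 1 / 2 + b / 2) * (real p2 powr (- 1 / 2 + c / 2) * B)"
        by (rule abel_summation_two_variables[OF le]) (use part pp bc in \<open>auto intro!: powr_mono2'\<close>)
      have "(\<Sum>p\<in>\<Delta>. of_real (omega a b c p) * e (\<kappa> * monom_phase a b c p)) =
         of_real (real m powr (- 1 / 2 - a / 2)) * (\<Sum>h\<in>{p1..q1}. \<Sum>n\<in>{p2..q2}. of_real (real h powr (- 1 / 2 + b / 2) * real n powr (- 1 / 2 + c / 2)) * F h n)"
      proof -
        let ?G = "\<lambda>(h, n). of_real (omega a b c (h, n, m)) * F h n"
        have "(\<Sum>p\<in>\<Delta>. of_real (omega a b c p) * e (\<kappa> * monom_phase a b c p)) =
            (\<Sum>x\<in>{x\<in>{p1..q1} \<times> {p2..q2}. (fst x, snd x, m) \<in> D a b c T}. ?G x)"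
          by (rule sum.reindex_bij_witness[of _ "\<lambda>(h, n). (h, n, m)" "\<lambda>(h, n, m). (h, n)"])
            (auto simp: \<Delta>_iff F_def)
        also have "\<dots> = (\<Sum>x\<in>{p1..q1} \<times> {p2..q2}. if (fst x, snd x, m) \<in> D a b c T then ?G x else 0)"
          by (rule sum.inter_filter) simp
        also have "\<dots> = (\<Sum>x\<in>{p1..q1} \<times> {p2..q2}. ?G x)"
          by (rule sum.cong) (auto simp: F_def)
        also have "\<dots> = (\<Sum>h\<in>{p1..q1}. \<Sum>n\<in>{p2..q2}. of_real (omega a b c (h, n, m)) * F h n)"
          by (simp add: sum.cartesian_product)
        finally show ?thesis
          by (simp add: sum_distrib_left omega_def mult_ac)
      qed
      then have "norm (\<Sum>p\<in>\<Delta>. of_real (omega a b c p) * e (\<kappa> * monom_phase a b c p)) \<le>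
          real m powr (- 1 / 2 - a / 2) * (real p1 powr (- 1 / 2 + b / 2) * (real p2 powr (- 1 / 2 + c / 2) * B))"
        using mult_left_mono[OF W, of "real m powr (- 1 / 2 - a / 2)"] by (simp add: norm_mult)
      also have "\<dots> = W * B" unfolding rp W_def by (simp add: mult_ac)
      also have "\<dots> \<le> C1 * (C2 * (Z powr E / real m) * l + C2 * (Z powr E / real m) * l)"
      proof -
        have W0: "0 \<le> W" by (simp add: W_def)
        have HN0: "0 < H" "0 < N" using H1 N1 by auto
        note bounds = C2'[rule_format, OF HN0 m Z_def W_def zZ PK]
        have Y0: "0 \<le> C2 * (Z powr E / real m)" using C2 by simp
        have "ln (2 + Z) \<le> ln (2 + \<kappa> * T)"
        proof (intro ln_mono add_left_mono)
          show "Z \<le> \<kappa> * T" using ZX XT \<kappa> mult_left_mono[of X T \<kappa>] by linarith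
        qed (use Z in auto)
        then have ll: "1 + ln (2 + Z) \<le> l" "0 \<le> 1 + ln (2 + Z)" using Z by (auto simp: l_def)
        have "W * (N * (H / sqrt Z) * (1 + ln (2 + Z))) \<le> C2 * (Z powr E / real m) * l"
        proof -
          have "W * (N * (H / sqrt Z)) * (1 + ln (2 + Z)) \<le> C2 * (Z powr E / real m) * l"
            by (rule mult_mono[OF _ ll(1) Y0 ll(2)]) (use bounds in simp)
          then show ?thesis by (simp add: mult.assoc)
        qed
        moreover have "W * (if Z \<le> H\<^sup>2 then (if H \<le> C1 * Z then Z else 0) else H * sqrt Z) \<le> C2 * (Z powr E / real m) * 1"
        proof (cases "Z \<le> H\<^sup>2")
          case True
          then show ?thesis using bounds Y0 by simp
        next
          case False
          then have "H \<le> sqrt Z" using HN0 real_le_rsqrt[of H Z] by simp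
          then show ?thesis using bounds False by simp
        qed
        moreover have "C2 * (Z powr E / real m) * 1 \<le> C2 * (Z powr E / real m) * l" using Y0 l by (intro mult_left_mono) auto
        ultimately have "W * (N * (H / sqrt Z) * (1 + ln (2 + Z))) + W * (if Z \<le> H\<^sup>2 then (if H \<le> C1 * Z then Z else 0) else H * sqrt Z)
           \<le> C2 * (Z powr E / real m) * l + C2 * (Z powr E / real m) * l" by linarith
        then have "C1 * (W * (N * (H / sqrt Z) * (1 + ln (2 + Z))) + W * (if Z \<le> H\<^sup>2 then (if H \<le> C1 * Z then Z else 0) else H * sqrt Z))
           \<le> C1 * (C2 * (Z powr E / real m) * l + C2 * (Z powr E / real m) * l)" using C1 by (intro mult_left_mono) auto
        moreover have "W * B = C1 * (W * (N * (H / sqrt Z) * (1 + ln (2 + Z))) + W * (if Z \<le> H\<^sup>2 then (if H \<le> C1 * Z then Z else 0) else H * sqrt Z))"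
          unfolding B_def by (simp only: distrib_left mult.left_commute[of W C1])
        ultimately show ?thesis by simp
      qed
      also have "\<dots> = 2 * C1 * C2 * (Z powr E) * l / real m" by simp
      also have "\<dots> \<le> 2 * C1 * C2 * (\<kappa> powr E * T powr E) * l / real m"
      proof -
        have "Z \<le> \<kappa> * T" using ZX XT \<kappa> mult_left_mono[of X T \<kappa>] by linarith
        then have "Z powr E \<le> (\<kappa> * T) powr E" using Z E0 by (intro powr_mono2) auto
        also have "\<dots> = \<kappa> powr E * T powr E" using \<kappa> T by (simp add: powr_mult)
        finally show ?thesis using C1 C2 l m by (intro divide_right_mono mult_right_mono mult_left_mono) auto
      qed
      also have "\<dots> = C * (T powr E * l / real m)" by (simp add: C_def)
      finally show ?thesis .
    qed
    then show "norm (\<Sum>p\<in>{p\<in>D a b c T. (\<lambda>(h, n, m). (floor_log h, floor_log n, m)) p = (i, j, m)}.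
        of_real (omega a b c p) * e (\<kappa> * monom_phase a b c p))
      \<le> C * (T powr E * (1 + ln (2 + \<kappa> * T)) / real m)"
      unfolding \<Delta>_def l_def .
  qed
qed

theorem theorem1p1:
  fixes a b c :: real
  assumes "0 < a" and "a < c" and "c < b"
    and "b + c - a = 1" and "c < 2 * a"
  shows "\<exists>C>0. \<forall>\<^sub>F T in at_top.
    cmod (\<Sum>p\<in>D a b c T. of_real (omega a b c p) * e (kappa a b c * monom_phase a b c p))
      \<le> C * (T powr (5/4 - c / (4 * a)) + T powr (1/4 + (2 * a - c) / (2 * (b - c))))"
proof -
  define \<kappa> where "\<kappa> = kappa a b c"
  have \<kappa>: "0 < \<kappa>" using assms by (simp add: \<kappa>_def kappa_def eta_def)
  define q where "q = (a * b * c) powr (- 1 / 3)"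
  have q: "0 < q" using assms by (simp add: q_def)
  define E where "E = 3 / 4 + (2 * a - c) / (2 * (a + c))"
  define E1 where "E1 = 5/4 - c / (4 * a)"
  \<comment> \<open>A quarter of the gap, because four factors \<open>l\<close> have to be absorbed:
    one from the bound for a box, two from the numbers of dyadic ranges of \<open>h\<close> and
    \<open>n\<close>, one from the sum of \<open>1 / m\<close>.\<close>
  define \<delta> where "\<delta> = (E1 - E) / 4"
  have \<delta>: "0 < \<delta>"
  proof -
    \<comment> \<open>Strict because \<open>a < c\<close> gives \<open>4 * a < 2 * (a + c)\<close>
      and \<open>c < 2 * a\<close> makes the numerator positive.\<close>
    have "(2 * a - c) / (2 * (a + c)) < (2 * a - c) / (4 * a)"
      using assms by (intro divide_strict_left_mono) auto
    also have "\<dots> = 1 / 2 - c / (4 * a)" using assms by (simp add: diff_divide_distrib)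
    finally show ?thesis by (simp add: \<delta>_def E1_def E_def)
  qed
  obtain C1 where C1: "0 < C1" and C1': "\<forall>T i j m. 0 < T \<longrightarrow> 1 \<le> m \<longrightarrow>
    norm (\<Sum>p\<in>{p\<in>D a b c T. (\<lambda>(h, n, m). (floor_log h, floor_log n, m)) p = (i, j, m)}.
        of_real (omega a b c p) * e (\<kappa> * monom_phase a b c p))
      \<le> C1 * (T powr E * (1 + ln (2 + \<kappa> * T)) / real m)"
    using dyadic_box_bound[OF assms \<kappa>] unfolding E_def by blast
  \<comment> \<open>Chosen so that a single quantity \<open>l\<close> dominates the logarithm in the
    box bound as well as \<open>1 + ln P\<close>, where \<open>P\<close> bounds the products
    \<open>h * n * m\<close>.\<close>
  define A where "A = \<kappa> + (1 / q) powr (3 / 2)"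
  have A: "0 < A" using \<kappa> by (simp add: A_def add_pos_nonneg)
  obtain C2 where C2: "0 < C2" and C2': "\<forall>T\<ge>1. 1 + ln (2 + A * T powr (3 / 2)) \<le> C2 * T powr \<delta>"
    using log_power_bound[OF \<delta> A] by blast
  define C where "C = 4 * C1 * C2 ^ 4"
  have C: "0 < C" using C1 C2 by (simp add: C_def)
  have main: "cmod (\<Sum>p\<in>D a b c T. of_real (omega a b c p) * e (\<kappa> * monom_phase a b c p)) \<le> C * T powr E1" if T: "1 \<le> T" for T
  proof -
    define l where "l = 1 + ln (2 + A * T powr (3 / 2))"
    have l1: "1 \<le> l" using A by (simp add: l_def)
    have lC: "l \<le> C2 * T powr \<delta>" using C2' T by (simp add: l_def)
    have TT: "T \<le> T powr (3 / 2)" using T powr_mono[of 1 "3 / 2" T] by simp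
    have l\<kappa>: "1 + ln (2 + \<kappa> * T) \<le> l"
    proof -
      have "\<kappa> * T \<le> A * T powr (3 / 2)" using \<kappa> TT T by (intro mult_mono) (auto simp: A_def)
      moreover have "0 < 2 + \<kappa> * T" using \<kappa> T by (simp add: add_pos_pos)
      ultimately show ?thesis unfolding l_def by (intro add_left_mono ln_mono) auto
    qed
    define P where "P = nat \<lfloor>(T / q) powr (3 / 2)\<rfloor>"
    define J where "J = floor_log P"
    have bound: "1 \<le> h" "1 \<le> n" "1 \<le> m" "h * n * m \<le> P" if p: "(h, n, m) \<in> D a b c T" for h n m
    proof -
      show pos: "1 \<le> h" "1 \<le> n" "1 \<le> m" using p by (auto simp: D_def)
      have "(real h * real n * real m) powr (2 / 3) * q \<le> T" using p by (auto simp: D_def q_def)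
      then have "(real h * real n * real m) powr (2 / 3) \<le> T / q" using q by (simp add: field_simps)
      then have "((real h * real n * real m) powr (2 / 3)) powr (3 / 2) \<le> (T / q) powr (3 / 2)" by (intro powr_mono2) auto
      then have "real (h * n * m) \<le> (T / q) powr (3 / 2)" by (simp add: powr_powr)
      then show "h * n * m \<le> P" unfolding P_def by (simp add: le_nat_floor)
    qed
    have bound': "h \<le> P" "n \<le> P" "m \<le> P" if "(h, n, m) \<in> D a b c T" for h n m
    proof -
      note bd = bound[OF that]
      have "h * 1 * 1 \<le> h * n * m" "1 * n * 1 \<le> h * n * m" "1 * 1 * m \<le> h * n * m"
        using bd by (intro mult_le_mono; simp)+
      then show "h \<le> P" "n \<le> P" "m \<le> P" using bd(4) by linarith+
    qed
    show ?thesis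
    \<comment> \<open>For \<open>P = 0\<close> the set \<open>D\<close> is empty; the logarithms of
      \<open>P\<close> are meaningful only for positive \<open>P\<close>.\<close>
    proof (cases "P = 0")
      case True
      have "D a b c T = {}" using bound bound' True by fastforce
      then show ?thesis using C by simp
    next
      case False
      then have P: "1 \<le> P" by simp
      have lP: "1 + ln (real P) \<le> l"
      proof -
        have "real P \<le> (T / q) powr (3 / 2)" unfolding P_def by simp
        also have "\<dots> = (1 / q) powr (3 / 2) * T powr (3 / 2)" using q T by (simp add: powr_divide)
        also have "\<dots> \<le> 2 + A * T powr (3 / 2)" using \<kappa> by (simp add: A_def distrib_right)
        finally show ?thesis unfolding l_def using P by (intro add_left_mono ln_mono) auto
      qed
      \<comment> \<open>The factor 2 comes from \<open>ln 2 \<ge> 1/2\<close>, which gives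
        \<open>J \<le> 2 * ln P\<close>.\<close>
      have J: "real (J + 1) \<le> 2 * l"
      proof -
        have "(2::nat) ^ J \<le> P" unfolding J_def using P by (intro floor_log_exp2_le) simp
        then have "(2::real) ^ J \<le> real P" by (metis of_nat_le_iff of_nat_numeral of_nat_power)
        then have "ln ((2::real) ^ J) \<le> ln (real P)" using P by (intro ln_mono) auto
        then have "real J * ln 2 \<le> ln (real P)" by (simp add: ln_realpow)
        moreover have "1 / 2 \<le> ln (2::real)" using ln2_ge_two_thirds by simp
        then have "real J * (1 / 2) \<le> real J * ln 2" by (intro mult_left_mono) auto
        ultimately have "real J \<le> 2 * ln (real P)" by simp
        then show ?thesis using lP by simp
      qed
      let ?g = "\<lambda>(h, n, m). (floor_log h, floor_log n, m)"
      let ?t = "\<lambda>p. of_real (omega a b c p) * e (\<kappa> * monom_phase a b c p)"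
      define \<T> where "\<T> = {..J} \<times> {..J} \<times> {1..P}"
      have fD: "finite (D a b c T)" using finite_D assms by simp
      have img: "?g ` D a b c T \<subseteq> \<T>"
      proof (rule image_subsetI)
        fix p assume p: "p \<in> D a b c T"
        obtain h n m where hnm: "p = (h, n, m)" by (cases p)
        show "?g p \<in> \<T>" using bound bound' p unfolding hnm \<T>_def J_def by (auto intro!: floor_log_le_iff)
      qed
      have "(\<Sum>p\<in>D a b c T. ?t p) = (\<Sum>y\<in>\<T>. \<Sum>p\<in>{p\<in>D a b c T. ?g p = y}. ?t p)"
        by (rule sum.group[OF fD _ img, symmetric]) (simp add: \<T>_def)
      also have "cmod \<dots> \<le> (\<Sum>y\<in>\<T>. C1 * (T powr E * l * inverse (real (snd (snd y)))))"
      proof (rule sum_norm_le)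
        fix y assume y: "y \<in> \<T>"
        obtain i j m where ijm: "y = (i, j, m)" by (cases y)
        have m: "1 \<le> m" using y by (simp add: ijm \<T>_def)
        have "cmod (\<Sum>p\<in>{p\<in>D a b c T. ?g p = y}. ?t p) \<le> C1 * (T powr E * (1 + ln (2 + \<kappa> * T)) / real m)"
          unfolding ijm using C1'[rule_format, of T m i j] T m by simp
        also have "\<dots> \<le> C1 * (T powr E * l / real m)"
          using C1 l\<kappa> m by (intro mult_left_mono divide_right_mono) auto
        finally show "cmod (\<Sum>p\<in>{p\<in>D a b c T. ?g p = y}. ?t p) \<le> C1 * (T powr E * l * inverse (real (snd (snd y))))"
          by (simp add: ijm divide_inverse)
      qed
      also have "\<dots> = real (J + 1) * (real (J + 1) * (C1 * (T powr E * l * harm P)))"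
      proof -
        have "(\<Sum>y\<in>\<T>. C1 * (T powr E * l * inverse (real (snd (snd y))))) =
            (\<Sum>i\<in>{..J}. \<Sum>j\<in>{..J}. \<Sum>m\<in>{1..P}. C1 * (T powr E * l * inverse (real m)))"
          unfolding \<T>_def sum.cartesian_product' by simp
        also have "(\<Sum>m\<in>{1..P}. C1 * (T powr E * l * inverse (real m))) = C1 * (T powr E * l * harm P)"
          by (simp add: harm_def sum_distrib_left)
        finally show ?thesis by simp
      qed
      also have "\<dots> \<le> (2 * l) * ((2 * l) * (C1 * (T powr E * l * l)))"
      proof -
        have "harm P \<le> l" using harm_le_one_plus_ln[OF P] lP by linarith
        moreover have "0 \<le> (harm P :: real)" by (rule harm_nonneg)
        ultimately show ?thesis using J C1 l1 by (intro mult_mono) auto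
      qed
      also have "\<dots> = 4 * C1 * T powr E * l ^ 4" by (simp add: power4_eq_xxxx)
      also have "\<dots> \<le> 4 * C1 * T powr E * (C2 * T powr \<delta>) ^ 4"
        using lC l1 C1 by (intro mult_left_mono power_mono) auto
      also have "\<dots> = C * (T powr E * (T powr \<delta>) ^ 4)" by (simp add: C_def power_mult_distrib)
      also have "T powr E * (T powr \<delta>) ^ 4 = T powr E1"
      proof -
        have "(T powr \<delta>) ^ 4 = T powr (4 * \<delta>)" using T by (simp add: powr_power mult.commute)
        then have "T powr E * (T powr \<delta>) ^ 4 = T powr (E + 4 * \<delta>)" by (simp add: powr_add)
        moreover have "E + 4 * \<delta> = E1" using \<delta>_def by (auto simp: field_simps)
        ultimately show ?thesis by (simp only:)
      qed
      finally show ?thesis .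
    qed
  qed
  show ?thesis
  proof (intro exI[of _ C] conjI C)
    show "\<forall>\<^sub>F T in at_top. cmod (\<Sum>p\<in>D a b c T. of_real (omega a b c p) * e (kappa a b c * monom_phase a b c p))
      \<le> C * (T powr (5/4 - c / (4 * a)) + T powr (1/4 + (2 * a - c) / (2 * (b - c))))"
    proof (rule eventually_at_top_linorderI[of 1])
      fix T :: real assume T: "1 \<le> T"
      have "C * T powr E1 \<le> C * (T powr E1 + T powr (1/4 + (2 * a - c) / (2 * (b - c))))"
        using C by (intro mult_left_mono) auto
      then show "cmod (\<Sum>p\<in>D a b c T. of_real (omega a b c p) * e (kappa a b c * monom_phase a b c p))
        \<le> C * (T powr (5/4 - c / (4 * a)) + T powr (1/4 + (2 * a - c) / (2 * (b - c))))"
        using main[OF T] unfolding E1_def \<kappa>_def by linarith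
    qed
  qed
qed

end
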